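(* There is a polynomial time semi-streaming algorithm achieving an $O(k \log k)$-approximation for the problem of finding a maximum weight set subject to a $k$-extendible constraint. Assuming it takes constant space to store a single element and a single weight, the space complexity of the algorithm is $O(\rho (\log k + \log \rho))$, where $\rho$ is the maximum size of a feasible (independent) set according to the constraint.
   Context: An independence system is a pair $(\mathcal{N}, \mathcal{I})$ where $\mathcal{N}$ is a finite ground set and $\mathcal{I}$ is a non-empty collection of subsets of $\mathcal{N}$ that is down-closed (if $T \in \mathcal{I}$ and $S \subseteq T$ then $S \in \mathcal{I}$); sets in $\mathcal{I}$ are called independent. For an integer $k \geq 1$, $(\mathcal{N}, \mathcal{I})$ is a $k$-extendible system if for any two sets $S \subseteq T \subseteq \mathcal{N}$ and any element $u \notin T$ with $S \cup \{u\} \in \mathcal{I}$, there is a subset $Y \subseteq T \setminus S$ with $|Y| \leq k$ such that $(T \setminus Y) \cup \{u\} \in \mathcal{I}$. The problem: given a $k$-extendible system $(\mathcal{N}, \mathcal{I})$ and a weight function $w \colon \mathcal{N} \to \mathbb{R}_{\geq 0}$, find an independent set $S$ maximizing $w(S) = \sum_{u \in S} w(u)$. In the data stream model the elements of $\mathcal{N}$ arrive one after the other in an adversarially chosen order, the algorithm learns $w(u)$ upon the arrival of $u$, and it has access to an independence oracle answering whether a given set is in $\mathcal{I}$. An algorithm is an $\alpha$-approximation if it outputs an independent set $T$ with $w(OPT) \leq \alpha \cdot w(T)$ for an optimal solution $OPT$. A semi-streaming algorithm is a data stream algorithm with space complexity $O(\rho \cdot \mathrm{polylog}\, n)$, where $n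 = |\mathcal{N}|$ and $\rho$ is the maximum size of an independent set. *)

theory Defs
  imports Complex_Main "HOL-Library.Landau_Symbols" "HOL-Library.More_List"
begin

section \<open>Independence systems\<close>

definition independence_system :: "'a set \<Rightarrow> 'a set set \<Rightarrow> bool" where
  "independence_system N \<I> \<longleftrightarrow>
     finite N \<and> \<I> \<subseteq> Pow N \<and> \<I> \<noteq> {} \<and> (\<forall>T\<in>\<I>. \<forall>S. S \<subseteq> T \<longrightarrow> S \<in> \<I>)"

text \<open>The exchange property is required for independent \<open>T\<close>, which is the usual meaning of the term.
  Were \<open>T\<close> allowed to be dependent, even a uniform matroid of rank one on three elements would fail
  to be 1-extendible. The lemma \<open>k_extendibleI_all_subsets\<close> below shows that the version for all
  \<open>T \<subseteq> N\<close> describes a special case.\<close>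

definition k_extendible :: "nat \<Rightarrow> 'a set \<Rightarrow> 'a set set \<Rightarrow> bool" where
  "k_extendible k N \<I> \<longleftrightarrow>
     independence_system N \<I> \<and>
     (\<forall>S T u. S \<subseteq> T \<and> T \<in> \<I> \<and> u \<in> N \<and> u \<notin> T \<and> S \<union> {u} \<in> \<I> \<longrightarrow>
        (\<exists>Y. Y \<subseteq> T - S \<and> card Y \<le> k \<and> (T - Y) \<union> {u} \<in> \<I>))"

lemma k_extendibleI_all_subsets:
  assumes "independence_system N \<I>"
    and "\<And>S T u. \<lbrakk>S \<subseteq> T; T \<subseteq> N; u \<in> N; u \<notin> T; S \<union> {u} \<in> \<I>\<rbrakk> \<Longrightarrow>
           \<exists>Y. Y \<subseteq> T - S \<and> card Y \<le> k \<and> (T - Y) \<union> {u} \<in> \<I>"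
  shows "k_extendible k N \<I>"
proof -
  have "\<And>T. T \<in> \<I> \<Longrightarrow> T \<subseteq> N"
    using assms(1) by (auto simp: independence_system_def)
  then show ?thesis
    unfolding k_extendible_def using assms by meson
qed

definition indep_rank :: "'a set set \<Rightarrow> nat" where
  "indep_rank \<I> = Max (card ` \<I>)"

definition optimal :: "'a set set \<Rightarrow> ('a \<Rightarrow> real) \<Rightarrow> 'a set \<Rightarrow> bool" where
  "optimal \<I> w OPT \<longleftrightarrow> is_arg_max (\<lambda>S. \<Sum>u\<in>S. w u) (\<lambda>S. S \<in> \<I>) OPT"

definition approximates :: "real \<Rightarrow> 'a set set \<Rightarrow> ('a \<Rightarrow> real) \<Rightarrow> 'a set \<Rightarrow> bool" where
  "approximates \<alpha> \<I> w T \<longleftrightarrow>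
     T \<in> \<I> \<and> (\<forall>OPT. optimal \<I> w OPT \<longrightarrow> (\<Sum>u\<in>OPT. w u) \<le> \<alpha> * (\<Sum>u\<in>T. w u))"


section \<open>Data stream programs\<close>

text \<open>A program of type \<open>com\<close> runs on a random access machine with one-way access to the stream. It
  works on finitely many growable arrays (named by natural numbers) of three kinds: numbers,
  weights and elements; a register is an array used at index 0 only. Elements are opaque: they can
  be copied, compared for equality and passed to the independence oracle, so an element can be
  output or queried only if it occupies a memory cell. The type \<open>com\<close> does not mention
  the instance, hence one program serves all \<open>k\<close>, all systems and all weights.\<close>

datatype nexp =
    NConst nat
  | NCell nat nexp   \<comment> \<open>array name and index\<close>
  | NAdd nexp nexp | NSub nexp nexp | NMul nexp nexp | NDiv nexp nexp | NMod nexp nexp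

datatype wexp =
    WZero
  | WCell nat nexp
  | WAdd wexp wexp | WSub wexp wexp
  | WMul nexp wexp | WDiv wexp nexp   \<comment> \<open>multiplication and division by numbers only\<close>

datatype bexp =
    NLess nexp nexp
  | WLess wexp wexp
  | EEq nat nexp nat nexp
  | More   \<comment> \<open>the stream is not exhausted\<close>
  | BNot bexp | BAnd bexp bexp

datatype com =
    Skip
  | NAssign nat nexp nexp
  | WAssign nat nexp wexp
  | EAssign nat nexp nat nexp
  | Read nat nexp nat nexp   \<comment> \<open>next element and its weight, into an element cell and a weight cell\<close>
  | Query nat nexp nat nexp nexp
      \<comment> \<open>\<open>Query x i y a b\<close> asks whether the elements in the cells \<open>a, \<dots>, b - 1\<close> of array \<open>y\<close>
          form an independent set and writes 1 (yes) or 0 (no) to the number cell \<open>x[i]\<close>\<close>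
  | Seq com com
  | If bexp com com
  | While bexp com

record 'a state =
  nums :: "nat \<Rightarrow> nat list"
  wts :: "nat \<Rightarrow> real list"
  elts :: "nat \<Rightarrow> 'a list"
  pending :: "'a list"

fun nval :: "'a state \<Rightarrow> nexp \<Rightarrow> nat" where
  "nval s (NConst n) = n"
| "nval s (NCell x i) = nth_default 0 (nums s x) (nval s i)"
| "nval s (NAdd a b) = nval s a + nval s b"
| "nval s (NSub a b) = nval s a - nval s b"
| "nval s (NMul a b) = nval s a * nval s b"
| "nval s (NDiv a b) = nval s a div nval s b"
| "nval s (NMod a b) = nval s a mod nval s b"

fun wval :: "'a state \<Rightarrow> wexp \<Rightarrow> real" where
  "wval s WZero = 0"
| "wval s (WCell x i) = nth_default 0 (wts s x) (nval s i)"
| "wval s (WAdd a b) = wval s a + wval s b"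
| "wval s (WSub a b) = wval s a - wval s b"
| "wval s (WMul n a) = real (nval s n) * wval s a"
| "wval s (WDiv a n) = wval s a / real (nval s n)"

fun bval :: "'a state \<Rightarrow> bexp \<Rightarrow> bool" where
  "bval s (NLess a b) \<longleftrightarrow> nval s a < nval s b"
| "bval s (WLess a b) \<longleftrightarrow> wval s a < wval s b"
| "bval s (EEq x i y j) \<longleftrightarrow>
     nval s i < length (elts s x) \<and> nval s j < length (elts s y) \<and>
     elts s x ! nval s i = elts s y ! nval s j"
| "bval s More \<longleftrightarrow> pending s \<noteq> []"
| "bval s (BNot b) \<longleftrightarrow> \<not> bval s b"
| "bval s (BAnd a b) \<longleftrightarrow> bval s a \<and> bval s b"

text \<open>Writing at index \<open>i \<le> length xs\<close> overwrites a cell or, if \<open>i = length xs\<close>, allocates a new one.\<close>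

definition write_cell :: "(nat \<Rightarrow> 'b list) \<Rightarrow> nat \<Rightarrow> nat \<Rightarrow> 'b \<Rightarrow> (nat \<Rightarrow> 'b list)" where
  "write_cell m x i v = m(x := take i (m x) @ v # drop (Suc i) (m x))"

text \<open>\<open>exec \<I> w B c s t s'\<close>: started in \<open>s\<close>, the program \<open>c\<close> halts in \<open>s'\<close> after \<open>t\<close> time units. The
  oracle \<open>\<I>\<close> is consulted only by \<open>Query\<close>, at a cost linear in the size of the query, and the
  weight function \<open>w\<close> only by \<open>Read\<close>. Every other command or test costs one unit; the expressions
  in it have constant size because the program is fixed. The number \<open>B\<close> is the largest one that
  fits in a number cell. There is no derivation for runs that overflow a number cell, write
  beyond the end of an array, copy from an unallocated element cell or read past the end of the
  stream.\<close>

inductive exec :: "'a set set \<Rightarrow> ('a \<Rightarrow> real) \<Rightarrow> nat \<Rightarrow> com \<Rightarrow> 'a state \<Rightarrow> nat \<Rightarrow> 'a state \<Rightarrow> bool"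
  for \<I> :: "'a set set" and w :: "'a \<Rightarrow> real" and B :: nat
where
  Skip: "exec \<I> w B Skip s 1 s"
| NAssign:
    "\<lbrakk>nval s i \<le> length (nums s x); nval s e \<le> B\<rbrakk> \<Longrightarrow>
     exec \<I> w B (NAssign x i e) s 1 (s\<lparr>nums := write_cell (nums s) x (nval s i) (nval s e)\<rparr>)"
| WAssign:
    "nval s i \<le> length (wts s x) \<Longrightarrow>
     exec \<I> w B (WAssign x i e) s 1 (s\<lparr>wts := write_cell (wts s) x (nval s i) (wval s e)\<rparr>)"
| EAssign:
    "\<lbrakk>nval s i \<le> length (elts s x); nval s j < length (elts s y)\<rbrakk> \<Longrightarrow>
     exec \<I> w B (EAssign x i y j) s 1
       (s\<lparr>elts := write_cell (elts s) x (nval s i) (elts s y ! nval s j)\<rparr>)"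
| Read:
    "\<lbrakk>pending s = u # us; nval s i \<le> length (elts s x); nval s j \<le> length (wts s y)\<rbrakk> \<Longrightarrow>
     exec \<I> w B (Read x i y j) s 1
       (s\<lparr>elts := write_cell (elts s) x (nval s i) u, wts := write_cell (wts s) y (nval s j) (w u),
          pending := us\<rparr>)"
| Query:
    "\<lbrakk>nval s i \<le> length (nums s x);
      qs = take (nval s b - nval s a) (drop (nval s a) (elts s y));
      r = (if set qs \<in> \<I> then 1 else 0); r \<le> B\<rbrakk> \<Longrightarrow>
     exec \<I> w B (Query x i y a b) s (1 + length qs) (s\<lparr>nums := write_cell (nums s) x (nval s i) r\<rparr>)"
| Seq:
    "\<lbrakk>exec \<I> w B c1 s t1 s'; exec \<I> w B c2 s' t2 s''\<rbrakk> \<Longrightarrow>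
     exec \<I> w B (Seq c1 c2) s (t1 + t2) s''"
| IfTrue: "\<lbrakk>bval s b; exec \<I> w B c1 s t s'\<rbrakk> \<Longrightarrow> exec \<I> w B (If b c1 c2) s (1 + t) s'"
| IfFalse: "\<lbrakk>\<not> bval s b; exec \<I> w B c2 s t s'\<rbrakk> \<Longrightarrow> exec \<I> w B (If b c1 c2) s (1 + t) s'"
| WhileFalse: "\<not> bval s b \<Longrightarrow> exec \<I> w B (While b c) s 1 s"
| WhileTrue:
    "\<lbrakk>bval s b; exec \<I> w B c s t1 s'; exec \<I> w B (While b c) s' t2 s''\<rbrakk> \<Longrightarrow>
     exec \<I> w B (While b c) s (1 + t1 + t2) s''"

text \<open>The parameter \<open>k\<close> is supplied in the number cell \<open>0[0]\<close>. At the end this cell holds the length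
  of the initial segment of element array 0 that is the output.\<close>

definition init :: "nat \<Rightarrow> 'a list \<Rightarrow> 'a state" where
  "init k xs = \<lparr>nums = (\<lambda>_. [])(0 := [k]), wts = (\<lambda>_. []), elts = (\<lambda>_. []), pending = xs\<rparr>"

definition output_set :: "'a state \<Rightarrow> 'a set" where
  "output_set s = set (take (nval s (NCell 0 (NConst 0))) (elts s 0))"

text \<open>The number of allocated memory cells, each holding a number, a weight or an element. Cells are
  never released (see \<open>exec_cells_mono\<close>), so in the final state of a run this is the maximal number
  of cells in use during the run. The sums are over finitely many arrays in every state that
  is reachable from an initial state.\<close>

definition num_cells :: "'a state \<Rightarrow> nat" where
  "num_cells s = (\<Sum>x | nums s x \<noteq> []. length (nums s x)) + (\<Sum>x | wts s x \<noteq> []. length (wts s x)) +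
     (\<Sum>x | elts s x \<noteq> []. length (elts s x))"

lemma length_write_cell: "i \<le> length (m x) \<Longrightarrow> length (m y) \<le> length (write_cell m x i v y)"
  by (auto simp: write_cell_def)

lemma exec_cells_mono:
  assumes "exec \<I> w B c s t s'"
  shows "length (nums s x) \<le> length (nums s' x)"
    and "length (wts s x) \<le> length (wts s' x)"
    and "length (elts s x) \<le> length (elts s' x)"
  using assms by (induction rule: exec.induct) (simp_all add: length_write_cell)

lemma finite_write_cell:
  "finite {y. m y \<noteq> []} \<Longrightarrow> finite {y. write_cell m x i v y \<noteq> []}"
  by (rule finite_subset[of _ "insert x {y. m y \<noteq> []}"]) (auto simp: write_cell_def)

lemma exec_finite_arrays:
  assumes "exec \<I> w B c s t s'"
    and "finite {x. nums s x \<noteq> []}" "finite {x. wts s x \<noteq> []}" "finite {x. elts s x \<noteq> []}"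
  shows "finite {x. nums s' x \<noteq> []} \<and> finite {x. wts s' x \<noteq> []} \<and> finite {x. elts s' x \<noteq> []}"
  using assms by (induction rule: exec.induct) (simp_all add: finite_write_cell)

inductive_cases exec_elims:
  "exec \<I> w B Skip s t s'"
  "exec \<I> w B (NAssign x i e) s t s'"
  "exec \<I> w B (WAssign x i f) s t s'"
  "exec \<I> w B (EAssign x i y j) s t s'"
  "exec \<I> w B (Read x i y j) s t s'"
  "exec \<I> w B (Query x i y a e) s t s'"
  "exec \<I> w B (Seq c1 c2) s t s'"
  "exec \<I> w B (If b c1 c2) s t s'"

inductive_cases exec_WhileE: "exec \<I> w B (While b c) s t s'"

lemma exec_deterministic:
  assumes "exec \<I> w B c s t s'" and "exec \<I> w B c s t' s''"
  shows "t' = t \<and> s'' = s'"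
  using assms
proof (induction arbitrary: t' s'' rule: exec.induct)
  case (Seq c1 s t1 s1 c2 t2 s2)
  from Seq.prems show ?case
  proof (rule exec_elims(7))
    fix u1 r u2
    assume *: "t' = u1 + u2" "exec \<I> w B c1 s u1 r" "exec \<I> w B c2 r u2 s''"
    from *(2) have 1: "u1 = t1 \<and> r = s1" by (rule Seq.IH(1))
    with *(3) have "u2 = t2 \<and> s'' = s2" by (intro Seq.IH(2)) (elim conjE, hypsubst)
    with *(1) 1 show ?thesis by presburger
  qed
next
  case (IfTrue s b c1 t s1 c2)
  from IfTrue.prems show ?case
    by (rule exec_elims(8)) (use IfTrue.hyps in \<open>auto dest: IfTrue.IH\<close>)
next
  case (IfFalse s b c2 t s1 c1)
  from IfFalse.prems show ?case
    by (rule exec_elims(8)) (use IfFalse.hyps in \<open>auto dest: IfFalse.IH\<close>)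
next
  case (WhileFalse s b c)
  from WhileFalse.prems show ?case
    by (rule exec_WhileE) (use WhileFalse.hyps in simp_all)
next
  case (WhileTrue s b c t1 s1 t2 s2)
  from WhileTrue.prems show ?case
  proof (rule exec_WhileE)
    assume "\<not> bval s b"
    with WhileTrue.hyps show ?thesis by simp
  next
    fix u1 r u2
    assume *: "t' = Suc (u1 + u2)" "exec \<I> w B c s u1 r" "exec \<I> w B (While b c) r u2 s''"
    from *(2) have 1: "u1 = t1 \<and> r = s1" by (rule WhileTrue.IH(1))
    with *(3) have "u2 = t2 \<and> s'' = s2" by (intro WhileTrue.IH(2)) (elim conjE, hypsubst)
    with *(1) 1 show ?thesis by presburger
  qed
next
  case (Skip s) then show ?case by (rule exec_elims(1)) simp
next
  case (NAssign s i x e)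
  from NAssign.prems show ?case by (rule exec_elims(2)) simp
next
  case (WAssign s i x e)
  from WAssign.prems show ?case by (rule exec_elims(3)) simp
next
  case (EAssign s i x j y)
  from EAssign.prems show ?case by (rule exec_elims(4)) simp
next
  case (Read s u us i x j y)
  from Read.prems show ?case by (rule exec_elims(5)) (use Read.hyps in simp)
next
  case (Query s i x qs b a y r)
  from Query.prems show ?case by (rule exec_elims(6)) (use Query.hyps in simp)
qed

end

theory Submission
  imports Defs
begin

text \<open>Stored weights are rounded down to a geometric grid with ratio 2 below the largest weight \<open>m\<close>, and
  in each class of equal rounded weight the algorithm keeps a greedily chosen independent set. Such
  a set is at least a \<open>1/k\<close> fraction of any independent set of elements of the class. Weights below
  \<open>m / (8 p\<^sup>2)\<close>, where \<open>p\<close> is a running upper estimate of the number of elements of an optimal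
  solution seen so far, are discarded; as \<open>p\<close> grows along with the number of losses, these cost at
  most half of the optimum, and only \<open>O(log p)\<close> classes of at most \<open>\<rho>\<close> elements remain.

  At the end the classes are split into \<open>q = O(log k)\<close> groups so that consecutive weights in a group
  differ by a factor \<open>2 ^ q \<ge> 2 k\<close>. A group is merged from light to heavy: all of the next class is
  taken and the previous solution is re-added greedily. Extendibility implies that a maximal
  extension drops at most \<open>k\<close> old elements per new element, which is at most half of the new weight,
  so at least half of the total weight of the group survives. The best group costs a factor \<open>q\<close>.\<close>

section \<open>Extendible systems\<close>

text \<open>The ratio \<open>8 * k * q\<close> is a product: 2 for lost weight, 2 for rounding,
  \<open>k\<close> for keeping a greedy set per class, \<open>q\<close> for using a single group and
  2 for the merge. The obstacle is that neither the largest weight nor the rank is known in advance.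
  So the grid is anchored at a running maximum \<open>m\<close> which changes in only two ways. It
  is multiplied by a power of 2, which keeps the surviving classes on the grid, or it jumps to a
  weight above \<open>2 ^ z * m\<close>, which puts every stored class below the new threshold.
  Stored weights thus never need to be rounded again. The exponent \<open>z\<close> only grows, and
  this adds grid points at the bottom. The stream may lose far more elements than any solution
  contains; the loss is therefore bounded for each independent set separately, where the number of
  lost elements is at most the current rank estimate \<open>p\<close>. Both space bounds come from
  \<open>2 ^ z \<le> max 1 (16 * p\<^sup>2)\<close> by bounding \<open>p\<close> once by
  \<open>k * \<rho>\<close> and once by the size of the ground set.\<close>

lemma k_extendible_system:
  assumes "k_extendible k N \<I>"
  shows "independence_system N \<I>" and "finite N" and "{} \<in> \<I>"
    and "A \<in> \<I> \<Longrightarrow> B \<subseteq> A \<Longrightarrow> B \<in> \<I>"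
    and "A \<in> \<I> \<Longrightarrow> A \<subseteq> N" and "A \<in> \<I> \<Longrightarrow> finite A"
proof -
  show sys: "independence_system N \<I>" using assms by (simp add: k_extendible_def)
  then show "finite N" by (simp add: independence_system_def)
  show down: "B \<in> \<I>" if "A \<in> \<I>" "B \<subseteq> A" for A B
    using sys that unfolding independence_system_def by blast
  show sub: "A \<subseteq> N" if "A \<in> \<I>" for A
    using sys that by (auto simp: independence_system_def)
  show "finite A" if "A \<in> \<I>" for A
    using finite_subset[OF sub[OF that] \<open>finite N\<close>] .
  from sys obtain A where "A \<in> \<I>" by (auto simp: independence_system_def)
  then show "{} \<in> \<I>" by (rule down) simp
qed

text \<open>The elements of \<open>U\<close> are added one at a time. Those already added join the
  protected part of the next exchange, so each exchange removes up to \<open>k\<close> elements of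
  \<open>T - R\<close> only and the losses add up to \<open>k * card U\<close>.\<close>

lemma k_extendible_exchange:
  assumes "k_extendible k N \<I>" and "finite U"
    and "R \<subseteq> T" "T \<in> \<I>" "U \<inter> T = {}" "R \<union> U \<in> \<I>"
  shows "\<exists>Y. Y \<subseteq> T - R \<and> card Y \<le> k * card U \<and> (T - Y) \<union> U \<in> \<I>"
  using assms(2,5,6)
proof (induction U rule: finite_induct)
  case empty
  then show ?case using assms(4) by (intro exI[of _ "{}"]) auto
next
  case (insert u U)
  note down = k_extendible_system(4)[OF assms(1)] and sub = k_extendible_system(5)[OF assms(1)]
  have "R \<union> U \<in> \<I>" by (rule down[OF insert.prems(2)]) auto
  with insert obtain Y where Y: "Y \<subseteq> T - R" "card Y \<le> k * card U" "(T - Y) \<union> U \<in> \<I>"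
    by auto
  have "\<exists>Y'. Y' \<subseteq> ((T - Y) \<union> U) - (R \<union> U) \<and> card Y' \<le> k \<and> (((T - Y) \<union> U) - Y') \<union> {u} \<in> \<I>"
  proof -
    have "R \<union> U \<subseteq> (T - Y) \<union> U" using Y(1) assms(3) by auto
    moreover have "u \<in> N" using sub[OF insert.prems(2)] by auto
    moreover have "u \<notin> (T - Y) \<union> U" using insert by auto
    moreover have "R \<union> U \<union> {u} \<in> \<I>" using insert.prems(2) by simp
    ultimately show ?thesis using assms(1) Y(3) unfolding k_extendible_def by blast
  qed
  then obtain Y' where Y': "Y' \<subseteq> ((T - Y) \<union> U) - (R \<union> U)" "card Y' \<le> k"
    "(((T - Y) \<union> U) - Y') \<union> {u} \<in> \<I>" by blast
  have eq: "(((T - Y) \<union> U) - Y') \<union> {u} = (T - (Y \<union> Y')) \<union> insert u U"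
    using Y'(1) by auto
  have "card (Y \<union> Y') \<le> card Y + card Y'" by (rule card_Un_le)
  also have "\<dots> \<le> k * card (insert u U)" using Y(2) Y'(2) insert by simp
  finally show ?case
    using Y(1) Y'(1,3) unfolding eq by (intro exI[of _ "Y \<union> Y'"]) blast
qed

text \<open>Since \<open>R \<union> U\<close> cannot be extended by any \<open>t\<close> in
  \<open>T - R\<close>, the exchange has to remove all of \<open>T - R\<close>: a survivor
  \<open>t\<close> would be independent together with \<open>R \<union> U\<close> by
  down-closure.\<close>

lemma k_extendible_maximal_loss:
  assumes "k_extendible k N \<I>"
    and "R \<subseteq> T" "T \<in> \<I>" "U \<inter> T = {}" "R \<union> U \<in> \<I>"
    and max: "\<And>t. t \<in> T - R \<Longrightarrow> insert t (R \<union> U) \<notin> \<I>"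
  shows "card (T - R) \<le> k * card U"
proof -
  note down = k_extendible_system(4)[OF assms(1)] and fin = k_extendible_system(6)[OF assms(1)]
  have "finite U" using fin[OF assms(5)] by auto
  from k_extendible_exchange[OF assms(1) this assms(2-5)] obtain Y
    where Y: "Y \<subseteq> T - R" "card Y \<le> k * card U" "(T - Y) \<union> U \<in> \<I>" by blast
  have "T - R \<subseteq> Y"
  proof
    fix t assume t: "t \<in> T - R"
    show "t \<in> Y"
    proof (rule ccontr)
      assume "t \<notin> Y"
      then have "insert t (R \<union> U) \<subseteq> (T - Y) \<union> U" using t Y(1) assms(2) by auto
      from down[OF Y(3) this] max[OF t] show False by simp
    qed
  qed
  with Y(1) have "Y = T - R" by auto
  with Y(2) show ?thesis by simp
qed

text \<open>Apply the previous bound with \<open>R = A \<inter> M\<close> and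
  \<open>U = M - A\<close>, so that \<open>R \<union> U = M\<close>. The common elements count once
  on the left and \<open>k\<close> times on the right, which is where \<open>1 \<le> k\<close>
  enters.\<close>

lemma k_extendible_maximal_card:
  assumes "k_extendible k N \<I>" "1 \<le> k"
    and "A \<in> \<I>" "M \<in> \<I>"
    and max: "\<And>a. a \<in> A - M \<Longrightarrow> insert a M \<notin> \<I>"
  shows "card A \<le> k * card M"
proof -
  note fin = k_extendible_system(6)[OF assms(1) assms(3)] k_extendible_system(6)[OF assms(1) assms(4)]
  have M: "(A \<inter> M) \<union> (M - A) = M" by auto
  have "card (A - (A \<inter> M)) \<le> k * card (M - A)"
  proof (rule k_extendible_maximal_loss[OF assms(1) _ assms(3)])
    show "A \<inter> M \<union> (M - A) \<in> \<I>" unfolding M by (rule assms(4))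
    show "insert t (A \<inter> M \<union> (M - A)) \<notin> \<I>" if "t \<in> A - A \<inter> M" for t
      unfolding M using that by (intro max) auto
  qed auto
  moreover have "card A = card (A - (A \<inter> M)) + card (A \<inter> M)"
    using card_Int_Diff[OF fin(1), of M] by (simp add: Diff_Int)
  moreover have "card M = card (A \<inter> M) + card (M - A)"
    using card_Int_Diff[OF fin(2), of A] by (simp add: Int_commute)
  moreover have "card (A \<inter> M) \<le> k * card (A \<inter> M)" using assms(2) by (cases k) auto
  ultimately show ?thesis by (simp only: add_mult_distrib2)
qed

section \<open>Greedy extension of an independent list\<close>

definition greedy :: "'a set set \<Rightarrow> 'a list \<Rightarrow> 'a list \<Rightarrow> 'a list" where
  "greedy \<I> = foldl (\<lambda>T x. if insert x (set T) \<in> \<I> then T @ [x] else T)"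

lemma greedy_Nil [simp]: "greedy \<I> base [] = base"
  and greedy_snoc: "greedy \<I> base (xs @ [x]) =
    (if insert x (set (greedy \<I> base xs)) \<in> \<I> then greedy \<I> base xs @ [x] else greedy \<I> base xs)"
  by (simp_all add: greedy_def)

lemma greedy_props:
  assumes "set base \<in> \<I>"
  shows "set (greedy \<I> base xs) \<in> \<I> \<and> set base \<subseteq> set (greedy \<I> base xs) \<and>
    set (greedy \<I> base xs) \<subseteq> set base \<union> set xs \<and>
    (distinct (base @ xs) \<longrightarrow> distinct (greedy \<I> base xs))"
  using assms
proof (induction xs rule: rev_induct)
  case (snoc x xs)
  then show ?case by (auto simp: greedy_snoc)
qed simp

text \<open>A rejected element stays rejected because the list only grows and supersets of dependent
  sets are dependent.\<close>

lemma greedy_maximal: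
  assumes "independence_system N \<I>" "set base \<in> \<I>"
  shows "\<forall>x \<in> set xs. x \<in> set (greedy \<I> base xs) \<or> insert x (set (greedy \<I> base xs)) \<notin> \<I>"
proof (induction xs rule: rev_induct)
  case (snoc y xs)
  have down: "\<And>A B. A \<in> \<I> \<Longrightarrow> B \<subseteq> A \<Longrightarrow> B \<in> \<I>"
    using assms(1) by (auto simp: independence_system_def)
  show ?case
  proof
    fix x assume x: "x \<in> set (xs @ [y])"
    show "x \<in> set (greedy \<I> base (xs @ [y])) \<or> insert x (set (greedy \<I> base (xs @ [y]))) \<notin> \<I>"
    proof (cases "x = y")
      case True then show ?thesis by (auto simp: greedy_snoc)
    next
      case False
      with x snoc have "x \<in> set (greedy \<I> base xs) \<or> insert x (set (greedy \<I> base xs)) \<notin> \<I>" by auto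
      moreover have "set (greedy \<I> base xs) \<subseteq> set (greedy \<I> base (xs @ [y]))"
        by (auto simp: greedy_snoc)
      ultimately show ?thesis using down by (meson insert_mono subset_iff)
    qed
  qed
qed simp

text \<open>Weights are compared by exact equality of reals. This is reliable because the machine
  has exact real arithmetic and all stored weights are points of one grid.\<close>

definition cls :: "('a \<times> real) list \<Rightarrow> real \<Rightarrow> 'a list" where
  "cls S b = map fst (filter (\<lambda>p. snd p = b) S)"

lemma set_cls: "set (cls S b) = {e. (e, b) \<in> set S}"
  by (force simp: cls_def)

lemma distinct_cls: "distinct (map fst S) \<Longrightarrow> distinct (cls S b)"
  unfolding cls_def by (rule distinct_map_filter)

lemma length_cls_le: "length (cls S b) \<le> length S"
  by (simp add: cls_def)

section \<open>Invariants of the streaming phase\<close>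

text \<open>The number \<open>min (k * |G|) |V|\<close> bounds the size of every independent subset of \<open>V\<close>. It is the
  estimate of the rank that determines which weights are negligible; capping it at \<open>|V|\<close> makes the
  running time independent of \<open>k\<close>.\<close>

definition maximal_seen :: "'a set set \<Rightarrow> nat \<Rightarrow> 'a set \<Rightarrow> 'a list \<Rightarrow> nat \<Rightarrow> bool" where
  "maximal_seen \<I> k V G z \<longleftrightarrow>
     finite V \<and> distinct G \<and> set G \<subseteq> V \<and> set G \<in> \<I> \<and> (\<forall>u\<in>V. u \<in> set G \<or> insert u (set G) \<notin> \<I>) \<and>
     8 * (min (k * length G) (card V))\<^sup>2 \<le> 2 ^ z \<and>
     (2::nat) ^ z \<le> max 1 (16 * (min (k * length G) (card V))\<^sup>2)"

text \<open>The equation \<open>b * 2 ^ z = 2 ^ j * m\<close> with \<open>j \<le> z\<close> puts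
  \<open>b\<close> on the grid from \<open>m / 2 ^ z\<close> to \<open>m\<close> with ratio 2. For
  \<open>m = 0\<close> it contradicts \<open>0 < b\<close> and forces \<open>S\<close> to be empty,
  which is the initial state. The witness \<open>u\<close> for a positive \<open>m\<close> will make
  \<open>m\<close> a lower bound for the optimum, as singletons of relevant elements are
  independent.\<close>

definition classes :: "'a set set \<Rightarrow> ('a \<Rightarrow> real) \<Rightarrow> 'a set \<Rightarrow> nat \<Rightarrow> real \<Rightarrow> ('a \<times> real) list \<Rightarrow> bool" where
  "classes \<I> w V z m S \<longleftrightarrow>
     0 \<le> m \<and> (0 < m \<longrightarrow> (\<exists>u\<in>V. m \<le> w u)) \<and> distinct (map fst S) \<and> fst ` set S \<subseteq> V \<and>
     (\<forall>(e, b) \<in> set S. 0 < b \<and> b \<le> w e \<and> (\<exists>j\<le>z. b * 2 ^ z = 2 ^ j * m)) \<and>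
     (\<forall>b. set (cls S b) \<in> \<I>)"

text \<open>A certificate that \<open>v\<close> can be charged to the greedy set of class
  \<open>b\<close>. Classes only grow until they are pruned, so the certificate survives as long as
  its class does.\<close>

definition covered :: "'a set set \<Rightarrow> ('a \<Rightarrow> real) \<Rightarrow> ('a \<times> real) list \<Rightarrow> 'a \<Rightarrow> bool" where
  "covered \<I> w S v \<longleftrightarrow>
     (\<exists>b. w v < 2 * b \<and> ((v, b) \<in> set S \<or> insert v (set (cls S b)) \<notin> \<I>))"

text \<open>The bound on the weight of a lost set \<open>X\<close> grows with \<open>x = |X|\<close> by increments
  \<open>m / (2 (x + 1) (x + 2))\<close>. They pay for losing one more element of weight at most
  \<open>m / (4 p\<^sup>2)\<close> because \<open>x + 1 \<le> p\<close>, and their sum stays below \<open>m / 2\<close>.\<close>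

definition small_loss :: "'a set set \<Rightarrow> ('a \<Rightarrow> real) \<Rightarrow> 'a set \<Rightarrow> real \<Rightarrow> ('a \<times> real) list \<Rightarrow> bool" where
  "small_loss \<I> w V m S \<longleftrightarrow>
     (\<forall>A\<in>\<I>. \<exists>X. X \<subseteq> A \<inter> V \<and>
        sum w X \<le> m / 2 * (real (card X) / (real (card X) + 1)) \<and>
        (\<forall>v \<in> A \<inter> V - X. covered \<I> w S v))"

lemma card_seen_le:
  assumes "k_extendible k N \<I>" "1 \<le> k" "maximal_seen \<I> k V G z" "A \<in> \<I>"
  shows "card (A \<inter> V) \<le> min (k * length G) (card V)"
proof -
  have fin: "finite V" using assms(3) by (simp add: maximal_seen_def)
  have AV: "A \<inter> V \<in> \<I>" by (rule k_extendible_system(4)[OF assms(1,4)]) simp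
  have "card (A \<inter> V) \<le> k * card (set G)"
    by (rule k_extendible_maximal_card[OF assms(1,2) AV]) (use assms(3) in \<open>auto simp: maximal_seen_def\<close>)
  moreover have "card (set G) = length G"
    using assms(3) by (simp add: maximal_seen_def distinct_card)
  moreover have "card (A \<inter> V) \<le> card V" using fin by (intro card_mono) auto
  ultimately show ?thesis by simp
qed

text \<open>One pruning can lose several elements of a solution, so the increment is needed for a
  whole set \<open>Y\<close>. With \<open>f t = t / (t + 1)\<close> one has
  \<open>f (x + y) - f x = y / ((x + 1) * (x + y + 1))\<close>. A nonempty \<open>Y\<close> gives
  \<open>x + 1 \<le> p\<close> and \<open>x + y + 1 \<le> 2 * p\<close>, so a weight of
  \<open>m' / (4 * p\<^sup>2)\<close> per element fits into this increment.\<close>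

lemma loss_increment:
  fixes m m' :: real
  assumes "finite X" "finite Y" "X \<inter> Y = {}" "0 \<le> m" "m \<le> m'"
    and X: "sum w X \<le> m / 2 * (real (card X) / (real (card X) + 1))"
    and Y: "\<And>v. v \<in> Y \<Longrightarrow> w v * (4 * real p ^ 2) \<le> m'"
    and p: "card (X \<union> Y) \<le> p"
  shows "sum w (X \<union> Y) \<le> m' / 2 * (real (card (X \<union> Y)) / (real (card (X \<union> Y)) + 1))"
proof (cases "Y = {}")
  case True
  have "m / 2 * (real (card X) / (real (card X) + 1)) \<le> m' / 2 * (real (card X) / (real (card X) + 1))"
    using assms(5) by (intro mult_right_mono) auto
  with X True show ?thesis by simp
next
  case False
  define x y where "x = real (card X)" and "y = real (card Y)"
  have xy: "real (card (X \<union> Y)) = x + y" using assms(1-3) by (simp add: card_Un_disjoint x_def y_def)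
  have y1: "1 \<le> y" using False assms(2) by (simp add: y_def Suc_leI card_gt_0_iff)
  have x0: "0 \<le> x" by (simp add: x_def)
  have pp: "x + y \<le> real p" using p xy by linarith
  have p0: "0 < real p" using pp y1 x0 by linarith
  have "sum w Y \<le> y * (m' / (4 * real p ^ 2))"
    unfolding y_def by (rule sum_bounded_above) (use Y p0 in \<open>simp add: field_simps\<close>)
  also have "\<dots> \<le> y * (m' / (2 * ((x + 1) * (x + y + 1))))"
  proof (intro mult_left_mono divide_left_mono)
    have "(x + 1) * (x + y + 1) \<le> real p * (2 * real p)"
      by (intro mult_mono) (use pp y1 x0 in linarith)+
    then show "2 * ((x + 1) * (x + y + 1)) \<le> 4 * real p ^ 2" by (simp add: power2_eq_square)
    show "0 < 4 * real p ^ 2 * (2 * ((x + 1) * (x + y + 1)))"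
      using p0 x0 y1 by (auto intro!: mult_pos_pos)
  qed (use y1 assms in auto)
  also have "\<dots> = m' / 2 * ((x + y) / (x + y + 1) - x / (x + 1))"
    using x0 y1 by (simp add: divide_simps) (simp add: algebra_simps)
  finally have Y2: "sum w Y \<le> m' / 2 * ((x + y) / (x + y + 1) - x / (x + 1))" .
  have "m / 2 * (x / (x + 1)) \<le> m' / 2 * (x / (x + 1))"
    using assms(5) x0 by (intro mult_right_mono) auto
  with X have "sum w X \<le> m' / 2 * (x / (x + 1))" by (simp add: x_def)
  moreover have "sum w (X \<union> Y) = sum w X + sum w Y" using assms(1-3) by (rule sum.union_disjoint)
  ultimately show ?thesis using Y2 unfolding xy by (simp add: algebra_simps)
qed

lemma real_pow2_ge_cap:
  assumes "maximal_seen \<I> k V G z"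
  shows "8 * real (min (k * length G) (card V)) ^ 2 \<le> 2 ^ z"
proof -
  have "8 * (min (k * length G) (card V))\<^sup>2 \<le> 2 ^ z" using assms by (simp add: maximal_seen_def)
  then have "real (8 * (min (k * length G) (card V))\<^sup>2) \<le> real (2 ^ z)" by (simp only: of_nat_le_iff)
  then show ?thesis by simp
qed

text \<open>A larger exponent only lengthens the grid at its lower end: the same \<open>b\<close>
  has its index shifted by \<open>z' - z\<close>.\<close>

lemma classes_increase_pow:
  assumes "classes \<I> w V z m S" "z \<le> z'" "V \<subseteq> V'"
  shows "classes \<I> w V' z' m S"
proof -
  have *: "\<exists>j\<le>z'. b * 2 ^ z' = 2 ^ j * m" if h: "j \<le> z" "b * 2 ^ z = 2 ^ j * m" for b :: real and j
  proof (intro exI[of _ "j + (z' - z)"] conjI)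
    have "(2::real) ^ z' = 2 ^ z * 2 ^ (z' - z)" using assms(2) by (simp flip: power_add)
    then have "b * 2 ^ z' = (b * 2 ^ z) * 2 ^ (z' - z)" by simp
    then show "b * 2 ^ z' = 2 ^ (j + (z' - z)) * m" unfolding h(2) by (simp add: power_add)
  qed (use assms(2) h in simp)
  have "\<exists>j\<le>z'. b * 2 ^ z' = 2 ^ j * m" if "(e, b) \<in> set S" for e b
    using assms(1) * that unfolding classes_def by blast
  then show ?thesis using assms(1,3) unfolding classes_def by blast
qed

text \<open>A discarded \<open>u\<close> joins the lost part of every independent set that contains
  it. It weighs less than \<open>m / 2 ^ z\<close>, and \<open>2 ^ z \<ge> 8 * p\<^sup>2\<close>
  holds for the estimate \<open>p\<close> that already takes \<open>u\<close> into account.\<close>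

lemma classes_skip:
  assumes ext: "k_extendible k N \<I>" "1 \<le> k"
    and G: "maximal_seen \<I> k (insert u V) G z" and u: "u \<notin> V"
    and loss: "small_loss \<I> w V m S" and m0: "0 \<le> m"
    and light: "w u * 2 ^ z < m"
    and w0: "0 < w u"
  shows "small_loss \<I> w (insert u V) m S"
  unfolding small_loss_def
proof
  fix A assume A: "A \<in> \<I>"
  have finV: "finite V" using G by (simp add: maximal_seen_def)
  let ?p = "min (k * length G) (card (insert u V))"
  from loss A obtain X where X: "X \<subseteq> A \<inter> V"
    "sum w X \<le> m / 2 * (real (card X) / (real (card X) + 1))"
    "\<forall>v \<in> A \<inter> V - X. covered \<I> w S v" by (auto simp: small_loss_def)
  define Y where "Y = A \<inter> {u}"
  have XY: "X \<union> Y \<subseteq> A \<inter> insert u V" using X by (auto simp: Y_def)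
  have "w v * (4 * real ?p ^ 2) \<le> m" if "v \<in> Y" for v
  proof -
    have "w u * (4 * real ?p ^ 2) \<le> w u * 2 ^ z"
      using real_pow2_ge_cap[OF G] w0
      by (intro mult_left_mono order_trans[OF _ real_pow2_ge_cap[OF G]]) auto
    with light that show ?thesis by (simp add: Y_def)
  qed
  moreover have "card (X \<union> Y) \<le> ?p"
    using card_mono[OF _ XY] finV card_seen_le[OF ext G A] by auto
  ultimately have "sum w (X \<union> Y) \<le> m / 2 * (real (card (X \<union> Y)) / (real (card (X \<union> Y)) + 1))"
    using X finV u by (intro loss_increment[OF _ _ _ m0 order_refl X(2)])
      (auto simp: Y_def intro: finite_subset)
  then show "\<exists>X. X \<subseteq> A \<inter> insert u V \<and>
        sum w X \<le> m / 2 * (real (card X) / (real (card X) + 1)) \<and>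
        (\<forall>v \<in> A \<inter> insert u V - X. covered \<I> w S v)"
    using X XY by (intro exI[of _ "X \<union> Y"]) (auto simp: Y_def)
qed

section \<open>Pruning the classes and inserting an element\<close>

definition prune :: "nat \<Rightarrow> real \<Rightarrow> ('a \<times> real) list \<Rightarrow> ('a \<times> real) list" where
  "prune z m S = filter (\<lambda>p. m \<le> snd p * 2 ^ z) S"

lemma cls_prune: "cls (prune z m S) b = (if m \<le> b * 2 ^ z then cls S b else [])"
  by (induction S) (auto simp: prune_def cls_def)

definition add_elem :: "'a set set \<Rightarrow> 'a \<Rightarrow> real \<Rightarrow> ('a \<times> real) list \<Rightarrow> ('a \<times> real) list" where
  "add_elem \<I> u b S = (if insert u (set (cls S b)) \<in> \<I> then S @ [(u, b)] else S)"

lemma cls_append: "cls (S @ S') b = cls S b @ cls S' b"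
  by (simp add: cls_def)

lemma cls_single: "cls [(u, b)] c = (if c = b then [u] else [])"
  by (simp add: cls_def)

text \<open>The last alternative for \<open>m'\<close> separates the jump
  (\<open>m * 2 ^ z < m'\<close>, everything stored is pruned) from the alignment with the old grid
  (\<open>m' = 2 ^ i * m\<close>, where \<open>i = 0\<close> means no change). A seen element can
  lose its cover only if its class is pruned, and then its weight is below
  \<open>2 * m' / 2 ^ z\<close>.\<close>

lemma classes_add:
  assumes ext: "k_extendible k N \<I>" "1 \<le> k"
    and G: "maximal_seen \<I> k (insert u V) G z" and u: "u \<notin> V"
    and cl: "classes \<I> w V z m S" and loss: "small_loss \<I> w V m S"
    and w0: "\<And>v. v \<in> insert u V \<Longrightarrow> 0 < w v" and single: "\<And>v. v \<in> insert u V \<Longrightarrow> {v} \<in> \<I>"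
    and b: "0 < b" "b \<le> w u" "w u < 2 * b" "l \<le> z" "b * 2 ^ z = 2 ^ l * m'"
    and m': "m \<le> m'" "m' = m \<or> m' \<le> w u" "m * 2 ^ z < m' \<or> (\<exists>i. m' = 2 ^ i * m)"
    and S': "S' = add_elem \<I> u b (prune z m' S)"
  shows "classes \<I> w (insert u V) z m' S'" and "small_loss \<I> w (insert u V) m' S'"
proof -
  note down = k_extendible_system(4)[OF ext(1)] and emp = k_extendible_system(3)[OF ext(1)]
  have m0: "0 \<le> m" using cl by (simp add: classes_def)
  have "0 < 2 ^ l * m'" unfolding b(5)[symmetric] using b(1) by simp
  then have m'0: "0 < m'" by (simp add: zero_less_mult_iff)
  have ge: "m' \<le> b * 2 ^ z" unfolding b(5) using m'0 by simp
  have cls_ge: "set (cls (prune z m' S) c) \<subseteq> set (cls S' c)" for c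
    by (auto simp: S' add_elem_def cls_append)
  have in_old: "e \<in> V \<and> 0 < c \<and> c \<le> w e \<and> (\<exists>j\<le>z. c * 2 ^ z = 2 ^ j * m)" if "(e, c) \<in> set S" for e c
    using cl that unfolding classes_def by force
  have distS: "distinct (map fst S)" using cl by (simp add: classes_def)
  \<comment> \<open>A surviving \<open>c\<close> excludes the jump, since \<open>c \<le> m\<close>
    by the old grid. In the aligned case \<open>c\<close> has index \<open>j - i\<close> on the new
    grid.\<close>
  have grid: "\<exists>j\<le>z. c * 2 ^ z = 2 ^ j * m'" if c: "(e, c) \<in> set S" "m' \<le> c * 2 ^ z" for e c
  proof -
    from in_old[OF c(1)] obtain j where j: "j \<le> z" "c * 2 ^ z = 2 ^ j * m" by blast
    have "(2::real) ^ j \<le> 2 ^ z" using j(1) by simp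
    then have "c * 2 ^ z \<le> 2 ^ z * m" unfolding j(2) using m0 by (intro mult_right_mono)
    with c(2) have "\<not> m * 2 ^ z < m'" by (simp only: mult.commute[of m] not_less)
    with m'(3) obtain i where i: "m' = 2 ^ i * m" by blast
    with m'0 m0 have mpos: "0 < m" by (auto simp: zero_less_mult_iff)
    from c(2) have "(2::real) ^ i \<le> 2 ^ j" unfolding j(2) i using mpos by simp
    then have ij: "i \<le> j" by simp
    then have "c * 2 ^ z = 2 ^ (j - i) * m'" unfolding j(2) i
      by (simp add: mult.assoc[symmetric] power_add[symmetric])
    with j(1) show ?thesis by (intro exI[of _ "j - i"]) auto
  qed
  show "classes \<I> w (insert u V) z m' S'"
    unfolding classes_def
  proof (intro conjI)
    show "0 \<le> m'" using m'0 by simp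
    show "0 < m' \<longrightarrow> (\<exists>v\<in>insert u V. m' \<le> w v)"
      using m'(2) cl unfolding classes_def by auto
    have "u \<notin> fst ` set S" using u cl by (auto simp: classes_def)
    then show "distinct (map fst S')"
      using distS by (auto simp: S' add_elem_def prune_def distinct_map_filter)
    show "fst ` set S' \<subseteq> insert u V"
    proof
      fix e assume "e \<in> fst ` set S'"
      then obtain c where "(e, c) \<in> set S'" by force
      then have "(e, c) \<in> set S \<or> e = u" by (auto simp: S' add_elem_def prune_def split: if_splits)
      with in_old show "e \<in> insert u V" by blast
    qed
    have *: "0 < c \<and> c \<le> w e \<and> (\<exists>j\<le>z. c * 2 ^ z = 2 ^ j * m')" if "(e, c) \<in> set S'" for e c
    proof (cases "(e, c) \<in> set (prune z m' S)")
      case True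
      then have "(e, c) \<in> set S" "m' \<le> c * 2 ^ z" by (auto simp: prune_def)
      with in_old grid show ?thesis by blast
    next
      case False
      with that have "e = u" "c = b" by (auto simp: S' add_elem_def split: if_splits)
      with b show ?thesis by blast
    qed
    then show "\<forall>(e, c)\<in>set S'. 0 < c \<and> c \<le> w e \<and> (\<exists>j\<le>z. c * 2 ^ z = 2 ^ j * m')" by blast
    show "\<forall>c. set (cls S' c) \<in> \<I>"
    proof
      fix c
      have 1: "set (cls (prune z m' S) c) \<in> \<I>"
        using cl emp by (cases "m' \<le> c * 2 ^ z") (simp_all add: cls_prune classes_def)
      have "set (cls S' c) = (if c = b \<and> insert u (set (cls (prune z m' S) b)) \<in> \<I>
          then insert u (set (cls (prune z m' S) b)) else set (cls (prune z m' S) c))"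
        by (simp add: S' add_elem_def cls_append cls_single)
      with 1 show "set (cls S' c) \<in> \<I>" by auto
    qed
  qed
  show "small_loss \<I> w (insert u V) m' S'"
    unfolding small_loss_def
  proof
    fix A assume A: "A \<in> \<I>"
    have finV: "finite V" using G by (simp add: maximal_seen_def)
    let ?p = "min (k * length G) (card (insert u V))"
    from loss A obtain X where X: "X \<subseteq> A \<inter> V"
      "sum w X \<le> m / 2 * (real (card X) / (real (card X) + 1))"
      "\<forall>v \<in> A \<inter> V - X. covered \<I> w S v" by (auto simp: small_loss_def)
    \<comment> \<open>The seen elements whose cover is destroyed by the pruning. The new
      \<open>u\<close> is not among them: it is either stored or rejected in class
      \<open>b\<close>.\<close>
    define Y where "Y = {v \<in> A \<inter> V - X. \<not> covered \<I> w S' v}"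
    have XY: "X \<union> Y \<subseteq> A \<inter> insert u V" using X by (auto simp: Y_def)
    have "w v * (4 * real ?p ^ 2) \<le> m'" if "v \<in> Y" for v
    proof -
      from that X have v: "v \<in> V" "covered \<I> w S v" "\<not> covered \<I> w S' v" by (auto simp: Y_def)
      from v(2) obtain c where c: "w v < 2 * c"
          "(v, c) \<in> set S \<or> insert v (set (cls S c)) \<notin> \<I>" by (auto simp: covered_def)
      have "c * 2 ^ z < m'"
      proof (rule ccontr)
        assume "\<not> c * 2 ^ z < m'"
        then have c': "m' \<le> c * 2 ^ z" by simp
        from c(2) have "(v, c) \<in> set S' \<or> insert v (set (cls S' c)) \<notin> \<I>"
        proof
          assume "(v, c) \<in> set S"
          with c' show ?thesis by (auto simp: S' add_elem_def prune_def)
        next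
          assume *: "insert v (set (cls S c)) \<notin> \<I>"
          have "set (cls S c) \<subseteq> set (cls S' c)" using cls_ge[of c] c' by (simp add: cls_prune)
          then show ?thesis using * down by (meson insert_mono)
        qed
        with v(3) c(1) show False by (auto simp: covered_def)
      qed
      \<comment> \<open>Rounding costs the factor 2 that turns the 8 of
        \<open>real_pow2_ge_cap\<close> into the 4 of \<open>loss_increment\<close>.\<close>
      moreover have "w v * 2 ^ z \<le> 2 * c * 2 ^ z" using c(1) by simp
      ultimately have "w v * 2 ^ z \<le> 2 * m'" by linarith
      moreover have "w v * (8 * real ?p ^ 2) \<le> w v * 2 ^ z"
        using real_pow2_ge_cap[OF G] w0[of v] v(1) by (intro mult_left_mono) auto
      ultimately show ?thesis by linarith
    qed
    moreover have "card (X \<union> Y) \<le> ?p"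
      using card_mono[OF _ XY] finV card_seen_le[OF ext G A] by auto
    ultimately have *: "sum w (X \<union> Y) \<le> m' / 2 * (real (card (X \<union> Y)) / (real (card (X \<union> Y)) + 1))"
      using X finV u by (intro loss_increment[OF _ _ _ m0 m'(1) X(2)])
        (auto simp: Y_def intro: finite_subset)
    have "covered \<I> w S' u"
      unfolding covered_def
    proof (intro exI conjI)
      show "w u < 2 * b" by (rule b(3))
      show "(u, b) \<in> set S' \<or> insert u (set (cls S' b)) \<notin> \<I>"
        by (auto simp: S' add_elem_def)
    qed
    with * show "\<exists>X. X \<subseteq> A \<inter> insert u V \<and>
          sum w X \<le> m' / 2 * (real (card X) / (real (card X) + 1)) \<and>
          (\<forall>v \<in> A \<inter> insert u V - X. covered \<I> w S' v)"
      using XY by (intro exI[of _ "X \<union> Y"]) (auto simp: Y_def)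
  qed
qed

section \<open>Comparison of the optimum with the classes\<close>

lemma sum_UN_le:
  fixes f :: "'b \<Rightarrow> real"
  assumes "finite J" "\<And>j. j \<in> J \<Longrightarrow> finite (B j)" "\<And>x. 0 \<le> f x"
  shows "sum f (\<Union>j\<in>J. B j) \<le> (\<Sum>j\<in>J. sum f (B j))"
  using assms(1,2)
proof (induction J rule: finite_induct)
  case (insert j J)
  have "sum f (B j \<union> (\<Union>i\<in>J. B i)) \<le> sum f (B j) + sum f (\<Union>i\<in>J. B i)"
    using insert assms(3) by (subst sum.union_inter[symmetric]) (auto intro: sum_nonneg)
  with insert show ?case by force
qed simp

definition class_value :: "nat \<Rightarrow> real \<Rightarrow> ('a \<times> real) list \<Rightarrow> nat \<Rightarrow> real" where
  "class_value z m S j = 2 ^ j * m / 2 ^ z * real (length (cls S (2 ^ j * m / 2 ^ z)))"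

text \<open>The lost part \<open>X\<close> of an optimum weighs at most \<open>m / 2\<close>, hence
  at most half of the optimum, because \<open>m\<close> is bounded by the weight of an independent
  singleton. The rest falls into the sets \<open>D j\<close>, with respect to which the greedy set
  of class \<open>j\<close> is maximal; so \<open>D j\<close> has at most \<open>k\<close> times as
  many elements, each of weight below twice the grid weight.\<close>

lemma optimum_le_class_values:
  assumes ext: "k_extendible k N \<I>" "1 \<le> k" and w: "\<And>u. u \<in> N \<Longrightarrow> 0 \<le> w u"
    and V: "V = {u \<in> N. {u} \<in> \<I> \<and> 0 < w u}"
    and cl: "classes \<I> w V z m S" and loss: "small_loss \<I> w V m S"
    and opt: "optimal \<I> w A"
  shows "sum w A \<le> 4 * real k * (\<Sum>j\<le>z. class_value z m S j)"
proof -
  note down = k_extendible_system(4)[OF ext(1)] and emp = k_extendible_system(3)[OF ext(1)]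
    and sub = k_extendible_system(5)[OF ext(1)] and fin = k_extendible_system(6)[OF ext(1)]
  have A: "A \<in> \<I>" and Amax: "\<And>B. B \<in> \<I> \<Longrightarrow> sum w B \<le> sum w A"
    using opt by (auto simp: optimal_def is_arg_max_linorder)
  from loss A obtain X where X: "X \<subseteq> A \<inter> V"
    "sum w X \<le> m / 2 * (real (card X) / (real (card X) + 1))"
    "\<forall>v \<in> A \<inter> V - X. covered \<I> w S v" by (auto simp: small_loss_def)
  have m0: "0 \<le> m" using cl by (simp add: classes_def)
  have "m \<le> sum w A"
  proof (cases "0 < m")
    case True
    with cl obtain u where "u \<in> V" "m \<le> w u" by (auto simp: classes_def)
    with Amax[of "{u}"] V show ?thesis by simp
  next
    case False
    then show ?thesis using Amax[OF emp] m0 by simp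
  qed
  moreover have "m / 2 * (real (card X) / (real (card X) + 1)) \<le> m / 2 * 1"
    using m0 by (intro mult_left_mono) auto
  ultimately have X2: "sum w X \<le> sum w A / 2" using X(2) by linarith
  define b where "b = (\<lambda>j::nat. 2 ^ j * m / 2 ^ z)"
  define D where "D = (\<lambda>j. {v \<in> A \<inter> V. w v < 2 * b j \<and> (v \<in> set (cls S (b j)) \<or> insert v (set (cls S (b j))) \<notin> \<I>)})"
  have cov: "A \<inter> V - X \<subseteq> (\<Union>j\<in>{..z}. D j)"
  proof
    fix v assume v: "v \<in> A \<inter> V - X"
    with X(3) obtain c where c: "w v < 2 * c" "(v, c) \<in> set S \<or> insert v (set (cls S c)) \<notin> \<I>"
      by (auto simp: covered_def)
    \<comment> \<open>An empty class cannot reject \<open>v\<close>, since \<open>{v}\<close> is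
      independent for \<open>v\<close> in \<open>V\<close>. Hence \<open>c\<close> is the rounded
      weight of a stored element and lies on the grid.\<close>
    have "set (cls S c) \<noteq> {}"
    proof
      assume "set (cls S c) = {}"
      then have "(v, c) \<notin> set S" "insert v (set (cls S c)) = {v}" by (auto simp: set_cls)
      with c(2) v V show False by simp
    qed
    then obtain e where "(e, c) \<in> set S" by (auto simp: set_cls)
    with cl obtain j where j: "j \<le> z" "c * 2 ^ z = 2 ^ j * m" unfolding classes_def by blast
    then have "c = b j" by (simp add: b_def field_simps)
    with j v c show "v \<in> (\<Union>j\<in>{..z}. D j)" by (auto simp: D_def set_cls)
  qed
  have Dle: "sum w (D j) \<le> 2 * real k * class_value z m S j" for j
  proof -
    have DI: "D j \<in> \<I>" by (rule down[OF A]) (auto simp: D_def)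
    have "card (D j) \<le> k * card (set (cls S (b j)))"
      by (rule k_extendible_maximal_card[OF ext DI]) (use cl in \<open>auto simp: classes_def D_def\<close>)
    also have "\<dots> = k * length (cls S (b j))"
      using cl by (simp add: classes_def distinct_card distinct_cls)
    finally have "real (card (D j)) \<le> real (k * length (cls S (b j)))" by (simp only: of_nat_le_iff)
    moreover have "sum w (D j) \<le> real (card (D j)) * (2 * b j)"
      by (rule sum_bounded_above) (auto simp: D_def)
    moreover have "0 \<le> 2 * b j" using m0 by (simp add: b_def)
    ultimately have "sum w (D j) \<le> real (k * length (cls S (b j))) * (2 * b j)"
      by (meson mult_right_mono order_trans)
    also have "\<dots> = 2 * real k * class_value z m S j" by (simp add: class_value_def b_def)
    finally show ?thesis .
  qed
  have finA: "finite A" by (rule fin[OF A])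
  \<comment> \<open>\<open>w\<close> may be negative outside \<open>N\<close>, whereas
    \<open>sum_UN_le\<close> wants a function that is nonnegative everywhere.\<close>
  let ?w = "\<lambda>u. if u \<in> N then w u else 0"
  have wN: "sum w B = sum ?w B" if "B \<subseteq> A" for B
    using sub[OF A] that by (intro sum.cong) auto
  have "sum w A = sum w (A \<inter> V)"
  proof (rule sum.mono_neutral_right)
    show "\<forall>i\<in>A - A \<inter> V. w i = 0"
    proof
      fix i assume i: "i \<in> A - A \<inter> V"
      then have "i \<in> N" "{i} \<in> \<I>" using sub[OF A] down[OF A, of "{i}"] by auto
      with i w[of i] V show "w i = 0" by force
    qed
  qed (use finA in auto)
  also have "\<dots> = sum w X + sum w (A \<inter> V - X)"
    using X(1) finA by (subst sum.subset_diff[of X]) auto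
  also have "sum w (A \<inter> V - X) \<le> (\<Sum>j\<le>z. sum w (D j))"
  proof -
    have "sum w (A \<inter> V - X) = sum ?w (A \<inter> V - X)" by (rule wN) auto
    also have "\<dots> \<le> sum ?w (\<Union>j\<in>{..z}. D j)"
      by (rule sum_mono2) (use cov w finA in \<open>auto simp: D_def\<close>)
    also have "\<dots> \<le> (\<Sum>j\<le>z. sum ?w (D j))"
      by (rule sum_UN_le) (use finA w in \<open>auto simp: D_def\<close>)
    also have "\<dots> = (\<Sum>j\<le>z. sum w (D j))"
      by (rule sum.cong[OF refl], rule wN[symmetric]) (auto simp: D_def)
    finally show ?thesis .
  qed
  also have "(\<Sum>j\<le>z. sum w (D j)) \<le> (\<Sum>j\<le>z. 2 * real k * class_value z m S j)"
    by (rule sum_mono) (rule Dle)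
  also have "\<dots> = 2 * real k * (\<Sum>j\<le>z. class_value z m S j)" by (simp add: sum_distrib_left)
  finally show ?thesis using X2 by linarith
qed

section \<open>Merging the classes\<close>

text \<open>Extendibility gives \<open>k * length E\<close>. The trivial bound
  \<open>length T\<close> may be multiplied by \<open>length E\<close> unless \<open>E\<close> is
  empty, and then nothing is lost. The minimum keeps the number of groups, and so the running time,
  independent of a huge \<open>k\<close>.\<close>

lemma greedy_loss:
  assumes ext: "k_extendible k N \<I>" and E: "set E \<in> \<I>" and T: "set T \<in> \<I>"
    and dist: "distinct (E @ T)"
  shows "card (set T - set (greedy \<I> E T)) \<le> min k (length T) * length E"
proof -
  define M where "M = set (greedy \<I> E T)"
  have M: "M \<in> \<I>" "set E \<subseteq> M" "M \<subseteq> set E \<union> set T"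
    using greedy_props[OF E, of T] by (auto simp: M_def)
  have eq: "(M \<inter> set T) \<union> set E = M" using M dist by auto
  have "card (set T - M \<inter> set T) \<le> k * card (set E)"
  proof (rule k_extendible_maximal_loss[OF ext _ T])
    show "M \<inter> set T \<union> set E \<in> \<I>" unfolding eq by (rule M(1))
    fix t assume "t \<in> set T - M \<inter> set T"
    then show "insert t (M \<inter> set T \<union> set E) \<notin> \<I>"
      unfolding eq unfolding M_def using greedy_maximal[OF k_extendible_system(1)[OF ext] E, of T] by auto
  qed (use dist in auto)
  moreover have "set T - M \<inter> set T = set T - M" by auto
  moreover have "card (set E) = length E" using dist by (simp add: distinct_card)
  ultimately have 1: "card (set T - M) \<le> k * length E" by simp
  have 2: "card (set T - M) \<le> length T"
    by (meson Diff_subset List.finite_set card_length card_mono order_trans)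
  show ?thesis
  proof (cases "length E")
    case 0
    then show ?thesis using 1 by (simp add: M_def)
  next
    case (Suc l)
    have "card (set T - M) \<le> length T * length E" using 2 Suc by simp
    with 1 show ?thesis by (simp add: M_def min_def)
  qed
qed

text \<open>At most \<open>Q / 2\<close> elements are lost per element of \<open>E\<close>, each of
  weight at most \<open>c / Q\<close>, so the loss is at most half of the weight that
  \<open>E\<close> brings in. The other half pays for the growth of the left-hand side; thus the
  factor 2 does not accumulate over the rounds.\<close>

lemma greedy_value:
  assumes ext: "k_extendible k N \<I>" and E: "set E \<in> \<I>" and T: "set T \<in> \<I>"
    and dist: "distinct (E @ T)"
    and Q: "2 * min k n \<le> Q" "0 < Q" and n: "length T \<le> n"
    and \<beta>E: "\<And>e. e \<in> set E \<Longrightarrow> \<beta> e = c" and \<beta>T: "\<And>e. e \<in> set T \<Longrightarrow> \<beta> e * real Q \<le> c"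
    and c: "0 \<le> c" and v: "v \<le> 2 * sum \<beta> (set T)"
  shows "v + c * real (length E) \<le> 2 * sum \<beta> (set (greedy \<I> E T))"
proof -
  define M where "M = set (greedy \<I> E T)"
  have M: "set E \<subseteq> M" "M \<subseteq> set E \<union> set T"
    using greedy_props[OF E, of T] by (auto simp: M_def)
  have M': "M = set E \<union> (M \<inter> set T)" "set E \<inter> (M \<inter> set T) = {}" using M dist by auto
  have "sum \<beta> M = sum \<beta> (set E) + sum \<beta> (M \<inter> set T)"
    by (subst M'(1)) (use M'(2) in \<open>auto intro!: sum.union_disjoint\<close>)
  moreover have "sum \<beta> (set E) = c * real (length E)"
    using \<beta>E dist by (simp add: distinct_card)
  moreover have "sum \<beta> (set T) = sum \<beta> (set T - M) + sum \<beta> (M \<inter> set T)"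
    by (subst sum.Int_Diff[of _ _ M]) (auto simp: Int_commute)
  moreover have "2 * sum \<beta> (set T - M) \<le> c * real (length E)"
  proof -
    have "sum \<beta> (set T - M) \<le> real (card (set T - M)) * (c / real Q)"
      by (rule sum_bounded_above) (use \<beta>T Q in \<open>simp add: field_simps\<close>)
    moreover have "2 * card (set T - M) \<le> Q * length E"
    proof -
      have "card (set T - M) \<le> min k (length T) * length E"
        unfolding M_def by (rule greedy_loss[OF ext E T dist])
      also have "\<dots> \<le> min k n * length E" using n by (intro mult_right_mono) auto
      finally have "2 * card (set T - M) \<le> (2 * min k n) * length E" by simp
      also have "\<dots> \<le> Q * length E" using Q by (intro mult_right_mono) auto
      finally show ?thesis .
    qed
    then have "real (2 * card (set T - M)) * (c / real Q) \<le> real (Q * length E) * (c / real Q)"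
      using c by (intro mult_right_mono) (simp_all only: of_nat_le_iff, auto)
    moreover have "real (Q * length E) * (c / real Q) = c * real (length E)" using Q(2) by simp
    moreover have "real (2 * card (set T - M)) * (c / real Q) = 2 * (real (card (set T - M)) * (c / real Q))"
      by simp
    ultimately show ?thesis by linarith
  qed
  ultimately show ?thesis using v unfolding M_def by linarith
qed

text \<open>Merging is analysed with the rounded weights, because they have the exact gap
  \<open>2 ^ q\<close> between consecutive classes of a group. Elements are stored once, so
  \<open>map_of\<close> is unambiguous.\<close>

definition base_weight :: "('a \<times> real) list \<Rightarrow> 'a \<Rightarrow> real" where
  "base_weight S e = the (map_of S e)"

lemma base_weight: "distinct (map fst S) \<Longrightarrow> (e, b) \<in> set S \<Longrightarrow> base_weight S e = b"
  by (simp add: base_weight_def)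

text \<open>\<open>v\<close> is the total value of the classes processed so far and not the value of
  \<open>T\<close>; the program accumulates it and compares the groups by it. The weight condition
  on \<open>T\<close> anticipates the next class, whose index is \<open>r + q * i\<close>.\<close>

definition merging ::
    "'a set set \<Rightarrow> nat \<Rightarrow> real \<Rightarrow> ('a \<times> real) list \<Rightarrow> nat \<Rightarrow> nat \<Rightarrow> nat \<Rightarrow> 'a list \<Rightarrow> real \<Rightarrow> bool" where
  "merging \<I> z m S q r i T v \<longleftrightarrow>
     set T \<in> \<I> \<and> distinct T \<and>
     (\<forall>e\<in>set T. \<exists>b. (e, b) \<in> set S \<and> b * 2 ^ q \<le> 2 ^ (r + q * i) * m / 2 ^ z) \<and>
     v = (\<Sum>i'<i. class_value z m S (r + q * i')) \<and> v \<le> 2 * sum (base_weight S) (set T)"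

lemma merging_0: "{} \<in> \<I> \<Longrightarrow> merging \<I> z m S q r 0 [] 0"
  by (simp add: merging_def)

text \<open>By the invariant the elements of \<open>T\<close> have rounded weight at most
  \<open>c / 2 ^ q\<close>. For a nonempty class this is strictly below \<open>c\<close> because
  \<open>0 < q\<close>.\<close>

lemma merging_disjoint:
  assumes cl: "classes \<I> w V z m S" and q: "0 < q"
    and mg: "merging \<I> z m S q r i T v"
    and c: "c = 2 ^ (r + q * i) * m / 2 ^ z"
  shows "distinct (cls S c @ T)"
proof -
  let ?E = "cls S c"
  have S: "distinct (map fst S)" using cl by (auto simp: classes_def)
  have Spos: "0 < b" if "(e, b) \<in> set S" for e b using cl that by (auto simp: classes_def)
  have q1: "(1::real) < 2 ^ q" using q by simp
  have T: "distinct T" using mg by (auto simp: merging_def)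
  have TS: "\<exists>b. (e, b) \<in> set S \<and> b * 2 ^ q \<le> c" if "e \<in> set T" for e
    using mg that unfolding c merging_def by blast
  have "set ?E \<inter> set T = {}"
  proof (rule ccontr)
    assume "set ?E \<inter> set T \<noteq> {}"
    then obtain e where e: "(e, c) \<in> set S" "e \<in> set T" by (auto simp: set_cls)
    from TS[OF e(2)] obtain b where b: "(e, b) \<in> set S" "b * 2 ^ q \<le> c" by blast
    have "b = c" using base_weight[OF S] e(1) b(1) by metis
    moreover have "c * 1 < c * 2 ^ q" using Spos[OF e(1)] q1 by (intro mult_strict_left_mono)
    ultimately show False using b(2) by simp
  qed
  then show ?thesis using T distinct_cls[OF S] by simp
qed

lemma merging_Suc:
  assumes ext: "k_extendible k N \<I>" and cl: "classes \<I> w V z m S" and finV: "finite V"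
    and Q: "2 * min k (card V) \<le> 2 ^ q" and q: "0 < q"
    and mg: "merging \<I> z m S q r i T v"
    and c: "c = 2 ^ (r + q * i) * m / 2 ^ z"
  shows "merging \<I> z m S q r (Suc i) (greedy \<I> (cls S c) T) (v + c * real (length (cls S c)))"
proof -
  let ?E = "cls S c" let ?T = "greedy \<I> ?E T"
  have S: "distinct (map fst S)" "0 \<le> m" "set ?E \<in> \<I>" "fst ` set S \<subseteq> V"
    using cl by (auto simp: classes_def)
  have c0: "0 \<le> c" using S(2) by (simp add: c)
  have T: "set T \<in> \<I>" "distinct T" using mg by (auto simp: merging_def)
  have TS: "\<exists>b. (e, b) \<in> set S \<and> b * 2 ^ q \<le> c" if "e \<in> set T" for e
    using mg that unfolding c merging_def by blast
  have dist: "distinct (?E @ T)" by (rule merging_disjoint[OF cl q mg c])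
  note gp = greedy_props[OF S(3), of T]
  have step: "2 ^ (r + q * Suc i) * m / 2 ^ z = c * 2 ^ q"
    by (simp add: c power_add)
  show ?thesis
    unfolding merging_def
  proof (intro conjI ballI)
    show "set ?T \<in> \<I>" "distinct ?T" using gp dist by auto
    show "\<exists>b. (e, b) \<in> set S \<and> b * 2 ^ q \<le> 2 ^ (r + q * Suc i) * m / 2 ^ z" if "e \<in> set ?T" for e
    proof -
      from that gp consider "(e, c) \<in> set S" | "e \<in> set T" by (auto simp: set_cls)
      then show ?thesis
      proof cases
        case 1
        then show ?thesis unfolding step by blast
      next
        case 2
        from TS[OF this] obtain b where b: "(e, b) \<in> set S" "b * 2 ^ q \<le> c" by blast
        have "c * 1 \<le> c * 2 ^ q" using c0 by (intro mult_left_mono) auto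
        with b(2) have "b * 2 ^ q \<le> c * 2 ^ q" by linarith
        with b(1) show ?thesis unfolding step by blast
      qed
    qed
    show "v + c * real (length ?E) = (\<Sum>i'<Suc i. class_value z m S (r + q * i'))"
      using mg by (simp add: merging_def class_value_def c)
    show "v + c * real (length ?E) \<le> 2 * sum (base_weight S) (set ?T)"
    proof (rule greedy_value[OF ext S(3) T(1) dist Q])
      have "set T \<subseteq> V" using TS S(4) by force
      then show "length T \<le> card V" using T(2) finV by (metis card_mono distinct_card)
      show "base_weight S e = c" if "e \<in> set ?E" for e
        using that base_weight[OF S(1)] by (auto simp: set_cls)
      show "base_weight S e * real (2 ^ q) \<le> c" if "e \<in> set T" for e
        using TS[OF that] base_weight[OF S(1)] by auto
    qed (use c0 mg in \<open>auto simp: merging_def\<close>)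
  qed
qed

lemma merging_weight:
  assumes cl: "classes \<I> w V z m S" and mg: "merging \<I> z m S q r i T v"
  shows "v \<le> 2 * sum w (set T)"
proof -
  have "base_weight S e \<le> w e" if e: "e \<in> set T" for e
  proof -
    obtain b where "(e, b) \<in> set S" using mg e by (auto simp: merging_def)
    moreover have "distinct (map fst S)" using cl by (simp add: classes_def)
    ultimately show ?thesis using cl base_weight[of S e b] by (auto simp: classes_def)
  qed
  then have "sum (base_weight S) (set T) \<le> sum w (set T)" by (intro sum_mono)
  with mg show ?thesis unfolding merging_def by linarith
qed

text \<open>Index \<open>j\<close> is found in group \<open>j mod q\<close> at position
  \<open>j div q\<close>. The lengths \<open>h r\<close> may differ, and a group may run past
  \<open>z\<close>, which only adds nonnegative terms.\<close>

lemma sum_residue_classes_ge: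
  fixes f :: "nat \<Rightarrow> real"
  assumes q: "0 < q" and f: "\<And>j. 0 \<le> f j" and h: "\<And>r. r < q \<Longrightarrow> z < r + q * h r"
  shows "(\<Sum>j\<le>z. f j) \<le> (\<Sum>r<q. \<Sum>i<h r. f (r + q * i))"
proof -
  have "(\<Sum>r<q. \<Sum>i<h r. f (r + q * i)) = (\<Sum>(r, i)\<in>Sigma {..<q} (\<lambda>r. {..<h r}). f (r + q * i))"
    by (subst sum.Sigma) auto
  moreover have "(\<Sum>j\<le>z. f j) = (\<Sum>(r, i)\<in>(\<lambda>j. (j mod q, j div q)) ` {..z}. f (r + q * i))"
  proof (subst sum.reindex)
    show "inj_on (\<lambda>j. (j mod q, j div q)) {..z}"
      by (rule inj_onI) (metis mod_mult_div_eq prod.inject)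
  qed simp
  moreover have "(\<Sum>(r, i)\<in>(\<lambda>j. (j mod q, j div q)) ` {..z}. f (r + q * i))
      \<le> (\<Sum>(r, i)\<in>Sigma {..<q} (\<lambda>r. {..<h r}). f (r + q * i))"
  proof (rule sum_mono2)
    show "(\<lambda>j. (j mod q, j div q)) ` {..z} \<subseteq> Sigma {..<q} (\<lambda>r. {..<h r})"
    proof clarsimp
      fix j assume j: "j \<le> z"
      have "j mod q + q * (j div q) < j mod q + q * h (j mod q)"
        using h[of "j mod q"] q j by simp
      then have "q * (j div q) < q * h (j mod q)" by (rule add_less_imp_less_left)
      then show "j mod q < q \<and> j div q < h (j mod q)" using q by (simp only: mult_less_cancel1 mod_less_divisor simp_thms)
    qed
  qed (use f in auto)
  ultimately show ?thesis by simp
qed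

text \<open>Averaging: \<open>v\<close> is at least the value of each of the \<open>q\<close>
  groups, which together contain all classes. The 8 is the 4 of
  \<open>optimum_le_class_values\<close> times the 2 of the merge.\<close>

lemma approximation_ratio:
  assumes ext: "k_extendible k N \<I>" "1 \<le> k" and w: "\<And>u. u \<in> N \<Longrightarrow> 0 \<le> w u"
    and V: "V = {u \<in> N. {u} \<in> \<I> \<and> 0 < w u}"
    and cl: "classes \<I> w V z m S" and loss: "small_loss \<I> w V m S"
    and q: "0 < q"
    and best: "\<And>r. r < q \<Longrightarrow> \<exists>i. z < r + q * i \<and> (\<Sum>i'<i. class_value z m S (r + q * i')) \<le> v"
    and T: "set T \<in> \<I>" "v \<le> 2 * sum w (set T)"
  shows "approximates (8 * real k * real q) \<I> w (set T)"
  unfolding approximates_def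
proof (intro conjI allI impI)
  show "set T \<in> \<I>" by (rule T)
  fix A assume "optimal \<I> w A"
  from optimum_le_class_values[OF ext w V cl loss this]
  have A: "sum w A \<le> 4 * real k * (\<Sum>j\<le>z. class_value z m S j)" by simp
  from best obtain h where h: "z < r + q * h r" "(\<Sum>i'<h r. class_value z m S (r + q * i')) \<le> v"
    if "r < q" for r by metis
  have "(\<Sum>j\<le>z. class_value z m S j) \<le> (\<Sum>r<q. \<Sum>i<h r. class_value z m S (r + q * i))"
    by (rule sum_residue_classes_ge[OF q]) (use h cl in \<open>auto simp: class_value_def classes_def\<close>)
  also have "\<dots> \<le> (\<Sum>r<q. v)" by (rule sum_mono) (use h in auto)
  also have "\<dots> \<le> real q * (2 * sum w (set T))" using T(2) by (simp add: mult_left_mono)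
  finally have "4 * real k * (\<Sum>j\<le>z. class_value z m S j) \<le> 4 * real k * (real q * (2 * sum w (set T)))"
    by (rule mult_left_mono) simp
  with A show "sum w A \<le> 8 * real k * real q * sum w (set T)" by (simp add: algebra_simps)
qed

lemma length_classes_le:
  assumes cl: "classes \<I> w V z m S" and rank: "\<And>A. A \<in> \<I> \<Longrightarrow> card A \<le> \<rho>"
  shows "length S \<le> \<rho> * (z + 1)"
proof -
  have dist: "distinct (map fst S)" using cl by (simp add: classes_def)
  then have "length S = card (fst ` set S)" by (metis distinct_card length_map set_map)
  also have "fst ` set S \<subseteq> (\<Union>j\<in>{..z}. set (cls S (2 ^ j * m / 2 ^ z)))"
  proof
    fix e assume "e \<in> fst ` set S"
    then obtain b where b: "(e, b) \<in> set S" by auto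
    with cl obtain j where j: "j \<le> z" "b * 2 ^ z = 2 ^ j * m" by (auto simp: classes_def)
    then have "b = 2 ^ j * m / 2 ^ z" by (simp add: field_simps)
    with b j show "e \<in> (\<Union>j\<in>{..z}. set (cls S (2 ^ j * m / 2 ^ z)))" by (auto simp: set_cls)
  qed
  then have "card (fst ` set S) \<le> card (\<Union>j\<in>{..z}. set (cls S (2 ^ j * m / 2 ^ z)))"
    by (intro card_mono) auto
  also have "\<dots> \<le> (\<Sum>j\<in>{..z}. card (set (cls S (2 ^ j * m / 2 ^ z))))"
    by (rule card_UN_le) simp
  also have "\<dots> \<le> (\<Sum>j\<in>{..z}. \<rho>)"
    by (rule sum_mono) (use cl rank in \<open>auto simp: classes_def\<close>)
  finally show ?thesis by (simp add: algebra_simps)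
qed

section \<open>Weakest preconditions\<close>

text \<open>Total correctness with time: the existential asserts a halting run, which includes the
  absence of overflows and illegal accesses. By \<open>exec_deterministic\<close> this run is the
  only one.\<close>

definition wp :: "'a set set \<Rightarrow> ('a \<Rightarrow> real) \<Rightarrow> nat \<Rightarrow> com \<Rightarrow> 'a state \<Rightarrow> (nat \<Rightarrow> 'a state \<Rightarrow> bool) \<Rightarrow> bool" where
  "wp \<I> w B c s Q \<longleftrightarrow> (\<exists>t s'. exec \<I> w B c s t s' \<and> Q t s')"

lemma wp_mono:
  "wp \<I> w B c s P \<Longrightarrow> (\<And>t s'. P t s' \<Longrightarrow> Q t s') \<Longrightarrow> wp \<I> w B c s Q"
  unfolding wp_def by blast

definition put :: "nat \<Rightarrow> 'b \<Rightarrow> 'b list \<Rightarrow> 'b list" where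
  "put i v xs = take i xs @ v # drop (Suc i) xs"

lemma write_cell_put: "write_cell m x i v = m(x := put i v (m x))"
  by (simp add: write_cell_def put_def)

lemma put_0 [simp]: "length xs \<le> 1 \<Longrightarrow> put 0 v xs = [v]"
  by (cases xs) (auto simp: put_def)

lemma length_put [simp]: "i \<le> length xs \<Longrightarrow> length (put i v xs) = max (length xs) (Suc i)"
  by (auto simp: put_def)

lemma take_put [simp]: "j \<le> i \<Longrightarrow> i \<le> length xs \<Longrightarrow> take j (put i v xs) = take j xs"
  by (simp add: put_def min_absorb1)

lemma take_Suc_put [simp]: "i \<le> length xs \<Longrightarrow> take (Suc i) (put i v xs) = take i xs @ [v]"
  by (simp add: put_def)

lemma nth_put: "i \<le> length xs \<Longrightarrow> j < length xs \<Longrightarrow> put i v xs ! j = (if j = i then v else xs ! j)"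
  by (auto simp: put_def nth_append nth_Cons' min_def)

lemma nth_default_single [simp]: "nth_default d [x] 0 = x"
  by (simp add: nth_default_def)

lemma wp_Skip [simp]: "wp \<I> w B Skip s Q \<longleftrightarrow> Q 1 s"
  unfolding wp_def by (auto elim!: exec_elims(1)) (use exec.Skip in fastforce)

lemma wp_NAssign: "wp \<I> w B (NAssign x i e) s Q \<longleftrightarrow>
    nval s i \<le> length (nums s x) \<and> nval s e \<le> B \<and>
    Q 1 (s\<lparr>nums := (nums s)(x := put (nval s i) (nval s e) (nums s x))\<rparr>)"
  unfolding wp_def write_cell_put[symmetric] by (auto elim!: exec_elims(2)) (use exec.NAssign in fastforce)

lemma wp_WAssign: "wp \<I> w B (WAssign x i e) s Q \<longleftrightarrow>
    nval s i \<le> length (wts s x) \<and>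
    Q 1 (s\<lparr>wts := (wts s)(x := put (nval s i) (wval s e) (wts s x))\<rparr>)"
  unfolding wp_def write_cell_put[symmetric] by (auto elim!: exec_elims(3)) (use exec.WAssign in fastforce)

lemma wp_EAssign [simp]: "wp \<I> w B (EAssign x i y j) s Q \<longleftrightarrow>
    nval s i \<le> length (elts s x) \<and> nval s j < length (elts s y) \<and>
    Q 1 (s\<lparr>elts := (elts s)(x := put (nval s i) (elts s y ! nval s j) (elts s x))\<rparr>)"
  unfolding wp_def write_cell_put[symmetric] by (auto elim!: exec_elims(4)) (use exec.EAssign in fastforce)

lemma wp_Read [simp]: "pending s = u # us \<Longrightarrow> wp \<I> w B (Read x i y j) s Q \<longleftrightarrow>
    nval s i \<le> length (elts s x) \<and> nval s j \<le> length (wts s y) \<and>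
    Q 1 (s\<lparr>elts := (elts s)(x := put (nval s i) u (elts s x)),
           wts := (wts s)(y := put (nval s j) (w u) (wts s y)), pending := us\<rparr>)"
  unfolding wp_def write_cell_put[symmetric] by (auto elim!: exec_elims(5)) (use exec.Read in fastforce)

lemma wp_Query:
  assumes "1 \<le> B"
  shows "wp \<I> w B (Query x i y a b) s Q \<longleftrightarrow>
    nval s i \<le> length (nums s x) \<and>
    Q (1 + length (take (nval s b - nval s a) (drop (nval s a) (elts s y))))
      (s\<lparr>nums := (nums s)(x := put (nval s i)
        (if set (take (nval s b - nval s a) (drop (nval s a) (elts s y))) \<in> \<I> then 1 else 0) (nums s x))\<rparr>)"
    (is "?L \<longleftrightarrow> ?R")
proof
  assume ?L
  then show ?R unfolding wp_def write_cell_put[symmetric] by (auto elim!: exec_elims(6))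
next
  assume R: ?R
  have "exec \<I> w B (Query x i y a b) s (1 + length (take (nval s b - nval s a) (drop (nval s a) (elts s y))))
    (s\<lparr>nums := write_cell (nums s) x (nval s i)
        (if set (take (nval s b - nval s a) (drop (nval s a) (elts s y))) \<in> \<I> then 1 else 0)\<rparr>)"
    by (rule exec.Query) (use R assms in auto)
  with R show ?L unfolding wp_def write_cell_put[symmetric] by blast
qed

lemma wp_Seq [simp]: "wp \<I> w B (Seq c1 c2) s Q \<longleftrightarrow>
    wp \<I> w B c1 s (\<lambda>t1 s1. wp \<I> w B c2 s1 (\<lambda>t2. Q (t1 + t2)))"
  unfolding wp_def by (auto elim!: exec_elims(7)) (blast intro: exec.Seq)

lemma wp_If [simp]: "wp \<I> w B (If b c1 c2) s Q \<longleftrightarrow>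
    (if bval s b then wp \<I> w B c1 s (\<lambda>t. Q (1 + t)) else wp \<I> w B c2 s (\<lambda>t. Q (1 + t)))"
proof (cases "bval s b")
  case True
  then show ?thesis unfolding wp_def by (auto elim!: exec_elims(8)) (use exec.IfTrue in fastforce)
next
  case False
  then show ?thesis unfolding wp_def by (auto elim!: exec_elims(8)) (use exec.IfFalse in fastforce)
qed

text \<open>The natural number \<open>i\<close> in the loop invariant bounds the number of remaining iterations.\<close>

lemma wp_While:
  assumes "P i s" and "\<And>i s. P i s \<Longrightarrow> bval s b \<Longrightarrow> wp \<I> w B c s (\<lambda>t s'. t \<le> T \<and> (\<exists>i'<i. P i' s'))"
    and "\<And>i' s' t. P i' s' \<Longrightarrow> \<not> bval s' b \<Longrightarrow> t \<le> i * Suc T + 1 \<Longrightarrow> Q t s'"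
  shows "wp \<I> w B (While b c) s Q"
proof -
  have "\<exists>t s'. exec \<I> w B (While b c) s t s' \<and> t \<le> i * Suc T + 1 \<and> (\<exists>i'. P i' s') \<and> \<not> bval s' b"
    using assms(1)
  proof (induction i arbitrary: s rule: less_induct)
    case (less i)
    show ?case
    proof (cases "bval s b")
      case True
      from assms(2)[OF less.prems True] obtain t s' i' where
        1: "exec \<I> w B c s t s'" "t \<le> T" "i' < i" "P i' s'" unfolding wp_def by blast
      from less.IH[OF 1(3,4)] obtain t' s'' where
        2: "exec \<I> w B (While b c) s' t' s''" "t' \<le> i' * Suc T + 1" "\<exists>i'. P i' s''" "\<not> bval s'' b" by blast
      have "Suc i' * Suc T \<le> i * Suc T" using 1(3) by (intro mult_right_mono) auto
      then have "1 + t + t' \<le> i * Suc T + 1" using 1(2) 2(2) by simp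
      with exec.WhileTrue[OF True 1(1) 2(1)] 2(3,4) show ?thesis by blast
    next
      case False
      with less.prems exec.WhileFalse[of s b \<I> w B c] show ?thesis by (intro exI[of _ 1]) auto
    qed
  qed
  with assms(3) show ?thesis unfolding wp_def by blast
qed

text \<open>For counting loops: the invariant is indexed by completed iterations, and
  \<open>n - i\<close> is the measure handed to \<open>wp_While\<close>.\<close>

lemma wp_for:
  assumes "P 0 s" and "\<And>i s. i < n \<Longrightarrow> P i s \<Longrightarrow> bval s b \<and> wp \<I> w B c s (\<lambda>t s'. t \<le> T \<and> P (Suc i) s')"
    and "\<And>s. P n s \<Longrightarrow> \<not> bval s b" and "\<And>s' t. P n s' \<Longrightarrow> t \<le> n * Suc T + 1 \<Longrightarrow> Q t s'"
  shows "wp \<I> w B (While b c) s Q"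
proof (rule wp_While[where P = "\<lambda>j s. \<exists>i\<le>n. j = n - i \<and> P i s" and i = n])
  show "\<exists>i\<le>n. n = n - i \<and> P i s" using assms(1) by (intro exI[of _ 0]) simp
next
  fix j s' assume "\<exists>i\<le>n. j = n - i \<and> P i s'" "bval s' b"
  then obtain i where i: "i < n" "j = n - i" "P i s'" using assms(3) by (metis le_neq_implies_less)
  from assms(2)[OF i(1,3)] have "wp \<I> w B c s' (\<lambda>t s'. t \<le> T \<and> P (Suc i) s')" by simp
  then show "wp \<I> w B c s' (\<lambda>t s'. t \<le> T \<and> (\<exists>i'<j. \<exists>i\<le>n. i' = n - i \<and> P i s'))"
  proof (rule wp_mono)
    fix t s'' assume "t \<le> T \<and> P (Suc i) s''"
    with i show "t \<le> T \<and> (\<exists>i'<j. \<exists>i\<le>n. i' = n - i \<and> P i s'')"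
      by (intro conjI exI[of _ "n - Suc i"] exI[of _ "Suc i"]) auto
  qed
next
  fix j s' t assume "\<exists>i\<le>n. j = n - i \<and> P i s'" "\<not> bval s' b" "t \<le> n * Suc T + 1"
  then show "Q t s'" using assms(2,4) by (metis le_neq_implies_less)
qed

abbreviation (input) reg :: "nat \<Rightarrow> nexp" where "reg x \<equiv> NCell x (NConst 0)"
abbreviation (input) wreg :: "nat \<Rightarrow> wexp" where "wreg x \<equiv> WCell x (NConst 0)"
abbreviation (input) set_reg :: "nat \<Rightarrow> nexp \<Rightarrow> com" where "set_reg x e \<equiv> NAssign x (NConst 0) e"
abbreviation (input) set_wreg :: "nat \<Rightarrow> wexp \<Rightarrow> com" where "set_wreg x e \<equiv> WAssign x (NConst 0) e"

text \<open>At most one cell per array makes every write at index 0 legal, whether or not the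
  register has been used before. The cutoff on array names serves the count of memory cells.\<close>

definition regs :: "(nat \<Rightarrow> nat list) \<Rightarrow> bool" where
  "regs f \<longleftrightarrow> (\<forall>x. length (f x) \<le> 1) \<and> (\<forall>x\<ge>15. f x = [])"

definition wregs :: "(nat \<Rightarrow> real list) \<Rightarrow> bool" where
  "wregs f \<longleftrightarrow> (\<forall>x. x \<noteq> 1 \<longrightarrow> length (f x) \<le> 1) \<and> (\<forall>x\<ge>6. f x = [])"

lemma regs_upd [simp]: "regs f \<Longrightarrow> x < 15 \<Longrightarrow> length v \<le> 1 \<Longrightarrow> regs (f(x := v))"
  by (auto simp: regs_def)

lemma wregs_upd [simp]: "wregs f \<Longrightarrow> x < 6 \<Longrightarrow> x = 1 \<or> length v \<le> 1 \<Longrightarrow> wregs (f(x := v))"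
  by (auto simp: wregs_def)

lemma wp_set_reg [simp]:
  assumes "regs (nums s)"
  shows "wp \<I> w B (NAssign x (NConst 0) e) s Q \<longleftrightarrow>
    nval s e \<le> B \<and> Q 1 (s\<lparr>nums := (nums s)(x := [nval s e])\<rparr>)"
  using assms by (simp add: wp_NAssign regs_def)

lemma wp_set_wreg [simp]:
  assumes "wregs (wts s)" "x \<noteq> 1"
  shows "wp \<I> w B (WAssign x (NConst 0) e) s Q \<longleftrightarrow>
    Q 1 (s\<lparr>wts := (wts s)(x := [wval s e])\<rparr>)"
  using assms by (simp add: wp_WAssign wregs_def)

lemma wp_Query_reg [simp]:
  assumes "regs (nums s)" "1 \<le> B"
  shows "wp \<I> w B (Query x (NConst 0) y (NConst 0) b) s Q \<longleftrightarrow>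
    Q (1 + min (length (elts s y)) (nval s b))
      (s\<lparr>nums := (nums s)(x := [if set (take (nval s b) (elts s y)) \<in> \<I> then 1 else 0])\<rparr>)"
  using assms by (simp add: wp_Query regs_def)

section \<open>Loops of the program\<close>

text \<open>Memory layout. Number registers: 0 holds \<open>k\<close> and finally the length of the output; 14 and 2 count
  the relevant elements seen and those in \<open>G\<close>; 3 holds \<open>p\<close>, 4 the number \<open>2 ^ z\<close>, 5 the number
  of stored elements, 6 a loop index, 7 the size of the set under construction, 8 the answer to a
  query; in the final phase 9 holds \<open>2 ^ q\<close>, 10 identifies the group by \<open>2 ^ r\<close>, 11 the class by
  \<open>2 ^ (r + q * i)\<close>, and 12 and 13 are the sizes of the current and the best solution.
  Weights: register 0 the weight of the current element, array 1 the rounded weights of the stored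
  elements, registers 2, 3, 4 and 5 the maximum \<open>m\<close>, the current class, the value of the current
  group and the best value. Elements: array 0 the best solution, 1 the stored elements, 2 the set
  \<open>G\<close>, 3 the current element, 4 the set under construction, 5 the current solution.\<close>

definition collect_class :: com where
  "collect_class =
     Seq (set_reg 7 (NConst 0)) (Seq (set_reg 6 (NConst 0))
     (While (NLess (reg 6) (reg 5))
       (Seq (If (BAnd (BNot (WLess (WCell 1 (reg 6)) (wreg 3))) (BNot (WLess (wreg 3) (WCell 1 (reg 6)))))
              (Seq (EAssign 4 (reg 7) 1 (reg 6)) (set_reg 7 (NAdd (reg 7) (NConst 1))))
              Skip)
            (set_reg 6 (NAdd (reg 6) (NConst 1))))))"

text \<open>Cells are never released, so after a pruning the arrays may be longer than
  \<open>S\<close>; only their initial segments are meaningful.\<close>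

definition stored :: "'a state \<Rightarrow> ('a \<times> real) list \<Rightarrow> bool" where
  "stored s S \<longleftrightarrow> nums s 5 = [length S] \<and> length S \<le> length (elts s 1) \<and> length S \<le> length (wts s 1) \<and>
     take (length S) (elts s 1) = map fst S \<and> take (length S) (wts s 1) = map snd S"

lemma stored_nth:
  assumes "stored s S" "i < length S"
  shows "elts s 1 ! i = fst (S ! i)" "wts s 1 ! i = snd (S ! i)"
proof -
  have "take (length S) (elts s 1) ! i = map fst S ! i" "take (length S) (wts s 1) ! i = map snd S ! i"
    using assms(1) by (simp_all add: stored_def)
  with assms(2) show "elts s 1 ! i = fst (S ! i)" "wts s 1 ! i = snd (S ! i)" by simp_all
qed

text \<open>\<open>WLess\<close> is the only comparison of weights, so membership in the class is
  tested by two negated comparisons.\<close>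

lemma wp_collect_class:
  assumes S: "stored s S" and b: "wts s 3 = [b]" and reg: "regs (nums s)" and B: "Suc (length S) \<le> B"
  shows "wp \<I> w B collect_class s (\<lambda>t s'. t \<le> 6 * length S + 3 \<and>
     (\<exists>L. s' = s\<lparr>nums := (nums s)(7 := [length (cls S b)], 6 := [length S]), elts := (elts s)(4 := L)\<rparr> \<and>
        length (cls S b) \<le> length L \<and> take (length (cls S b)) L = cls S b \<and>
        length L \<le> max (length (elts s 4)) (length (cls S b))))"
proof -
  let ?C = "\<lambda>i. cls (take i S) b"
  let ?P = "\<lambda>i s'. \<exists>L. s' = s\<lparr>nums := (nums s)(7 := [length (?C i)], 6 := [i]), elts := (elts s)(4 := L)\<rparr> \<and>
      length (?C i) \<le> length L \<and> take (length (?C i)) L = ?C i \<and>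
      length L \<le> max (length (elts s 4)) (length (?C i))"
  have S5: "nums s 5 = [length S]" and len: "length S \<le> length (elts s 1)" "length S \<le> length (wts s 1)"
    using S by (auto simp: stored_def)
  show ?thesis
    unfolding collect_class_def
    apply (simp add: reg)
    apply (rule wp_for[where P = ?P and n = "length S" and T = 5])
    subgoal by (auto simp: cls_def intro!: exI[of _ "elts s 4"])
    subgoal premises prems for i s'
    proof -
      from prems(2) obtain L where
        s': "s' = s\<lparr>nums := (nums s)(7 := [length (?C i)], 6 := [i]), elts := (elts s)(4 := L)\<rparr>"
        and L: "length (?C i) \<le> length L" "take (length (?C i)) L = ?C i"
          "length L \<le> max (length (elts s 4)) (length (?C i))" by blast
      have i: "i < length S" by fact
      have CS: "?C (Suc i) = (if snd (S ! i) = b then ?C i @ [fst (S ! i)] else ?C i)"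
        using i by (simp add: take_Suc_conv_app_nth cls_append cls_def)
      have "length (?C i) \<le> i" using length_cls_le[of "take i S" b] i by simp
      then have le: "Suc (length (?C i)) \<le> B" "Suc i \<le> B" using i B by auto
      have d: "nth_default 0 (wts s (Suc 0)) i = snd (S ! i)"
        using i len stored_nth[OF S i] by (simp add: nth_default_def)
      have e: "elts s (Suc 0) ! i = fst (S ! i)" using stored_nth[OF S i] by simp
      show ?thesis
      proof (cases "snd (S ! i) = b")
        case True
        then show ?thesis
          using i L le len by (auto simp: s' S5 b reg d e CS
            intro!: exI[of _ "put (length (?C i)) (fst (S ! i)) L"])
      next
        case False
        then show ?thesis
          using i L le len by (auto simp: s' S5 b reg d e CS intro!: exI[of _ L])
      qed
    qed
    subgoal using S5 by auto
    subgoal by auto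
    done
qed

definition prune_stored :: com where
  "prune_stored =
     Seq (set_reg 7 (NConst 0)) (Seq (set_reg 6 (NConst 0))
     (Seq (While (NLess (reg 6) (reg 5))
       (Seq (If (WLess (WMul (reg 4) (WCell 1 (reg 6))) (wreg 2)) Skip
              (Seq (EAssign 1 (reg 7) 1 (reg 6)) (Seq (WAssign 1 (reg 7) (WCell 1 (reg 6)))
                (set_reg 7 (NAdd (reg 7) (NConst 1))))))
            (set_reg 6 (NAdd (reg 6) (NConst 1)))))
     (set_reg 5 (reg 7))))"

text \<open>Compaction in place: the write position never overtakes the read position, so the cells
  still to be read keep their contents. No element or weight cell is allocated.\<close>

lemma wp_prune_stored:
  assumes S: "stored s S" and m: "wts s 2 = [m]" and Z: "nums s 4 = [2 ^ z]"
    and reg: "regs (nums s)" and B: "Suc (length S) \<le> B"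
  shows "wp \<I> w B prune_stored s (\<lambda>t s'. t \<le> 6 * length S + 4 \<and>
     (\<exists>E W. s' = s\<lparr>nums := (nums s)(7 := [length (prune z m S)], 6 := [length S], 5 := [length (prune z m S)]),
          elts := (elts s)(1 := E), wts := (wts s)(1 := W)\<rparr> \<and>
        length E = length (elts s 1) \<and> length W = length (wts s 1) \<and>
        stored s' (prune z m S)))"
proof -
  let ?C = "\<lambda>i. prune z m (take i S)"
  let ?P = "\<lambda>i s'. \<exists>E W. s' = s\<lparr>nums := (nums s)(7 := [length (?C i)], 6 := [i]),
        elts := (elts s)(1 := E), wts := (wts s)(1 := W)\<rparr> \<and>
      length E = length (elts s 1) \<and> length W = length (wts s 1) \<and>
      take (length (?C i)) E = map fst (?C i) \<and> take (length (?C i)) W = map snd (?C i) \<and>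
      (\<forall>j. i \<le> j \<and> j < length S \<longrightarrow> E ! j = fst (S ! j) \<and> W ! j = snd (S ! j))"
  have S5: "nums s 5 = [length S]" and len: "length S \<le> length (elts s 1)" "length S \<le> length (wts s 1)"
    using S by (auto simp: stored_def)
  have lenC: "length (?C i) \<le> i" for i
    unfolding prune_def by (metis length_filter_le length_take min.bounded_iff)
  have lenCS: "length (prune z m S) \<le> length S" by (simp add: prune_def)
  show ?thesis
    unfolding prune_stored_def
    apply (simp add: reg)
    apply (rule wp_for[where P = ?P and n = "length S" and T = 5])
    subgoal using stored_nth[OF S] by (auto simp: prune_def intro!: exI[of _ "elts s 1"] exI[of _ "wts s 1"])
    subgoal premises prems for i s'
    proof -
      from prems(2) obtain E W where
        s': "s' = s\<lparr>nums := (nums s)(7 := [length (?C i)], 6 := [i]),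
          elts := (elts s)(1 := E), wts := (wts s)(1 := W)\<rparr>"
        and L: "length E = length (elts s 1)" "length W = length (wts s 1)"
          "take (length (?C i)) E = map fst (?C i)" "take (length (?C i)) W = map snd (?C i)"
          "\<forall>j. i \<le> j \<and> j < length S \<longrightarrow> E ! j = fst (S ! j) \<and> W ! j = snd (S ! j)" by blast
      have i: "i < length S" by fact
      have CS: "?C (Suc i) = (if m \<le> snd (S ! i) * 2 ^ z then ?C i @ [S ! i] else ?C i)"
        using i by (simp add: take_Suc_conv_app_nth prune_def)
      have le: "Suc (length (?C i)) \<le> B" "Suc i \<le> B" using i B lenC[of i] by auto
      have Ei: "E ! i = fst (S ! i)" "W ! i = snd (S ! i)" using L(5) i by auto
      have d: "nth_default 0 W i = snd (S ! i)"
        using i len L(2) Ei by (simp add: nth_default_def)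
      have lenE: "length (?C i) < length E" "length (?C i) < length W" "i < length E"
        using lenC[of i] i L len by auto
      show ?thesis
      proof (cases "m \<le> snd (S ! i) * 2 ^ z")
        case True
        have nth: "put (length (?C i)) (fst (S ! i)) E ! j = fst (S ! j) \<and>
            put (length (?C i)) (snd (S ! i)) W ! j = snd (S ! j)" if "Suc i \<le> j" "j < length S" for j
          using that lenE lenC[of i] L len by (subst (1 2) nth_put) auto
        from True show ?thesis
          using i L le len lenE nth by (auto simp: s' S5 Z m reg d Ei CS wp_WAssign mult.commute
            intro!: exI[of _ "put (length (?C i)) (fst (S ! i)) E"] exI[of _ "put (length (?C i)) (snd (S ! i)) W"])
      next
        case False
        then show ?thesis
          using i L le len by (auto simp: s' S5 Z m reg d CS mult.commute intro!: exI[of _ E] exI[of _ W])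
      qed
    qed
    subgoal using S5 by auto
    subgoal premises prems for s' t
    proof -
      from prems(1) obtain E W where
        s': "s' = s\<lparr>nums := (nums s)(7 := [length (prune z m S)], 6 := [length S]),
          elts := (elts s)(1 := E), wts := (wts s)(1 := W)\<rparr>"
        and L: "length E = length (elts s 1)" "length W = length (wts s 1)"
          "take (length (prune z m S)) E = map fst (prune z m S)"
          "take (length (prune z m S)) W = map snd (prune z m S)" by auto
      show ?thesis
        using lenCS B len L prems(2)
        by (auto simp: s' reg stored_def intro!: exI[of _ E] exI[of _ W])
    qed
    done
qed

definition copy_elems :: "nat \<Rightarrow> nat \<Rightarrow> nat \<Rightarrow> com" where
  "copy_elems c y x =
     Seq (set_reg 6 (NConst 0))
     (While (NLess (reg 6) (reg c))
       (Seq (EAssign x (reg 6) y (reg 6)) (set_reg 6 (NAdd (reg 6) (NConst 1)))))"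

lemma wp_copy_elems:
  assumes c: "nums s c = [n]" "c \<noteq> 6" and n: "n \<le> length (elts s y)" and xy: "x \<noteq> y"
    and reg: "regs (nums s)" and B: "Suc n \<le> B"
  shows "wp \<I> w B (copy_elems c y x) s (\<lambda>t s'. t \<le> 3 * n + 2 \<and>
     (\<exists>L. s' = s\<lparr>nums := (nums s)(6 := [n]), elts := (elts s)(x := L)\<rparr> \<and>
        n \<le> length L \<and> take n L = take n (elts s y) \<and> length L \<le> max (length (elts s x)) n))"
proof -
  let ?P = "\<lambda>i s'. \<exists>L. s' = s\<lparr>nums := (nums s)(6 := [i]), elts := (elts s)(x := L)\<rparr> \<and>
        i \<le> length L \<and> take i L = take i (elts s y) \<and> length L \<le> max (length (elts s x)) i"
  show ?thesis
    unfolding copy_elems_def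
    apply (simp add: reg)
    apply (rule wp_for[where P = ?P and n = n and T = 2])
    subgoal by (auto intro!: exI[of _ "elts s x"])
    subgoal premises prems for i s'
    proof -
      from prems(2) obtain L where
        s': "s' = s\<lparr>nums := (nums s)(6 := [i]), elts := (elts s)(x := L)\<rparr>"
        and L: "i \<le> length L" "take i L = take i (elts s y)" "length L \<le> max (length (elts s x)) i" by blast
      have i: "i < n" by fact
      then have "take (Suc i) (elts s y) = take i (elts s y) @ [elts s y ! i]"
        using n by (simp add: take_Suc_conv_app_nth)
      then show ?thesis
        using i L n B xy c(2) by (auto simp: s' c reg intro!: exI[of _ "put i (elts s y ! i) L"])
    qed
    subgoal using c by auto
    subgoal by auto
    done
qed

definition grow_power :: "nat \<Rightarrow> nexp \<Rightarrow> com" where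
  "grow_power x e = While (NLess (reg x) e) (set_reg x (NMul (NConst 2) (reg x)))"

text \<open>Powers of 2 stand for their exponents, since the machine has no logarithm. The measure
  \<open>b - 2 ^ z\<close> is crude, but a time linear in \<open>b\<close> is good enough for a
  polynomial bound.\<close>

lemma wp_grow_power:
  assumes x: "nums s x = [2 ^ z]" and e: "\<And>v. nval (s\<lparr>nums := (nums s)(x := [v])\<rparr>) e = b"
    and reg: "regs (nums s)" "x < 15" and B: "2 * b \<le> B"
  shows "wp \<I> w B (grow_power x e) s (\<lambda>t s'. t \<le> 2 * b + 1 \<and>
     (\<exists>z'\<ge>z. s' = s\<lparr>nums := (nums s)(x := [2 ^ z'])\<rparr> \<and> b \<le> 2 ^ z' \<and> 2 ^ z' \<le> max (2 ^ z) (2 * b)))"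
  unfolding grow_power_def
proof (rule wp_While[where T = 1 and i = "b - 2 ^ z" and
      P = "\<lambda>i s'. \<exists>z'\<ge>z. s' = s\<lparr>nums := (nums s)(x := [2 ^ z'])\<rparr> \<and> 2 ^ z' \<le> max (2 ^ z) (2 * b) \<and> i = b - 2 ^ z'"])
  show "\<exists>z'\<ge>z. s = s\<lparr>nums := (nums s)(x := [2 ^ z'])\<rparr> \<and> 2 ^ z' \<le> max (2 ^ z) (2 * b) \<and> b - 2 ^ z = b - 2 ^ z'"
    using x by (intro exI[of _ z]) (auto simp: fun_upd_idem)
next
  fix i s' assume "\<exists>z'\<ge>z. s' = s\<lparr>nums := (nums s)(x := [2 ^ z'])\<rparr> \<and> 2 ^ z' \<le> max (2 ^ z) (2 * b) \<and> i = b - 2 ^ z'"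
    and "bval s' (NLess (reg x) e)"
  then obtain z' where z': "z \<le> z'" "s' = s\<lparr>nums := (nums s)(x := [2 ^ z'])\<rparr>" "i = b - 2 ^ z'" "2 ^ z' < b"
    by (auto simp: e)
  then have "2 * 2 ^ z' \<le> B" "b - 2 * 2 ^ z' < b - 2 ^ z'" using B by (auto intro: diff_less_mono2)
  then show "wp \<I> w B (set_reg x (NMul (NConst 2) (reg x))) s' (\<lambda>t s'. t \<le> 1 \<and> (\<exists>i'<i. \<exists>z'\<ge>z.
      s' = s\<lparr>nums := (nums s)(x := [2 ^ z'])\<rparr> \<and> 2 ^ z' \<le> max (2 ^ z) (2 * b) \<and> i' = b - 2 ^ z'))"
    using z' reg by simp (intro exI[of _ "b - 2 * 2 ^ z'"] conjI exI[of _ "Suc z'"], auto)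
next
  fix i s' t assume "\<exists>z'\<ge>z. s' = s\<lparr>nums := (nums s)(x := [2 ^ z'])\<rparr> \<and> 2 ^ z' \<le> max (2 ^ z) (2 * b) \<and> i = b - 2 ^ z'"
    "\<not> bval s' (NLess (reg x) e)" "t \<le> (b - 2 ^ z) * Suc 1 + 1"
  then show "t \<le> 2 * b + 1 \<and> (\<exists>z'\<ge>z. s' = s\<lparr>nums := (nums s)(x := [2 ^ z'])\<rparr> \<and> b \<le> 2 ^ z' \<and>
      2 ^ z' \<le> max (2 ^ z) (2 * b))"
    by (auto simp: e)
qed

definition find_class :: com where
  "find_class =
     Seq (set_wreg 3 (WMul (reg 4) (wreg 2)))
     (While (WLess (wreg 0) (wreg 3)) (set_wreg 3 (WDiv (wreg 3) (NConst 2))))"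

text \<open>Halving starts at \<open>2 ^ z * m\<close>, the largest weight that does not cause a
  jump, so the result stays aligned with the grid of \<open>m\<close> even if it exceeds
  \<open>m\<close>. As \<open>wu\<close> is at least \<open>m / 2 ^ z\<close>, at most
  \<open>2 * z\<close> halvings are needed.\<close>

lemma wp_find_class:
  assumes m: "wts s 2 = [m]" "0 < m" and Z: "nums s 4 = [2 ^ z]" and u: "wts s 0 = [wu]"
    and h: "m \<le> 2 ^ z * wu" "wu \<le> 2 ^ z * m" and reg: "wregs (wts s)"
  shows "wp \<I> w B find_class s (\<lambda>t s'. t \<le> 4 * z + 2 \<and>
     (\<exists>b l. s' = s\<lparr>wts := (wts s)(3 := [b])\<rparr> \<and> b * 2 ^ l = 2 ^ z * m \<and> b \<le> wu \<and> wu < 2 * b))"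
proof -
  let ?P = "\<lambda>i s'. \<exists>b l. s' = s\<lparr>wts := (wts s)(3 := [b])\<rparr> \<and> b * 2 ^ l = 2 ^ z * m \<and> wu < 2 * b \<and>
    l \<le> 2 * z \<and> i = 2 * z - l"
  have "wu < 2 * (2 ^ z * m)" using h(2) m(2) by (smt (verit) mult_pos_pos zero_less_power)
  then have 0: "?P (2 * z) (s\<lparr>wts := (wts s)(3 := [2 ^ z * m])\<rparr>)"
    by (intro exI[of _ "2 ^ z * m"] exI[of _ 0]) auto
  show ?thesis
    unfolding find_class_def
    apply (simp add: reg Z m)
    apply (rule wp_While[where P = ?P and i = "2 * z" and T = 1])
    subgoal by (rule 0)
    subgoal premises prems for i s'
    proof -
      from prems(1) obtain b l where s': "s' = s\<lparr>wts := (wts s)(3 := [b])\<rparr>"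
        and b: "b * 2 ^ l = 2 ^ z * m" "wu < 2 * b" and l: "l \<le> 2 * z" "i = 2 * z - l" by blast
      have less: "wu < b" using prems(2) by (simp add: s' u)
      have "m * 2 ^ l \<le> 2 ^ z * wu * 2 ^ l" using h(1) by (intro mult_right_mono) auto
      also have "\<dots> < 2 ^ z * b * 2 ^ l" using less by simp
      also have "\<dots> = 2 ^ (2 * z) * m" using b(1) by (simp add: mult_2 power_add)
      finally have "(2::real) ^ l < 2 ^ (2 * z)" using m(2) by (simp add: mult.commute[of m])
      then have "l < 2 * z" by simp
      then show ?thesis using b l less
        by (simp add: s' reg) (intro exI[of _ "2 * z - Suc l"] conjI exI[of _ "b / 2"] exI[of _ "Suc l"], auto)
    qed
    subgoal using u by (auto simp: not_less)
    done
qed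

definition merge_greedily :: com where
  "merge_greedily =
     Seq (set_reg 6 (NConst 0))
     (While (NLess (reg 6) (reg 12))
       (Seq (EAssign 4 (reg 7) 5 (reg 6))
       (Seq (Query 8 (NConst 0) 4 (NConst 0) (NAdd (reg 7) (NConst 1)))
       (Seq (If (NLess (NConst 0) (reg 8)) (set_reg 7 (NAdd (reg 7) (NConst 1))) Skip)
         (set_reg 6 (NAdd (reg 6) (NConst 1)))))))"

text \<open>The oracle reads memory cells only, so a candidate is written behind the current set
  before it is queried; this is the spare cell in \<open>Suc \<rho>\<close>. A rejected candidate is
  overwritten by the next one, if any.\<close>

lemma wp_merge_greedily:
  assumes E: "nums s 7 = [length E]" "length E \<le> length (elts s 4)" "take (length E) (elts s 4) = E"
    and T: "nums s 12 = [length T]" "length T \<le> length (elts s 5)" "take (length T) (elts s 5) = T"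
    and dist: "distinct (E @ T)" and ind: "set E \<in> \<I>"
    and rank: "\<And>A. A \<in> \<I> \<Longrightarrow> card A \<le> \<rho>"
    and reg: "regs (nums s)" and B: "Suc \<rho> \<le> B" "Suc (length T) \<le> B"
  shows "wp \<I> w B merge_greedily s (\<lambda>t s'. t \<le> (\<rho> + 7) * length T + 2 \<and>
     (\<exists>L F. s' = s\<lparr>nums := (nums s)(8 := F, 7 := [length (greedy \<I> E T)], 6 := [length T]),
         elts := (elts s)(4 := L)\<rparr> \<and> length F \<le> 1 \<and>
        length (greedy \<I> E T) \<le> length L \<and> take (length (greedy \<I> E T)) L = greedy \<I> E T \<and>
        length L \<le> max (length (elts s 4)) (Suc \<rho>)))"
proof -
  let ?G = "\<lambda>i. greedy \<I> E (take i T)"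
  let ?P = "\<lambda>i s'. \<exists>L F. s' = s\<lparr>nums := (nums s)(8 := F, 7 := [length (?G i)], 6 := [i]),
         elts := (elts s)(4 := L)\<rparr> \<and> length F \<le> 1 \<and>
        length (?G i) \<le> length L \<and> take (length (?G i)) L = ?G i \<and>
        length L \<le> max (length (elts s 4)) (Suc \<rho>)"
  have lenG: "length (?G i) \<le> \<rho>" for i
  proof -
    have "distinct (E @ take i T)" using dist by (auto dest: in_set_takeD)
    then have "distinct (?G i)" "set (?G i) \<in> \<I>" using greedy_props[OF ind] by auto
    then show ?thesis using rank distinct_card by metis
  qed
  have reg8: "length (nums s 8) \<le> 1" using reg by (simp add: regs_def)
  show ?thesis
    unfolding merge_greedily_def
    apply (simp add: reg)
    apply (rule wp_for[where P = ?P and n = "length T" and T = "\<rho> + 6"])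
    subgoal using E reg8 by (auto intro!: exI[of _ "elts s 4"] exI[of _ "nums s 8"] simp: fun_upd_idem)
    subgoal premises prems for i s'
    proof -
      from prems(2) obtain L F where
        s': "s' = s\<lparr>nums := (nums s)(8 := F, 7 := [length (?G i)], 6 := [i]), elts := (elts s)(4 := L)\<rparr>"
        and F: "length F \<le> 1"
        and L: "length (?G i) \<le> length L" "take (length (?G i)) L = ?G i"
          "length L \<le> max (length (elts s 4)) (Suc \<rho>)" by blast
      have i: "i < length T" by fact
      have Ti: "elts s 5 ! i = T ! i" using T(3) i by (metis nth_take)
      have GS: "?G (Suc i) = (if insert (T ! i) (set (?G i)) \<in> \<I> then ?G i @ [T ! i] else ?G i)"
        using i by (simp add: take_Suc_conv_app_nth greedy_snoc)
      have le: "1 \<le> B" "Suc (length (?G i)) \<le> B" "Suc i \<le> B" using lenG[of i] B i by auto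
      show ?thesis
        using i F L le T(2) lenG[of i]
        by (auto simp: s' T(1) reg Ti GS fun_upd_twist[of 7 8] intro!: exI[of _ "put (length (?G i)) (T ! i) L"]
            exI[of _ "[if insert (T ! i) (set (?G i)) \<in> \<I> then 1 else 0]"])
    qed
    subgoal using T by auto
    subgoal by (auto simp: algebra_simps)
    done
qed

section \<open>Processing a stream element\<close>

definition same_except :: "nat set \<Rightarrow> (nat \<Rightarrow> 'b) \<Rightarrow> (nat \<Rightarrow> 'b) \<Rightarrow> bool" where
  "same_except X f g \<longleftrightarrow> (\<forall>x. x \<notin> X \<longrightarrow> f x = g x)"

lemma same_exceptD: "same_except X f g \<Longrightarrow> x \<notin> X \<Longrightarrow> f x = g x"
  by (simp add: same_except_def)

text \<open>With truncated subtraction \<open>a - (a - b)\<close> is the minimum of \<open>a\<close>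
  and \<open>b\<close>. The answer of the oracle is added to the length of \<open>G\<close>, so the
  tentatively written element is kept precisely if the answer is 1.\<close>

definition note_element :: com where
  "note_element =
     Seq (set_reg 14 (NAdd (reg 14) (NConst 1)))
     (Seq (EAssign 2 (reg 2) 3 (NConst 0))
     (Seq (Query 8 (NConst 0) 2 (NConst 0) (NAdd (reg 2) (NConst 1)))
     (Seq (set_reg 2 (NAdd (reg 2) (reg 8)))
     (Seq (set_reg 3 (NSub (NMul (reg 0) (reg 2)) (NSub (NMul (reg 0) (reg 2)) (reg 14))))
     (grow_power 4 (NMul (NConst 8) (NMul (reg 3) (reg 3))))))))"

definition extend_max :: "'a set set \<Rightarrow> 'a \<Rightarrow> 'a list \<Rightarrow> 'a list" where
  "extend_max \<I> u G = (if insert u (set G) \<in> \<I> then G @ [u] else G)"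

lemma wp_note_element:
  assumes k: "nums s 0 = [k]" and n: "nums s 14 = [n]" and g: "nums s 2 = [length G]" and Z: "nums s 4 = [2 ^ z]"
    and u: "elts s 3 = [u]" and G: "length G \<le> length (elts s 2)" "take (length G) (elts s 2) = G"
    and reg: "regs (nums s)" and B: "16 * (Suc n)\<^sup>2 \<le> B" "length G \<le> n"
    and G': "G' = extend_max \<I> u G" and p: "p = min (k * length G') (Suc n)"
  shows "wp \<I> w B note_element s (\<lambda>t s'. t \<le> 16 * (Suc n)\<^sup>2 + n + 7 \<and> pending s' = pending s \<and> wts s' = wts s \<and>
     regs (nums s') \<and> same_except {2, 3, 4, 8, 14} (nums s') (nums s) \<and> same_except {2} (elts s') (elts s) \<and>
     nums s' 14 = [Suc n] \<and> nums s' 2 = [length G'] \<and>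
     length G' \<le> length (elts s' 2) \<and> take (length G') (elts s' 2) = G' \<and>
     length (elts s' 2) \<le> max (length (elts s 2)) (Suc (length G)) \<and>
     (\<exists>z'\<ge>z. nums s' 4 = [2 ^ z'] \<and> 8 * p\<^sup>2 \<le> 2 ^ z' \<and> 2 ^ z' \<le> max (2 ^ z) (16 * p\<^sup>2)))"
proof -
  have B1: "1 \<le> B" "Suc n \<le> B" "Suc (length G) \<le> B"
    using B by (auto simp: power2_eq_square)
  have min_eq: "a - (a - b) = min a b" for a b :: nat by auto
  have pn: "p\<^sup>2 \<le> (Suc n)\<^sup>2" using p by (intro power_mono) auto
  have pB: "p \<le> B" using p B1 by auto
  have lenG: "length G + (if insert u (set G) \<in> \<I> then 1 else 0) = length G'"
    by (simp add: G' extend_max_def)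
  have G1: "take (length G') (put (length G) u (elts s 2)) = G'"
    using G by (simp add: G' extend_max_def)
  have G2: "length G' \<le> max (length (elts s 2)) (Suc (length G))" "length G' \<le> Suc (length G)"
    by (auto simp: G' extend_max_def)
  have GB: "length G' \<le> B" using G2(2) B1(3) by simp
  have G3: "take (Suc (length G)) (put (length G) u (elts s 2)) = G @ [u]"
    using G by simp
  define F :: nat where "F = (if insert u (set G) \<in> \<I> then 1 else 0)"
  have F: "length G + F = length G'" using lenG by (simp add: F_def)
  have "wp \<I> w B (grow_power 4 (NMul (NConst 8) (NMul (reg 3) (reg 3))))
      (s\<lparr>elts := (elts s)(2 := put (length G) u (elts s 2)),
          nums := (nums s)(14 := [Suc n], 8 := [F], 2 := [length G'], 3 := [p])\<rparr>)
      (\<lambda>t s'. t \<le> 16 * (Suc n)\<^sup>2 + 1 \<and> (\<exists>z'\<ge>z. s' = s\<lparr>elts := (elts s)(2 := put (length G) u (elts s 2)),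
          nums := (nums s)(14 := [Suc n], 8 := [F], 2 := [length G'], 3 := [p], 4 := [2 ^ z'])\<rparr> \<and>
        8 * p\<^sup>2 \<le> 2 ^ z' \<and> 2 ^ z' \<le> max (2 ^ z) (16 * p\<^sup>2)))"
    apply (rule wp_mono[OF wp_grow_power[where z = z and b = "8 * p\<^sup>2"]])
    subgoal by (simp add: Z)
    subgoal by (simp add: power2_eq_square)
    subgoal by (simp add: reg)
    subgoal by simp
    subgoal using pn B(1) by linarith
    subgoal for t s' using pn by (elim conjE exE, intro conjI) (linarith, auto)
    done
  note grow = wp_mono[OF this]
  have q: "min (length (put (length G) u (elts s 2))) (Suc (length G)) \<le> Suc n" using B(2) by simp
  show ?thesis
  proof (cases "insert u (set G) \<in> \<I>")
    case True
    then have lG': "length G' = Suc (length G)" "F = 1" by (simp_all add: G' extend_max_def F_def)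
    show ?thesis
      unfolding note_element_def using lG' True B1 GB pB
      apply (simp add: reg k n g u G G3 min_eq p[symmetric, unfolded lG'] del: mult_Suc_right)
      apply (rule grow[unfolded lG' One_nat_def])
      using G1 G2 G(1) B(2) q by (auto simp: reg same_except_def)
  next
    case False
    then have lG': "length G' = length G" "F = 0" by (simp_all add: G' extend_max_def F_def)
    show ?thesis
      unfolding note_element_def using lG' False B1 GB pB
      apply (simp add: reg k n g u G G3 min_eq p[symmetric, unfolded lG'] del: mult_Suc_right)
      apply (rule grow[unfolded lG' One_nat_def])
      using G1 G2 G(1) B(2) q by (auto simp: reg same_except_def)
  qed
qed

text \<open>The rank estimate is monotone in both \<open>length G\<close> and \<open>card V\<close>,
  so the upper bound on \<open>2 ^ z\<close> carries over to the new estimate \<open>p\<close> even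
  when \<open>z\<close> stays the same.\<close>

lemma maximal_seen_extend:
  assumes "maximal_seen \<I> k V G z" "G' = extend_max \<I> u G" "u \<notin> V" "z \<le> z'"
    and down: "\<And>A B. A \<in> \<I> \<Longrightarrow> B \<subseteq> A \<Longrightarrow> B \<in> \<I>"
    and p: "p = min (k * length G') (Suc (card V))"
    and z': "8 * p\<^sup>2 \<le> 2 ^ z'" "2 ^ z' \<le> max (2 ^ z) (16 * p\<^sup>2)"
  shows "maximal_seen \<I> k (insert u V) G' z'"
proof -
  have V: "finite V" "set G \<subseteq> V" "distinct G" "set G \<in> \<I>"
    and max: "\<And>v. v \<in> V \<Longrightarrow> v \<in> set G \<or> insert v (set G) \<notin> \<I>"
    using assms(1) by (auto simp: maximal_seen_def)
  have card: "card (insert u V) = Suc (card V)" using V(1) assms(3) by simp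
  have lenG': "length G \<le> length G'" by (simp add: assms(2) extend_max_def)
  have "(min (k * length G) (card V))\<^sup>2 \<le> p\<^sup>2"
    unfolding p using lenG' by (intro power_mono min.mono mult_left_mono) auto
  moreover have "(2::nat) ^ z \<le> max 1 (16 * (min (k * length G) (card V))\<^sup>2)"
    using assms(1) by (simp add: maximal_seen_def)
  ultimately have "(2::nat) ^ z' \<le> max 1 (16 * p\<^sup>2)" using z'(2) by linarith
  moreover have "v \<in> set G' \<or> insert v (set G') \<notin> \<I>" if "v \<in> insert u V" for v
  proof (cases "v = u")
    case True
    then show ?thesis by (auto simp: assms(2) extend_max_def)
  next
    case False
    then have "v \<in> set G \<or> insert v (set G) \<notin> \<I>" using that max by auto
    moreover have "set G \<subseteq> set G'" by (auto simp: assms(2) extend_max_def)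
    ultimately show ?thesis using down by (meson insert_mono subset_iff)
  qed
  ultimately show ?thesis
    using V assms(3) z'(1) unfolding maximal_seen_def card p[symmetric]
    by (auto simp: assms(2) extend_max_def)
qed

definition store_element :: com where
  "store_element =
     Seq prune_stored (Seq collect_class
     (Seq (EAssign 4 (reg 7) 3 (NConst 0))
     (Seq (Query 8 (NConst 0) 4 (NConst 0) (NAdd (reg 7) (NConst 1)))
     (If (NLess (NConst 0) (reg 8))
       (Seq (EAssign 1 (reg 5) 3 (NConst 0)) (Seq (WAssign 1 (reg 5) (wreg 3))
         (set_reg 5 (NAdd (reg 5) (NConst 1)))))
       Skip))))"

lemma wp_store_element:
  assumes S: "stored s S" and m: "wts s 2 = [m]" and Z: "nums s 4 = [2 ^ z]" and b: "wts s 3 = [b]"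
    and u: "elts s 3 = [u]" and reg: "regs (nums s)" "wregs (wts s)"
    and B: "Suc (length S) \<le> B"
    and S': "S' = add_elem \<I> u b (prune z m S)"
    and C: "length (cls (prune z m S) b) \<le> \<rho>"
  shows "wp \<I> w B store_element s (\<lambda>t s'. t \<le> 12 * length S + \<rho> + 14 \<and> pending s' = pending s \<and>
     regs (nums s') \<and> wregs (wts s') \<and>
     same_except {5, 6, 7, 8} (nums s') (nums s) \<and> same_except {1, 4} (elts s') (elts s) \<and>
     same_except {1} (wts s') (wts s) \<and> stored s' S' \<and>
     length (elts s' 1) \<le> max (length (elts s 1)) (length S') \<and>
     length (wts s' 1) \<le> max (length (wts s 1)) (length S') \<and>
     length (elts s' 4) \<le> max (length (elts s 4)) (Suc \<rho>))"
proof -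
  define S1 where "S1 = prune z m S"
  have len1: "length S1 \<le> length S" by (simp add: S1_def prune_def)
  let ?C = "cls S1 b"
  have lenC: "length ?C \<le> \<rho>" using C by (simp add: S1_def)
  show ?thesis
    unfolding store_element_def wp_Seq
    apply (rule wp_mono[OF wp_prune_stored[OF S m Z reg(1) B]])
    subgoal premises prems1 for t1 s1
    proof -
      from prems1 obtain E W where
        s1: "s1 = s\<lparr>nums := (nums s)(7 := [length S1], 6 := [length S], 5 := [length S1]),
          elts := (elts s)(1 := E), wts := (wts s)(1 := W)\<rparr>"
        and EW: "length E = length (elts s 1)" "length W = length (wts s 1)"
        and st: "stored s1 S1" and t1: "t1 \<le> 6 * length S + 4"
        unfolding S1_def by blast
      have r1: "regs (nums s1)" "wregs (wts s1)" "wts s1 3 = [b]" "Suc (length S1) \<le> B"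
        using reg b B len1 by (simp_all add: s1)
      show ?thesis
        apply (rule wp_mono[OF wp_collect_class[OF st r1(3) r1(1) r1(4)]])
        subgoal premises prems2 for t2 s2
        proof -
          from prems2 obtain L where
            s2: "s2 = s1\<lparr>nums := (nums s1)(7 := [length ?C], 6 := [length S1]), elts := (elts s1)(4 := L)\<rparr>"
            and L: "length ?C \<le> length L" "take (length ?C) L = ?C" "length L \<le> max (length (elts s1 4)) (length ?C)"
            and t2: "t2 \<le> 6 * length S1 + 3" by blast
          have st': "length S1 \<le> length E" "length S1 \<le> length W" "take (length S1) E = map fst S1"
            "take (length S1) W = map snd S1"
            using st by (auto simp: stored_def s1)
          have t: "t1 + t2 \<le> 12 * length S + 7" using t1 t2 len1 by linarith
          have B1: "1 \<le> B" using B by simp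
          have q: "min (length (put (length ?C) u L)) (Suc (length ?C)) \<le> Suc \<rho>" using lenC by simp
          show ?thesis
          proof (cases "insert u (set ?C) \<in> \<I>")
            case True
            then have "S' = S1 @ [(u, b)]" by (simp add: S' add_elem_def S1_def)
            then show ?thesis
              using True t L lenC EW st' len1 q r1(4)
              by (auto simp: s1 s2 reg u b B1 wp_WAssign same_except_def stored_def)
          next
            case False
            then have "S' = S1" by (simp add: S' add_elem_def S1_def)
            then show ?thesis
              using False t L lenC EW st' len1 q B1
              by (auto simp: s1 s2 reg u b B1 same_except_def stored_def)
          qed
        qed
        done
    qed
    done
qed

definition classify :: com where
  "classify =
     If (WLess (WMul (reg 4) (wreg 2)) (wreg 0))
       (Seq (set_wreg 2 (wreg 0)) (Seq (set_wreg 3 (wreg 0)) store_element))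
     (If (WLess (WMul (reg 4) (wreg 0)) (wreg 2)) Skip
       (Seq find_class (Seq (If (WLess (wreg 2) (wreg 3)) (set_wreg 2 (wreg 3)) Skip) store_element)))"

text \<open>The tests separate the cases of \<open>classes_skip\<close> and
  \<open>classes_add\<close>. After a jump the new weight is its own class and the top of the grid.
  Otherwise the maximum is raised, if at all, to the rounded weight \<open>b\<close> and not to
  \<open>w u\<close>, since a power of 2 times \<open>m\<close> keeps the grid aligned.\<close>

lemma wp_classify:
  assumes ext: "k_extendible k N \<I>" "1 \<le> k"
    and G: "maximal_seen \<I> k (insert u V) G z" and uV: "u \<notin> V"
    and cl: "classes \<I> w V z m S" and loss: "small_loss \<I> w V m S"
    and w0: "\<And>v. v \<in> insert u V \<Longrightarrow> 0 < w v" and single: "\<And>v. v \<in> insert u V \<Longrightarrow> {v} \<in> \<I>"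
    and rank: "\<And>A. A \<in> \<I> \<Longrightarrow> card A \<le> \<rho>"
    and S: "stored s S" and m: "wts s 2 = [m]" and Z: "nums s 4 = [2 ^ z]" and wu: "wts s 0 = [w u]"
    and u: "elts s 3 = [u]" and reg: "regs (nums s)" "wregs (wts s)"
    and B: "Suc (length S) \<le> B"
  shows "wp \<I> w B classify s (\<lambda>t s'. t \<le> 12 * length S + \<rho> + 4 * z + 21 \<and> pending s' = pending s \<and>
     regs (nums s') \<and> wregs (wts s') \<and>
     same_except {5, 6, 7, 8} (nums s') (nums s) \<and> same_except {1, 4} (elts s') (elts s) \<and>
     length (elts s' 4) \<le> max (length (elts s 4)) (Suc \<rho>) \<and>
     (\<exists>m' S'. wts s' 2 = [m'] \<and> stored s' S' \<and>
       classes \<I> w (insert u V) z m' S' \<and> small_loss \<I> w (insert u V) m' S' \<and>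
       length (elts s' 1) \<le> max (length (elts s 1)) (length S') \<and>
       length (wts s' 1) \<le> max (length (wts s 1)) (length S')))"
proof -
  note down = k_extendible_system(4)[OF ext(1)]
  have m0: "0 \<le> m" and distS: "distinct (map fst S)" and clsI: "\<And>b. set (cls S b) \<in> \<I>"
    using cl by (auto simp: classes_def)
  have wu0: "0 < w u" using w0 by simp
  have lenC: "length (cls (prune z m' S) b) \<le> \<rho>" for m' b
  proof (cases "m' \<le> b * 2 ^ z")
    case True
    then show ?thesis
      using rank[OF clsI[of b]] distinct_cls[OF distS, of b] by (simp add: cls_prune distinct_card)
  qed (simp add: cls_prune)
  have store: "wp \<I> w B store_element s1 (\<lambda>t s'. t \<le> 12 * length S + \<rho> + 14 \<and> pending s' = pending s \<and>
     regs (nums s') \<and> wregs (wts s') \<and>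
     same_except {5, 6, 7, 8} (nums s') (nums s) \<and> same_except {1, 4} (elts s') (elts s) \<and>
     length (elts s' 4) \<le> max (length (elts s 4)) (Suc \<rho>) \<and>
     (\<exists>m' S'. wts s' 2 = [m'] \<and> stored s' S' \<and>
       classes \<I> w (insert u V) z m' S' \<and> small_loss \<I> w (insert u V) m' S' \<and>
       length (elts s' 1) \<le> max (length (elts s 1)) (length S') \<and>
       length (wts s' 1) \<le> max (length (wts s 1)) (length S')))"
    if s1: "s1 = s\<lparr>wts := (wts s)(2 := [m'], 3 := [b])\<rparr>"
      and b: "0 < b" "b \<le> w u" "w u < 2 * b" "l \<le> z" "b * 2 ^ z = 2 ^ l * m'"
      and m': "m \<le> m'" "m' = m \<or> m' \<le> w u" "m * 2 ^ z < m' \<or> (\<exists>i. m' = 2 ^ i * m)"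
    for s1 m' b l
  proof -
    define S' where "S' = add_elem \<I> u b (prune z m' S)"
    note new = classes_add[OF ext G uV cl loss w0 single b m' S'_def]
    show ?thesis
      by (rule wp_mono[OF wp_store_element[where s = s1 and S = S and m = m' and z = z and b = b and u = u
              and S' = S' and \<rho> = \<rho>]])
        (use S Z u reg B lenC[of m' b] new in \<open>auto simp: s1 stored_def S'_def[symmetric] same_except_def\<close>)
  qed
  show ?thesis
  proof (cases "2 ^ z * m < w u")
    case True
    have mw: "m \<le> w u"
    proof -
      have "1 * m \<le> 2 ^ z * m" using m0 by (intro mult_right_mono) auto
      with True show ?thesis by linarith
    qed
    from True show ?thesis
      unfolding classify_def
      apply (simp add: Z m wu reg)
      apply (rule wp_mono[OF store[where b = "w u" and m' = "w u" and l = z]])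
      using wu0 mw by (auto simp: mult.commute)
  next
    case nreset: False
    show ?thesis
    proof (cases "2 ^ z * w u < m")
      case True
      have "small_loss \<I> w (insert u V) m S"
        by (rule classes_skip[OF ext G uV loss m0 _ wu0]) (use True in \<open>simp add: mult.commute\<close>)
      moreover have "classes \<I> w (insert u V) z m S"
        by (rule classes_increase_pow[OF cl]) auto
      ultimately show ?thesis
        using nreset True S m reg unfolding classify_def
        by (simp add: Z m wu same_except_def) blast
    next
      case False
      have mpos: "0 < m" using nreset wu0 m0 by (cases "m = 0") auto
      have h: "m \<le> 2 ^ z * w u" "w u \<le> 2 ^ z * m" using False nreset by auto
      have body: "wp \<I> w B (Seq find_class (Seq (If (WLess (wreg 2) (wreg 3)) (set_wreg 2 (wreg 3)) Skip) store_element)) s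
        (\<lambda>t s'. t \<le> 12 * length S + \<rho> + 4 * z + 19 \<and> pending s' = pending s \<and>
     regs (nums s') \<and> wregs (wts s') \<and>
     same_except {5, 6, 7, 8} (nums s') (nums s) \<and> same_except {1, 4} (elts s') (elts s) \<and>
     length (elts s' 4) \<le> max (length (elts s 4)) (Suc \<rho>) \<and>
     (\<exists>m' S'. wts s' 2 = [m'] \<and> stored s' S' \<and>
       classes \<I> w (insert u V) z m' S' \<and> small_loss \<I> w (insert u V) m' S' \<and>
       length (elts s' 1) \<le> max (length (elts s 1)) (length S') \<and>
       length (wts s' 1) \<le> max (length (wts s 1)) (length S')))"
        apply (subst wp_Seq)
        apply (rule wp_mono[OF wp_find_class[OF m mpos Z wu h reg(2)]])
        subgoal premises prems for t1 s1
        proof -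
          from prems obtain b l where s1: "s1 = s\<lparr>wts := (wts s)(3 := [b])\<rparr>"
            and b: "b * 2 ^ l = 2 ^ z * m" "b \<le> w u" "w u < 2 * b" and t1: "t1 \<le> 4 * z + 2" by blast
          have b0: "0 < b" using b wu0 by linarith
          define m' where "m' = max m b"
          show ?thesis
          proof (cases "m < b")
            case True
            have "l \<le> z"
            proof (rule ccontr)
              assume "\<not> l \<le> z"
              then have "(2::real) ^ z \<le> 2 ^ l" by simp
              then have "m * 2 ^ z \<le> m * 2 ^ l" using mpos by simp
              also have "\<dots> < b * 2 ^ l" using True by simp
              finally show False using b(1) by (simp add: mult.commute)
            qed
            then have "(2::real) ^ z = 2 ^ (z - l) * 2 ^ l" by (simp flip: power_add)
            with b(1) have "b = 2 ^ (z - l) * m" by simp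
            then show ?thesis
              using True t1 b b0
              by (simp add: s1 m reg)
                (rule wp_mono[OF store[where b = b and m' = b and l = z]],
                 auto simp: fun_upd_twist[of 2 3] mult.commute)
          next
            case False
            \<comment> \<open>The lower end \<open>m / 2 ^ z\<close> is a grid point, so a weight
              that is not below it cannot be rounded below it.\<close>
            have "l \<le> 2 * z"
            proof (rule ccontr)
              assume "\<not> l \<le> 2 * z"
              then have "Suc (2 * z) \<le> l" by simp
              then have "(2::real) ^ Suc (2 * z) \<le> 2 ^ l" by (rule power_increasing) simp
              then have "b * 2 ^ Suc (2 * z) \<le> b * 2 ^ l" using b0 by simp
              also have "b * 2 ^ Suc (2 * z) = 2 ^ z * (2 ^ z * (2 * b))" by (simp add: power_even_eq power2_eq_square)
              also have "b * 2 ^ l = 2 ^ z * m" by (rule b(1))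
              finally have "2 ^ z * (2 * b) \<le> m" by simp
              moreover have "2 ^ z * w u < 2 ^ z * (2 * b)" using b(3) by simp
              ultimately show False using h(1) by linarith
            qed
            moreover have "z \<le> l"
            proof (rule ccontr)
              assume "\<not> z \<le> l"
              then have "(2::real) ^ l < 2 ^ z" by simp
              then have "b * 2 ^ l < b * 2 ^ z" using b0 by simp
              also have "\<dots> \<le> m * 2 ^ z" using False by simp
              finally show False using b(1) by (simp add: mult.commute)
            qed
            ultimately have l: "2 * z - l \<le> z" "(2::real) ^ z * 2 ^ z = 2 ^ (2 * z - l) * 2 ^ l"
              by (auto simp flip: power_add)
            have "b * 2 ^ z * 2 ^ l = 2 ^ (2 * z - l) * m * 2 ^ l"
              using b(1) l(2) by (metis (no_types, opaque_lifting) mult.assoc mult.commute)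
            then have "b * 2 ^ z = 2 ^ (2 * z - l) * m" by simp
            then show ?thesis
              using False t1 b b0 l(1)
              by (simp add: s1 m reg)
                (rule wp_mono[OF store[where b = b and m' = m and l = "2 * z - l"]],
                 auto simp: fun_upd_idem m intro: exI[of _ 0])
          qed
        qed
        done
      show ?thesis
        unfolding classify_def using nreset False
        by (simp add: Z m wu del: wp_Seq) (rule wp_mono[OF body], auto)
    qed
  qed
qed

text \<open>\<open>c\<close> bounds the arrays of stored elements and of their weights. Arrays 2 and
  4 have one spare cell each for the candidate of a query.\<close>

definition shape :: "nat \<Rightarrow> nat \<Rightarrow> 'a state \<Rightarrow> bool" where
  "shape \<rho> c s \<longleftrightarrow> regs (nums s) \<and> wregs (wts s) \<and> length (wts s 1) \<le> c \<and>
     length (elts s 0) \<le> \<rho> \<and> length (elts s 1) \<le> c \<and> length (elts s 2) \<le> Suc \<rho> \<and>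
     length (elts s 3) \<le> 1 \<and> length (elts s 4) \<le> Suc \<rho> \<and> length (elts s 5) \<le> \<rho> \<and>
     (\<forall>x\<ge>6. elts s x = [])"

lemma sum_lengths_le:
  fixes f :: "nat \<Rightarrow> 'b list"
  assumes "\<forall>x\<ge>n. f x = []"
  shows "(\<Sum>x | f x \<noteq> []. length (f x)) \<le> (\<Sum>x<n. length (f x))"
  by (rule sum_mono2) (use assms in \<open>auto simp: not_le[symmetric]\<close>)

text \<open>The constant 23 consists of 15 number registers, 5 weight registers, the cell of the
  current element and the 2 spare cells. The element arrays 0, 2, 4 and 5 contribute
  \<open>4 * \<rho>\<close>.\<close>

lemma num_cells_shape:
  assumes "shape \<rho> c s"
  shows "num_cells s \<le> 23 + 4 * \<rho> + 2 * c"
proof -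
  have n: "\<forall>x\<ge>15. nums s x = []" "\<And>x. length (nums s x) \<le> 1"
    and w: "\<forall>x\<ge>6. wts s x = []" "\<And>x. x \<noteq> 1 \<Longrightarrow> length (wts s x) \<le> 1"
    and e: "\<forall>x\<ge>6. elts s x = []"
    using assms by (auto simp: shape_def regs_def wregs_def)
  have "(\<Sum>x<15. length (nums s x)) \<le> (\<Sum>x<(15::nat). 1)" by (rule sum_mono) (rule n(2))
  then have 1: "(\<Sum>x | nums s x \<noteq> []. length (nums s x)) \<le> 15"
    using sum_lengths_le[OF n(1)] by simp
  have "(\<Sum>x<6. length (wts s x)) \<le> (\<Sum>x<(6::nat). if x = 1 then c else 1)"
    by (rule sum_mono) (use w(2) assms in \<open>auto simp: shape_def\<close>)
  also have "\<dots> = c + 5" by (simp add: numeral_eq_Suc)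
  finally have 2: "(\<Sum>x | wts s x \<noteq> []. length (wts s x)) \<le> c + 5"
    using sum_lengths_le[OF w(1)] by simp
  have "(\<Sum>x<6. length (elts s x)) \<le> c + 4 * \<rho> + 3"
    using assms by (simp add: numeral_eq_Suc shape_def)
  then have 3: "(\<Sum>x | elts s x \<noteq> []. length (elts s x)) \<le> c + 4 * \<rho> + 3"
    using sum_lengths_le[OF e] by simp
  show ?thesis using 1 2 3 by (simp add: num_cells_def)
qed

section \<open>The complete program\<close>

definition step :: com where
  "step =
     Seq (Read 3 (NConst 0) 0 (NConst 0))
     (Seq (Query 8 (NConst 0) 3 (NConst 0) (NConst 1))
     (If (BAnd (NLess (NConst 0) (reg 8)) (WLess WZero (wreg 0)))
       (Seq note_element classify)
       Skip))"

definition merge_class :: com where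
  "merge_class =
     Seq (set_wreg 3 (WDiv (WMul (reg 11) (wreg 2)) (reg 4)))
     (Seq collect_class
     (Seq (set_wreg 4 (WAdd (wreg 4) (WMul (reg 7) (wreg 3))))
     (Seq merge_greedily
     (Seq (set_reg 12 (reg 7))
     (Seq (copy_elems 12 4 5)
     (set_reg 11 (NMul (reg 11) (reg 9))))))))"

definition merge_group :: com where
  "merge_group =
     Seq (set_wreg 4 WZero) (Seq (set_reg 12 (NConst 0)) (Seq (set_reg 11 (reg 10))
     (While (BNot (NLess (reg 4) (reg 11))) merge_class)))"

text \<open>Register 9 starts at 2, so \<open>q\<close> is positive even if no relevant element has
  arrived. Register 3 again receives a minimum by truncated subtraction, here of \<open>k\<close>
  and the number of relevant elements; it limits \<open>2 ^ q\<close> and thereby the number of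
  groups.\<close>

definition finish :: com where
  "finish =
     Seq (set_reg 9 (NConst 2))
     (Seq (set_reg 3 (NSub (reg 0) (NSub (reg 0) (reg 14))))
     (Seq (grow_power 9 (NMul (NConst 2) (reg 3)))
     (Seq (set_reg 13 (NConst 0)) (Seq (set_wreg 5 WZero) (Seq (set_reg 10 (NConst 1))
     (Seq (While (NLess (reg 10) (reg 9))
       (Seq merge_group
       (Seq (If (WLess (wreg 5) (wreg 4))
              (Seq (set_wreg 5 (wreg 4)) (Seq (set_reg 13 (reg 12)) (copy_elems 12 5 0))) Skip)
         (set_reg 10 (NMul (NConst 2) (reg 10))))))
     (set_reg 0 (reg 13))))))))"

definition stream_program :: com where
  "stream_program =
     Seq (set_reg 14 (NConst 0)) (Seq (set_reg 2 (NConst 0)) (Seq (set_reg 4 (NConst 1))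
     (Seq (set_reg 5 (NConst 0)) (Seq (set_wreg 2 WZero)
     (Seq (While More step) finish)))))"

section \<open>Runs on a fixed instance\<close>

locale extendible_stream =
  fixes k :: nat and N :: "'a set" and \<I> :: "'a set set" and w :: "'a \<Rightarrow> real" and \<rho> B :: nat
  assumes ext: "k_extendible k N \<I>" and k_pos: "1 \<le> k"
    and w_nonneg: "\<And>u. u \<in> N \<Longrightarrow> 0 \<le> w u"
    and rank: "\<And>A. A \<in> \<I> \<Longrightarrow> card A \<le> \<rho>" and rank_le: "\<rho> \<le> card N"
    and B: "64 * (card N + 1) ^ 3 \<le> B"
begin

abbreviation "size_bound \<equiv> card N + 1"

lemmas down = k_extendible_system(4)[OF ext] and finite_N = k_extendible_system(2)[OF ext]

lemma B_quad: "64 * size_bound\<^sup>2 \<le> B" and B_lin: "64 * size_bound \<le> B"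
proof -
  have "size_bound ^ 2 \<le> size_bound ^ 3" "size_bound ^ 1 \<le> size_bound ^ 3"
    by (intro power_increasing; simp)+
  then show "64 * size_bound\<^sup>2 \<le> B" "64 * size_bound \<le> B" using B by simp_all
qed

text \<open>The program drops all other elements on arrival: they are in no independent set or weigh
  nothing. The filter makes weights positive, as rounding to a geometric grid requires, and
  guarantees that an empty class accepts any element.\<close>

definition good :: "'a set" where
  "good = {u \<in> N. {u} \<in> \<I> \<and> 0 < w u}"

definition represents :: "'a state \<Rightarrow> 'a set \<Rightarrow> 'a list \<Rightarrow> nat \<Rightarrow> real \<Rightarrow> ('a \<times> real) list \<Rightarrow> bool" where
  "represents s V G z m S \<longleftrightarrow> V \<subseteq> good \<and>
     maximal_seen \<I> k V G z \<and> classes \<I> w V z m S \<and> small_loss \<I> w V m S \<and>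
     shape \<rho> (\<rho> * (z + 1)) s \<and> stored s S \<and>
     nums s 0 = [k] \<and> nums s 14 = [card V] \<and> nums s 2 = [length G] \<and> nums s 4 = [2 ^ z] \<and> wts s 2 = [m] \<and>
     length G \<le> length (elts s 2) \<and> take (length G) (elts s 2) = G"

lemma length_stored_le:
  assumes "classes \<I> w V z m S" "V \<subseteq> N"
  shows "length S \<le> card N"
proof -
  have "distinct (map fst S)" "set (map fst S) \<subseteq> N" using assms by (auto simp: classes_def)
  then show ?thesis using finite_N by (metis card_mono distinct_card length_map)
qed

lemma exponent_le:
  assumes "maximal_seen \<I> k V G z" "V \<subseteq> N"
  shows "(2::nat) ^ z \<le> 16 * size_bound\<^sup>2" "z + 1 \<le> 16 * size_bound\<^sup>2"
proof -
  have "(min (k * length G) (card V))\<^sup>2 \<le> size_bound\<^sup>2"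
    using card_mono[OF finite_N assms(2)] by (intro power_mono) auto
  moreover have "1 \<le> size_bound\<^sup>2" by simp
  moreover have "(2::nat) ^ z \<le> max 1 (16 * (min (k * length G) (card V))\<^sup>2)"
    using assms(1) by (simp add: maximal_seen_def)
  ultimately show "(2::nat) ^ z \<le> 16 * size_bound\<^sup>2" by linarith
  moreover have "z < 2 ^ z" by simp
  ultimately show "z + 1 \<le> 16 * size_bound\<^sup>2" by linarith
qed

lemma good_N: "good \<subseteq> N"
  by (auto simp: good_def)

lemma wp_step:
  assumes r: "represents s V G z m S" and pend: "pending s = u # us" and u: "u \<in> N" "u \<notin> V"
  shows "wp \<I> w B step s (\<lambda>t s'. t \<le> 150 * size_bound\<^sup>2 \<and> pending s' = us \<and>
    (\<exists>G z m S. represents s' (if u \<in> good then insert u V else V) G z m S))"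
proof -
  have V: "V \<subseteq> good" "V \<subseteq> N" "finite V"
    using r good_N finite_N by (auto simp: represents_def intro: finite_subset)
  have ms: "maximal_seen \<I> k V G z" and cl: "classes \<I> w V z m S" and loss: "small_loss \<I> w V m S"
    and sh: "shape \<rho> (\<rho> * (z + 1)) s" and st: "stored s S"
    and rg: "nums s 0 = [k]" "nums s 14 = [card V]" "nums s 2 = [length G]" "nums s 4 = [2 ^ z]" "wts s 2 = [m]"
    and G: "length G \<le> length (elts s 2)" "take (length G) (elts s 2) = G"
    using r by (auto simp: represents_def)
  have reg: "regs (nums s)" "wregs (wts s)" using sh by (auto simp: shape_def)
  have B1: "1 \<le> B" using B_lin by simp
  have e3: "length (elts s 3) \<le> 1" "length (wts s 0) \<le> 1"
    using sh by (auto simp: shape_def wregs_def)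
  define F :: nat where "F = (if {u} \<in> \<I> then 1 else 0)"
  define s1 where "s1 = s\<lparr>elts := (elts s)(3 := [u]), wts := (wts s)(0 := [w u]), pending := us,
    nums := (nums s)(8 := [F])\<rparr>"
  have sb: "1 \<le> size_bound\<^sup>2" by simp
  \<comment> \<open>The common beginning takes 4 units: one for the read, two for the query of a
    single element and one for the test. Skipping takes a fifth.\<close>
  have enter: "wp \<I> w B step s Q" if
    "if u \<in> good then wp \<I> w B (Seq note_element classify) s1 (\<lambda>t. Q (t + 4)) else Q 5 s1" for Q
  proof -
    have Suc4: "t + 4 = Suc (Suc (Suc (Suc t)))" "5 = Suc (Suc (Suc (Suc (Suc 0))))" for t by simp_all
    show ?thesis
      using that pend e3 reg B1 u(1) unfolding step_def good_def s1_def F_def Suc4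
      by (cases "{u} \<in> \<I>"; cases "0 < w u") simp_all
  qed
  show ?thesis
  proof (rule enter, cases "u \<in> good")
    case False
    have "represents s1 V G z m S"
      using V(1) ms cl loss sh st rg G unfolding represents_def s1_def shape_def stored_def by auto
    then show "if u \<in> good then wp \<I> w B (Seq note_element classify) s1 (\<lambda>t s'. t + 4 \<le> 150 * size_bound\<^sup>2 \<and> pending s' = us \<and>
        (\<exists>G z m S. represents s' (if u \<in> good then insert u V else V) G z m S))
      else 5 \<le> 150 * size_bound\<^sup>2 \<and> pending s1 = us \<and>
        (\<exists>G z m S. represents s1 (if u \<in> good then insert u V else V) G z m S)"
      using False sb by (auto simp: s1_def)
  next
    case True
    define G' where "G' = extend_max \<I> u G"
    define p where "p = min (k * length G') (Suc (card V))"
    have cardV: "Suc (card V) \<le> card N"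
      using card_mono[OF finite_N, of "insert u V"] V u by auto
    have lenG: "length G \<le> card V"
      using ms V(3) by (metis card_mono distinct_card maximal_seen_def)
    have "(Suc (card V))\<^sup>2 \<le> size_bound\<^sup>2" using cardV by (intro power_mono) auto
    then have B2: "16 * (Suc (card V))\<^sup>2 \<le> B" using B_quad by linarith
    have pos: "0 < w v" "{v} \<in> \<I>" if "v \<in> insert u V" for v
      using that True V(1) by (auto simp: good_def)
    have s1': "nums s1 0 = [k]" "nums s1 14 = [card V]" "nums s1 2 = [length G]" "nums s1 4 = [2 ^ z]"
       "elts s1 3 = [u]" "length G \<le> length (elts s1 2)" "take (length G) (elts s1 2) = G" "regs (nums s1)"
      using rg G reg by (simp_all add: s1_def)
    note note_elt = wp_note_element[OF s1' B2 lenG G'_def p_def]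
    have "wp \<I> w B (Seq note_element classify) s1 (\<lambda>t s'. t + 4 \<le> 150 * size_bound\<^sup>2 \<and> pending s' = us \<and>
        (\<exists>G z m S. represents s' (insert u V) G z m S))"
      unfolding wp_Seq
    proof (rule wp_mono[OF note_elt], elim conjE exE)
      fix t1 z' and s2 :: "'a state"
      assume t1: "t1 \<le> 16 * (Suc (card V))\<^sup>2 + card V + 7"
        and s2: "pending s2 = pending s1" "wts s2 = wts s1" "regs (nums s2)"
          "same_except {2, 3, 4, 8, 14} (nums s2) (nums s1)" "same_except {2} (elts s2) (elts s1)"
        and s2': "nums s2 14 = [Suc (card V)]" "nums s2 2 = [length G']"
          "length G' \<le> length (elts s2 2)" "take (length G') (elts s2 2) = G'"
          "length (elts s2 2) \<le> max (length (elts s1 2)) (Suc (length G))"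
        and z': "z \<le> z'" "nums s2 4 = [2 ^ z']" "8 * p\<^sup>2 \<le> 2 ^ z'" "2 ^ z' \<le> max (2 ^ z) (16 * p\<^sup>2)"
      have ms': "maximal_seen \<I> k (insert u V) G' z'"
        by (rule maximal_seen_extend[OF ms G'_def u(2) z'(1) down p_def z'(3,4)])
      have cl': "classes \<I> w V z' m S" by (rule classes_increase_pow[OF cl z'(1)]) auto
      note f2 = s2(1,2) same_exceptD[OF s2(4)] same_exceptD[OF s2(5)]
      have st2: "stored s2 S" using st by (simp add: stored_def f2 s1_def)
      have w2: "wts s2 2 = [m]" "wts s2 0 = [w u]" "wregs (wts s2)" and e2: "elts s2 3 = [u]"
        using rg reg by (simp_all add: f2 s1_def)
      have lenS: "length S \<le> card N" by (rule length_stored_le[OF cl V(2)])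
      then have B3: "Suc (length S) \<le> B" using B_lin by simp
      have uVN: "insert u V \<subseteq> N" using V u by auto
      show "wp \<I> w B classify s2 (\<lambda>t s'. t1 + t + 4 \<le> 150 * size_bound\<^sup>2 \<and> pending s' = us \<and>
        (\<exists>G z m S. represents s' (insert u V) G z m S))"
      proof (rule wp_mono[OF wp_classify[OF ext k_pos ms' u(2) cl' loss pos rank st2 w2(1) z'(2) w2(2) e2
              s2(3) w2(3) B3]], assumption, assumption, assumption, elim conjE exE)
        fix t2 m' S' and s3 :: "'a state"
        assume t2: "t2 \<le> 12 * length S + \<rho> + 4 * z' + 21"
          and s3: "pending s3 = pending s2" "regs (nums s3)" "wregs (wts s3)"
            "same_except {5, 6, 7, 8} (nums s3) (nums s2)" "same_except {1, 4} (elts s3) (elts s2)"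
          and l4: "length (elts s3 4) \<le> max (length (elts s2 4)) (Suc \<rho>)"
          and m': "wts s3 2 = [m']" "stored s3 S'" "classes \<I> w (insert u V) z' m' S'"
            "small_loss \<I> w (insert u V) m' S'"
          and l1: "length (elts s3 1) \<le> max (length (elts s2 1)) (length S')"
            "length (wts s3 1) \<le> max (length (wts s2 1)) (length S')"
        note f3 = s3(1) same_exceptD[OF s3(4)] same_exceptD[OF s3(5)]
        have "\<rho> * (z + 1) \<le> \<rho> * (z' + 1)" using z'(1) by (intro mult_left_mono) auto
        moreover have "length S' \<le> \<rho> * (z' + 1)" by (rule length_classes_le[OF m'(3) rank])
        moreover have "length (elts s2 1) \<le> \<rho> * (z + 1)" "length (wts s2 1) \<le> \<rho> * (z + 1)"
          using sh by (simp_all add: f2 s1_def shape_def)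
        ultimately have c: "length (elts s3 1) \<le> \<rho> * (z' + 1)" "length (wts s3 1) \<le> \<rho> * (z' + 1)"
          using l1 by linarith+
        have "length G \<le> \<rho>" using rank[of "set G"] ms by (simp add: maximal_seen_def distinct_card)
        then have "shape \<rho> (\<rho> * (z' + 1)) s3"
          using c s3(2,3) l4 s2'(5) sh by (auto simp: shape_def f3 f2 s1_def)
        moreover have "card (insert u V) = Suc (card V)" using V(3) u(2) by simp
        ultimately have "represents s3 (insert u V) G' z' m' S'"
          using V(1) True ms' m' s2' z'(2) rg unfolding represents_def
          by (simp add: f3 f2 s1_def)
        moreover have "t1 + t2 + 4 \<le> 150 * size_bound\<^sup>2"
        proof -
          have "(Suc (card V))\<^sup>2 \<le> size_bound\<^sup>2" using cardV by (intro power_mono) auto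
          moreover have "size_bound \<le> size_bound\<^sup>2" by (simp add: power2_eq_square)
          moreover have "z' + 1 \<le> 16 * size_bound\<^sup>2" by (rule exponent_le[OF ms' uVN])
          ultimately show ?thesis using t1 t2 lenS rank_le cardV by linarith
        qed
        ultimately show "t1 + t2 + 4 \<le> 150 * size_bound\<^sup>2 \<and> pending s3 = us \<and>
          (\<exists>G z m S. represents s3 (insert u V) G z m S)"
          by (auto simp: f3 f2 s1_def)
      qed
    qed
    with True show "if u \<in> good then wp \<I> w B (Seq note_element classify) s1 (\<lambda>t s'. t + 4 \<le> 150 * size_bound\<^sup>2 \<and> pending s' = us \<and>
        (\<exists>G z m S. represents s' (if u \<in> good then insert u V else V) G z m S))
      else 5 \<le> 150 * size_bound\<^sup>2 \<and> pending s1 = us \<and>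
        (\<exists>G z m S. represents s1 (if u \<in> good then insert u V else V) G z m S)"
      by simp
  qed
qed

section \<open>The merging phase of the program\<close>

definition merge_state ::
    "nat \<Rightarrow> real \<Rightarrow> ('a \<times> real) list \<Rightarrow> nat \<Rightarrow> 'a state \<Rightarrow> bool" where
  "merge_state z m S q s \<longleftrightarrow> shape \<rho> (\<rho> * (z + 1)) s \<and> stored s S \<and>
     nums s 4 = [2 ^ z] \<and> nums s 9 = [2 ^ q] \<and> wts s 2 = [m]"

definition holds_merged ::
    "nat \<Rightarrow> real \<Rightarrow> ('a \<times> real) list \<Rightarrow> nat \<Rightarrow> nat \<Rightarrow> nat \<Rightarrow> 'a list \<Rightarrow> real \<Rightarrow> 'a state \<Rightarrow> bool" where
  "holds_merged z m S q r i T v s \<longleftrightarrow> merging \<I> z m S q r i T v \<and> wts s 4 = [v] \<and>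
     nums s 12 = [length T] \<and> length T \<le> length (elts s 5) \<and> take (length T) (elts s 5) = T"

definition group_frame :: "'a state \<Rightarrow> 'a state \<Rightarrow> bool" where
  "group_frame s s' \<longleftrightarrow> same_except {6, 7, 8, 11, 12} (nums s') (nums s) \<and>
     same_except {3, 4} (wts s') (wts s) \<and> same_except {4, 5} (elts s') (elts s)"

lemma length_indep: "set T \<in> \<I> \<Longrightarrow> distinct T \<Longrightarrow> length T \<le> \<rho>"
  using rank distinct_card by metis

lemma wp_merge_class:
  assumes ms: "maximal_seen \<I> k V G z" and VN: "V \<subseteq> N"
    and cl: "classes \<I> w V z m S" and Q: "2 * min k (card V) \<le> 2 ^ q" "0 < q" "2 ^ q \<le> 4 * size_bound"
    and st: "merge_state z m S q s" and hm: "holds_merged z m S q r i T v s"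
    and y: "nums s 11 = [2 ^ (r + q * i)]" "r + q * i \<le> z"
  shows "wp \<I> w B merge_class s (\<lambda>t s'. t \<le> 30 * size_bound\<^sup>2 \<and> merge_state z m S q s' \<and>
     group_frame s s' \<and> nums s' 11 = [2 ^ (r + q * Suc i)] \<and>
     (\<exists>T v. holds_merged z m S q r (Suc i) T v s'))"
proof -
  define c where "c = 2 ^ (r + q * i) * m / 2 ^ z"
  define E where "E = cls S c"
  define T' where "T' = greedy \<I> E T"
  have finV: "finite V" using ms by (simp add: maximal_seen_def)
  have sh: "shape \<rho> (\<rho> * (z + 1)) s" and S: "stored s S" and rg: "nums s 4 = [2 ^ z]" "nums s 9 = [2 ^ q]" "wts s 2 = [m]"
    using st by (auto simp: merge_state_def)
  have reg: "regs (nums s)" "wregs (wts s)" using sh by (auto simp: shape_def)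
  have mg: "merging \<I> z m S q r i T v" and T: "wts s 4 = [v]"
      "nums s 12 = [length T]" "length T \<le> length (elts s 5)" "take (length T) (elts s 5) = T"
    using hm by (auto simp: holds_merged_def)
  have mg': "merging \<I> z m S q r (Suc i) T' (v + c * real (length E))"
    unfolding T'_def E_def by (rule merging_Suc[OF ext cl finV Q(1,2) mg c_def])
  have E: "set E \<in> \<I>" "distinct E" using cl distinct_cls[of S c] by (auto simp: classes_def E_def)
  have lenS: "length S \<le> card N" by (rule length_stored_le[OF cl VN])
  have lens: "length T \<le> \<rho>" "length T' \<le> \<rho>" "length E \<le> \<rho>"
    using length_indep E mg mg' unfolding merging_def by blast+
  have distET: "distinct (E @ T)"
    unfolding E_def by (rule merging_disjoint[OF cl Q(2) mg c_def])
  have B1: "Suc (length S) \<le> B" "Suc \<rho> \<le> B" "Suc (length T) \<le> B" "Suc (length T') \<le> B" "length T' \<le> B"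
    using B_lin lenS lens rank_le by simp_all
  \<comment> \<open>Register 11 is multiplied by \<open>2 ^ q\<close> even after the last class of
    the group and may then exceed \<open>2 ^ z\<close>. This product, at most \<open>16 * 4\<close>
    times a cube, determines the bound required of \<open>B\<close>.\<close>
  have yB: "(2::nat) ^ (r + q * i) * 2 ^ q \<le> B"
  proof -
    have "(2::nat) ^ (r + q * i) \<le> 2 ^ z" using y(2) by simp
    also have "\<dots> \<le> 16 * size_bound\<^sup>2" by (rule exponent_le[OF ms VN])
    finally have "(2::nat) ^ (r + q * i) * 2 ^ q \<le> (16 * size_bound\<^sup>2) * (4 * size_bound)"
      using Q(3) by (intro mult_mono) auto
    also have "(16 * a\<^sup>2) * (4 * a) = 64 * a ^ 3" for a :: nat by (simp add: power3_eq_cube power2_eq_square)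
    finally show ?thesis using B by linarith
  qed
  define s1 where "s1 = s\<lparr>wts := (wts s)(3 := [c])\<rparr>"
  have s1: "stored s1 S" "wts s1 3 = [c]" "regs (nums s1)"
    using S reg by (simp_all add: s1_def stored_def)
  show ?thesis
    unfolding merge_class_def
    apply (simp add: reg y(1) rg c_def[symmetric] del: wp_Seq)
    apply (subst wp_Seq)
    apply (simp add: reg y(1) rg c_def[symmetric] s1_def[symmetric] del: wp_Seq)
    apply (subst wp_Seq)
    apply (rule wp_mono[OF wp_collect_class[OF s1 B1(1)]])
    apply (elim conjE exE)
    subgoal premises prems for t2 s2' L
    proof -
      have t2: "t2 \<le> 6 * length S + 3" by (rule prems)
      have L: "length E \<le> length L" "take (length E) L = E" "length L \<le> max (length (elts s 4)) (length E)"
        using prems unfolding E_def by (simp_all add: s1_def)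
      define s3 where "s3 = s\<lparr>nums := (nums s)(7 := [length E], 6 := [length S]), elts := (elts s)(4 := L),
        wts := (wts s)(3 := [c], 4 := [v + real (length E) * c])\<rparr>"
      have s2': "s2' = s\<lparr>nums := (nums s)(7 := [length E], 6 := [length S]), elts := (elts s)(4 := L),
        wts := (wts s)(3 := [c])\<rparr>"
        using prems unfolding E_def by (simp add: s1_def)
      have s3: "nums s3 7 = [length E]" "length E \<le> length (elts s3 4)" "take (length E) (elts s3 4) = E"
        "nums s3 12 = [length T]" "length T \<le> length (elts s3 5)" "take (length T) (elts s3 5) = T"
        "regs (nums s3)"
        using T L reg by (simp_all add: s3_def)
      note mgr = wp_merge_greedily[OF s3(1-6) distET E(1) rank s3(7) B1(2,3), folded T'_def]
      show ?thesis
        apply (subst wp_Seq)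
        apply (simp add: s2' reg T s3_def[symmetric] del: wp_Seq)
        apply (subst wp_Seq)
        apply (rule wp_mono[OF mgr], assumption)
        apply (elim conjE exE)
        subgoal premises prems2 for t4 s4 L' F
        proof -
          have t4: "t4 \<le> (\<rho> + 7) * length T + 2" by (rule prems2)
          have s4: "s4 = s3\<lparr>nums := (nums s3)(8 := F, 7 := [length T'], 6 := [length T]), elts := (elts s3)(4 := L')\<rparr>"
            and F: "length F \<le> 1" and L': "length T' \<le> length L'" "take (length T') L' = T'"
            "length L' \<le> max (length (elts s3 4)) (Suc \<rho>)" by (rule prems2)+
          have r4: "regs (nums s4)" using s3(7) F by (simp add: s4)
          show ?thesis
            apply (subst wp_Seq)
            apply (simp add: s4 s3(7) F[unfolded One_nat_def] B1(5) del: wp_Seq)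
            apply (subst wp_Seq)
            apply (rule wp_mono[OF wp_copy_elems[where n = "length T'"]])
            subgoal by simp
            subgoal by simp
            subgoal using L' by simp
            subgoal by simp
            subgoal using r4 by (simp add: s4)
            subgoal by (rule B1(4))
            apply (elim conjE exE)
            subgoal premises prems3 for t6 s6 L6
            proof -
              have t6: "t6 \<le> 3 * length T' + 2" by (rule prems3)
              have L6: "length T' \<le> length L6" "take (length T') L6 = T'" "length L6 \<le> \<rho>"
                using prems3 L' sh lens by (auto simp: shape_def s3_def)
              have time: "t2 + t4 + t6 + 4 \<le> 30 * size_bound\<^sup>2"
              proof -
                have "(\<rho> + 7) * length T \<le> (size_bound + 7) * size_bound"
                  using lens rank_le by (intro mult_mono) auto
                then show ?thesis
                  using t2 t4 t6 lenS lens rank_le by (simp add: power2_eq_square algebra_simps)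
              qed
              have L4: "length L' \<le> Suc \<rho>" using L' L sh lens by (auto simp: shape_def s3_def)
              have fin: "shape \<rho> (\<rho> * (z + 1)) s'" "stored s' S" "group_frame s s'"
                "nums s' 4 = [2 ^ z]" "nums s' 9 = [2 ^ q]" "wts s' 2 = [m]" "wts s' 4 = [v + c * real (length E)]"
                "nums s' 12 = [length T']" "elts s' 5 = L6"
                if "s' = s3\<lparr>nums := (nums s3)(8 := F, 7 := [length T'], 12 := [length T'], 6 := [length T'], 11 := [2 ^ (r + q * i) * 2 ^ q]),
                    elts := (elts s3)(4 := L', 5 := L6)\<rparr>" for s'
                using sh S reg rg F L4 L6(3) unfolding that
                by (auto simp: s3_def shape_def stored_def group_frame_def same_except_def mult.commute)
              have s6: "s6 = s3\<lparr>nums := (nums s3)(8 := F, 7 := [length T'], 12 := [length T'], 6 := [length T']),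
                  elts := (elts s3)(4 := L', 5 := L6)\<rparr>"
                using prems3 by simp
              have r6: "regs (nums s6)" using s3(7) F by (simp add: s6)
              have yq: "nums s6 11 = [2 ^ (r + q * i)]" "nums s6 9 = [2 ^ q]"
                using rg y by (simp_all add: s6 s3_def)
              define s7 where "s7 = s6\<lparr>nums := (nums s6)(11 := [2 ^ (r + q * i) * 2 ^ q])\<rparr>"
              have "holds_merged z m S q r (Suc i) T' (v + c * real (length E)) s7"
                using mg' L6 fin[of s7] by (simp add: holds_merged_def s7_def s6)
              moreover have "merge_state z m S q s7" "group_frame s s7"
                using fin[of s7] by (simp_all add: merge_state_def s7_def s6)
              moreover have "nums s7 11 = [2 ^ (r + q * Suc i)]"
                by (simp add: s7_def power_add mult.commute mult.left_commute)
              ultimately show ?thesis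
                using time r6 yq yB by (auto simp: s7_def)
            qed
            done
        qed
        done
    qed
    done
qed

lemma group_frame_trans: "group_frame s s' \<Longrightarrow> group_frame s' s'' \<Longrightarrow> group_frame s s''"
  by (simp add: group_frame_def same_except_def)

text \<open>The measure \<open>Suc z - (r + q * i)\<close> decreases since \<open>0 < q\<close>. The
  number \<open>i\<close> of rounds depends on \<open>r\<close>, which is why
  \<open>approximation_ratio\<close> lets it vary with the group.\<close>

lemma wp_merge_group:
  assumes ms: "maximal_seen \<I> k V G z" and VN: "V \<subseteq> N"
    and cl: "classes \<I> w V z m S" and Q: "2 * min k (card V) \<le> 2 ^ q" "0 < q" "2 ^ q \<le> 4 * size_bound"
    and st: "merge_state z m S q s" and r: "nums s 10 = [2 ^ r]" "r < q"
  shows "wp \<I> w B merge_group s (\<lambda>t s'. t \<le> 500 * size_bound ^ 4 \<and> merge_state z m S q s' \<and>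
     group_frame s s' \<and> (\<exists>i T v. z < r + q * i \<and> holds_merged z m S q r i T v s'))"
proof -
  define P where "P = (\<lambda>j s'. merge_state z m S q s' \<and> group_frame s s' \<and>
    (\<exists>i T v. nums s' 11 = [2 ^ (r + q * i)] \<and> holds_merged z m S q r i T v s' \<and> j = Suc z - (r + q * i)))"
  have reg: "regs (nums s)" "wregs (wts s)" using st by (auto simp: merge_state_def shape_def)
  have "(2::nat) ^ r \<le> 2 ^ q" using r(2) by simp
  then have rB: "(2::nat) ^ r \<le> B" using Q(3) B_lin by linarith
  have sq: "Suc z \<le> 16 * size_bound\<^sup>2" using exponent_le(2)[OF ms VN] by simp
  define s0 where "s0 = s\<lparr>wts := (wts s)(4 := [0]), nums := (nums s)(12 := [0], 11 := [2 ^ r])\<rparr>"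
  have "merging \<I> z m S q r 0 [] 0" by (rule merging_0) (rule k_extendible_system(3)[OF ext])
  then have "holds_merged z m S q r 0 [] 0 s0" by (simp add: holds_merged_def s0_def)
  moreover have "merge_state z m S q s0" "group_frame s s0"
    using st by (auto simp: merge_state_def s0_def shape_def stored_def group_frame_def same_except_def)
  moreover have "nums s0 11 = [2 ^ (r + q * 0)]" by (simp add: s0_def)
  ultimately have P0: "P (Suc z - (r + q * 0)) s0" unfolding P_def by blast
  have loop: "wp \<I> w B (While (BNot (NLess (reg 4) (reg 11))) merge_class) s0
    (\<lambda>t s'. t \<le> Suc z * Suc (30 * size_bound\<^sup>2) + 1 \<and> merge_state z m S q s' \<and> group_frame s s' \<and>
      (\<exists>i T v. z < r + q * i \<and> holds_merged z m S q r i T v s'))"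
  proof (rule wp_While[of P, OF P0])
    fix j s' assume P: "P j s'" and b: "bval s' (BNot (NLess (reg 4) (reg 11)))"
    from P obtain i T v where i: "nums s' 11 = [2 ^ (r + q * i)]" "holds_merged z m S q r i T v s'"
        "j = Suc z - (r + q * i)" and st': "merge_state z m S q s'" "group_frame s s'"
      unfolding P_def by blast
    have "(2::nat) ^ (r + q * i) \<le> 2 ^ z" using b st'(1) by (simp add: i(1) merge_state_def not_less)
    then have le: "r + q * i \<le> z" by (rule power_le_imp_le_exp[rotated]) simp
    show "wp \<I> w B merge_class s' (\<lambda>t s'. t \<le> 30 * size_bound\<^sup>2 \<and> (\<exists>i'<j. P i' s'))"
    proof (rule wp_mono[OF wp_merge_class[OF ms VN cl Q st'(1) i(2,1) le]], elim conjE exE)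
      fix t T v and s'' :: "'a state"
      assume *: "t \<le> 30 * size_bound\<^sup>2" "merge_state z m S q s''" "group_frame s' s''"
        "nums s'' 11 = [2 ^ (r + q * Suc i)]" "holds_merged z m S q r (Suc i) T v s''"
      have "P (Suc z - (r + q * Suc i)) s''"
        unfolding P_def using * group_frame_trans[OF st'(2)] by blast
      moreover have "Suc z - (r + q * Suc i) < j" using Q(2) le by (simp add: i(3))
      ultimately show "t \<le> 30 * size_bound\<^sup>2 \<and> (\<exists>i'<j. P i' s'')" using *(1) by blast
    qed
  next
    fix j s' t assume P: "P j s'" and b: "\<not> bval s' (BNot (NLess (reg 4) (reg 11)))"
      and t: "t \<le> (Suc z - (r + q * 0)) * Suc (30 * size_bound\<^sup>2) + 1"
    from P obtain i T v where i: "nums s' 11 = [2 ^ (r + q * i)]" "holds_merged z m S q r i T v s'"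
        and st': "merge_state z m S q s'" "group_frame s s'"
      unfolding P_def by blast
    have "(2::nat) ^ z < 2 ^ (r + q * i)" using b st'(1) by (simp add: i(1) merge_state_def)
    then have "z < r + q * i" by (rule power_less_imp_less_exp[rotated]) simp
    moreover have "(Suc z - (r + q * 0)) * Suc (30 * size_bound\<^sup>2) \<le> Suc z * Suc (30 * size_bound\<^sup>2)"
      by (intro mult_right_mono) auto
    ultimately show "t \<le> Suc z * Suc (30 * size_bound\<^sup>2) + 1 \<and> merge_state z m S q s' \<and> group_frame s s' \<and>
      (\<exists>i T v. z < r + q * i \<and> holds_merged z m S q r i T v s')"
      using t i(2) st' by (meson add_le_mono1 le_trans)
  qed
  have "Suc z * Suc (30 * size_bound\<^sup>2) \<le> (16 * size_bound\<^sup>2) * (31 * size_bound\<^sup>2)"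
    by (intro mult_mono sq) auto
  also have "(16 * a\<^sup>2) * (31 * a\<^sup>2) = 496 * a ^ 4" for a :: nat
    by (simp add: power2_eq_square power4_eq_xxxx)
  finally have time: "Suc z * Suc (30 * size_bound\<^sup>2) \<le> 496 * size_bound ^ 4" .
  have "1 \<le> size_bound ^ 4" by (rule one_le_power) simp
  with time have time: "Suc z * Suc (30 * size_bound\<^sup>2) + 1 + 3 \<le> 500 * size_bound ^ 4" by linarith
  have start: "wp \<I> w B merge_group s Q" if
    "wp \<I> w B (While (BNot (NLess (reg 4) (reg 11))) merge_class) s0 (\<lambda>t. Q (Suc (Suc (Suc t))))" for Q
    using that reg r(1) rB by (simp add: merge_group_def s0_def)
  show ?thesis
    by (rule start, rule wp_mono[OF loop]) (use time in auto)
qed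

text \<open>The outer loop runs through the residues \<open>r < q\<close>. Throughout, the best
  value dominates the totals of all groups treated so far, and array 0 holds an independent set of
  at least half that value.\<close>

lemma finish_correct:
  assumes rep: "represents s good G z m S"
  shows "wp \<I> w B finish s (\<lambda>t s'. t \<le> 2100 * size_bound ^ 5 \<and> shape \<rho> (\<rho> * (z + 1)) s' \<and>
     (\<exists>q. 2 ^ q \<le> 4 * k \<and> approximates (8 * real k * real q) \<I> w (output_set s')))"
proof -
  have ms: "maximal_seen \<I> k good G z" and cl: "classes \<I> w good z m S" and loss: "small_loss \<I> w good m S"
    and sh: "shape \<rho> (\<rho> * (z + 1)) s" and st: "stored s S"
    and rg: "nums s 0 = [k]" "nums s 14 = [card good]" "nums s 4 = [2 ^ z]" "wts s 2 = [m]"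
    using rep by (auto simp: represents_def)
  have reg: "regs (nums s)" "wregs (wts s)" using sh by (auto simp: shape_def)
  have cardg: "card good \<le> card N" by (rule card_mono[OF finite_N good_N])
  define p where "p = min k (card good)"
  have p: "p \<le> k" "p \<le> card N" using cardg by (auto simp: p_def)
  have emp: "{} \<in> \<I>" by (rule k_extendible_system(3)[OF ext])
  have A1: "1 \<le> size_bound ^ 4" "1 \<le> size_bound ^ 5" "size_bound \<le> size_bound ^ 4" "size_bound \<le> size_bound ^ 5"
    using power_increasing[of 1 4 size_bound] power_increasing[of 1 5 size_bound] by (simp_all add: one_le_power)
  have B0: "2 \<le> B" "4 * p \<le> B" "p \<le> B" "1 \<le> B" using B_lin p by simp_all
  define s1 where "s1 = s\<lparr>nums := (nums s)(9 := [2 ^ 1], 3 := [p])\<rparr>"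
  have grow: "wp \<I> w B (grow_power 9 (NMul (NConst 2) (reg 3))) s1 (\<lambda>t s'. t \<le> 2 * (2 * p) + 1 \<and>
     (\<exists>q\<ge>1. s' = s1\<lparr>nums := (nums s1)(9 := [2 ^ q])\<rparr> \<and> 2 * p \<le> 2 ^ q \<and> 2 ^ q \<le> max (2 ^ 1) (2 * (2 * p))))"
    by (rule wp_grow_power) (use reg B0 in \<open>simp_all add: s1_def\<close>)
  have loop: "wp \<I> w B (While (NLess (reg 10) (reg 9))
       (Seq merge_group
       (Seq (If (WLess (wreg 5) (wreg 4))
              (Seq (set_wreg 5 (wreg 4)) (Seq (set_reg 13 (reg 12)) (copy_elems 12 5 0))) Skip)
         (set_reg 10 (NMul (NConst 2) (reg 10)))))) s2
     (\<lambda>t s'. t \<le> q * Suc (510 * size_bound ^ 4) + 1 \<and> shape \<rho> (\<rho> * (z + 1)) s' \<and>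
       (\<exists>T. nums s' 13 = [length T] \<and> take (length T) (elts s' 0) = T \<and> length T \<le> \<rho> \<and>
         approximates (8 * real k * real q) \<I> w (set T)))" (is "wp \<I> w B (While ?b ?body) s2 ?Q")
    if q: "1 \<le> q" "2 * p \<le> 2 ^ q" "2 ^ q \<le> 4 * size_bound"
      and s2: "s2 = s\<lparr>wts := (wts s)(5 := [0]), nums := (nums s)(3 := [p], 9 := [2 ^ q], 13 := [0], 10 := [2 ^ 0])\<rparr>"
    for q s2
  proof -
    define P where "P = (\<lambda>j s'. merge_state z m S q s' \<and>
      (\<exists>r v T. r \<le> q \<and> nums s' 10 = [2 ^ r] \<and> wts s' 5 = [v] \<and> nums s' 13 = [length T] \<and>
        take (length T) (elts s' 0) = T \<and> distinct T \<and> set T \<in> \<I> \<and> v \<le> 2 * sum w (set T) \<and>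
        (\<forall>r'<r. \<exists>i. z < r' + q * i \<and> (\<Sum>i'<i. class_value z m S (r' + q * i')) \<le> v) \<and> j = q - r))"
    have "merge_state z m S q s2"
      using sh st rg by (auto simp: merge_state_def s2 shape_def stored_def)
    moreover have "nums s2 10 = [2 ^ 0]" "wts s2 5 = [0]" "nums s2 13 = [length []]"
      by (simp_all add: s2)
    ultimately have "P (q - 0) s2"
      unfolding P_def using emp by (intro conjI exI[of _ 0] exI[of _ "[]"]) auto
    then have P0: "P q s2" by simp
    show ?thesis
    proof (rule wp_While[of P, OF P0])
      fix j s' assume P: "P j s'" and b: "bval s' (NLess (reg 10) (reg 9))"
      from P obtain r v T where st': "merge_state z m S q s'" and r: "r \<le> q" "nums s' 10 = [2 ^ r]"
        and v: "wts s' 5 = [v]" and T: "nums s' 13 = [length T]"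
        "take (length T) (elts s' 0) = T" "distinct T" "set T \<in> \<I>" "v \<le> 2 * sum w (set T)"
        and best: "\<And>r'. r' < r \<Longrightarrow> \<exists>i. z < r' + q * i \<and> (\<Sum>i'<i. class_value z m S (r' + q * i')) \<le> v"
        and j: "j = q - r" unfolding P_def by blast
      have "(2::nat) ^ r < 2 ^ q" using b st' by (simp add: r(2) merge_state_def)
      then have rq: "r < q" by (rule power_less_imp_less_exp[rotated]) simp
      have "(2::nat) ^ Suc r \<le> 2 ^ q" using rq by (intro power_increasing) auto
      then have rB: "(2::nat) ^ Suc r \<le> B" using q(3) B_lin by linarith
      show "wp \<I> w B ?body s' (\<lambda>t s'. t \<le> 510 * size_bound ^ 4 \<and> (\<exists>i'<j. P i' s'))"
        apply (subst wp_Seq)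
      proof (rule wp_mono[OF wp_merge_group[OF ms good_N cl q(2)[unfolded p_def] _ q(3) st' r(2) rq]],
          use q(1) in simp, elim conjE exE)
        fix t i T' v' and s3 :: "'a state"
        assume t: "t \<le> 500 * size_bound ^ 4" and st3: "merge_state z m S q s3" and fr: "group_frame s' s3"
          and i: "z < r + q * i" and hm: "holds_merged z m S q r i T' v' s3"
        note f3 = same_exceptD[of "{6, 7, 8, 11, 12}" "nums s3" "nums s'"]
          same_exceptD[of "{3, 4}" "wts s3" "wts s'"] same_exceptD[of "{4, 5}" "elts s3" "elts s'"]
        have same: "same_except {6, 7, 8, 11, 12} (nums s3) (nums s')" "same_except {3, 4} (wts s3) (wts s')"
          "same_except {4, 5} (elts s3) (elts s')"
          using fr by (simp_all add: group_frame_def)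
        have reg3: "regs (nums s3)" "wregs (wts s3)" using st3 by (auto simp: merge_state_def shape_def)
        have mg: "merging \<I> z m S q r i T' v'" and T': "wts s3 4 = [v']" "nums s3 12 = [length T']"
          "length T' \<le> length (elts s3 5)" "take (length T') (elts s3 5) = T'"
          using hm by (auto simp: holds_merged_def)
        have T'I: "set T' \<in> \<I>" "distinct T'" "v' = (\<Sum>i'<i. class_value z m S (r + q * i'))"
          using mg by (auto simp: merging_def)
        have lenT': "length T' \<le> \<rho>" by (rule length_indep[OF T'I(1,2)])
        then have B3: "Suc (length T') \<le> B" "length T' \<le> B" using B_lin rank_le by simp_all
        have old: "wts s3 5 = [v]" "nums s3 10 = [2 ^ r]" "nums s3 13 = [length T]" "elts s3 0 = elts s' 0"
          using v r T same by (simp_all add: f3)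
        have better: "\<exists>i. z < r' + q * i \<and> (\<Sum>i'<i. class_value z m S (r' + q * i')) \<le> max v v'"
          if "r' < Suc r" for r'
        proof (cases "r' = r")
          case True
          then show ?thesis using i T'I(3) by (intro exI[of _ i]) auto
        next
          case False
          with that best[of r'] show ?thesis by (meson le_max_iff_disj less_SucE)
        qed
        have jless: "q - Suc r < j" using rq j by simp
        have t4: "t + (3 * \<rho> + 6) \<le> 510 * size_bound ^ 4" using t A1 rank_le by linarith
        show "wp \<I> w B (Seq (If (WLess (wreg 5) (wreg 4))
              (Seq (set_wreg 5 (wreg 4)) (Seq (set_reg 13 (reg 12)) (copy_elems 12 5 0))) Skip)
         (set_reg 10 (NMul (NConst 2) (reg 10)))) s3
          (\<lambda>t' s'. t + t' \<le> 510 * size_bound ^ 4 \<and> (\<exists>i'<j. P i' s'))"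
        proof (cases "v < v'")
          case False
          then have vv: "max v v' = v" by simp
          have "P (q - Suc r) (s3\<lparr>nums := (nums s3)(10 := [2 ^ Suc r])\<rparr>)"
            unfolding P_def using st3 old T rq better vv
            by (intro conjI exI[of _ "Suc r"] exI[of _ v] exI[of _ T])
              (auto simp: merge_state_def shape_def stored_def)
          then show ?thesis
            using False jless t4 rB by (auto simp: old T' reg3)
        next
          case True
          then have vv: "max v v' = v'" by simp
          have start: "wp \<I> w B (Seq (If (WLess (wreg 5) (wreg 4))
              (Seq (set_wreg 5 (wreg 4)) (Seq (set_reg 13 (reg 12)) (copy_elems 12 5 0))) Skip)
              (set_reg 10 (NMul (NConst 2) (reg 10)))) s3 R" if
            "wp \<I> w B (copy_elems 12 5 0) (s3\<lparr>wts := (wts s3)(5 := [v']), nums := (nums s3)(13 := [length T'])\<rparr>)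
              (\<lambda>t s'. wp \<I> w B (set_reg 10 (NMul (NConst 2) (reg 10))) s' (\<lambda>t'. R (Suc (Suc (Suc (t + t'))))))" for R
            using that True by (simp add: old T' reg3 B3)
          show ?thesis
          proof (rule start, rule wp_mono[OF wp_copy_elems[where n = "length T'"]])
            fix t1 and s4 :: "'a state"
            assume "t1 \<le> 3 * length T' + 2 \<and> (\<exists>L. s4 = s3\<lparr>wts := (wts s3)(5 := [v']), nums := (nums s3)(13 := [length T'])\<rparr>
               \<lparr>nums := (nums (s3\<lparr>wts := (wts s3)(5 := [v']), nums := (nums s3)(13 := [length T'])\<rparr>))(6 := [length T']),
                elts := (elts (s3\<lparr>wts := (wts s3)(5 := [v']), nums := (nums s3)(13 := [length T'])\<rparr>))(0 := L)\<rparr> \<and>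
              length T' \<le> length L \<and>
              take (length T') L = take (length T') (elts (s3\<lparr>wts := (wts s3)(5 := [v']), nums := (nums s3)(13 := [length T'])\<rparr>) 5) \<and>
              length L \<le> max (length (elts (s3\<lparr>wts := (wts s3)(5 := [v']), nums := (nums s3)(13 := [length T'])\<rparr>) 0)) (length T'))"
            then obtain L where t1: "t1 \<le> 3 * length T' + 2"
              and s4: "s4 = s3\<lparr>wts := (wts s3)(5 := [v']), nums := (nums s3)(13 := [length T'], 6 := [length T']),
                elts := (elts s3)(0 := L)\<rparr>"
              and L: "length T' \<le> length L" "take (length T') L = T'" "length L \<le> max (length (elts s3 0)) (length T')"
              using T' by auto
            have L\<rho>: "length L \<le> \<rho>" using L(3) lenT' st3 by (auto simp: merge_state_def shape_def)
            have "v' \<le> 2 * sum w (set T')" by (rule merging_weight[OF cl mg])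
            then have "P (q - Suc r) (s4\<lparr>nums := (nums s4)(10 := [2 ^ Suc r])\<rparr>)"
              unfolding P_def using st3 old T'I rq better vv L L\<rho>
              by (intro conjI exI[of _ "Suc r"] exI[of _ v'] exI[of _ T'])
                (auto simp: merge_state_def shape_def stored_def s4)
            then show "wp \<I> w B (set_reg 10 (NMul (NConst 2) (reg 10))) s4
                (\<lambda>t' s'. t + Suc (Suc (Suc (t1 + t'))) \<le> 510 * size_bound ^ 4 \<and> (\<exists>i'<j. P i' s'))"
              using jless t4 t1 lenT' rB reg3 by (auto simp: old s4)
          qed (use T' reg3 B3 in simp_all)
        qed
      qed
    next
      fix j s' t assume P: "P j s'" and b: "\<not> bval s' (NLess (reg 10) (reg 9))"
        and t: "t \<le> q * Suc (510 * size_bound ^ 4) + 1"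
      from P obtain r v T where st': "merge_state z m S q s'" and r: "r \<le> q" "nums s' 10 = [2 ^ r]"
        and v: "wts s' 5 = [v]" and T: "nums s' 13 = [length T]"
        "take (length T) (elts s' 0) = T" "distinct T" "set T \<in> \<I>" "v \<le> 2 * sum w (set T)"
        and best: "\<And>r'. r' < r \<Longrightarrow> \<exists>i. z < r' + q * i \<and> (\<Sum>i'<i. class_value z m S (r' + q * i')) \<le> v"
        unfolding P_def by blast
      have "(2::nat) ^ q \<le> 2 ^ r" using b st' by (simp add: r(2) merge_state_def)
      then have "q \<le> r" by (rule power_le_imp_le_exp[rotated]) simp
      then have "approximates (8 * real k * real q) \<I> w (set T)"
        using best q(1) by (intro approximation_ratio[OF ext k_pos w_nonneg good_def cl loss _ _ T(4,5)]) auto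
      then show "t \<le> q * Suc (510 * size_bound ^ 4) + 1 \<and> shape \<rho> (\<rho> * (z + 1)) s' \<and>
       (\<exists>T. nums s' 13 = [length T] \<and> take (length T) (elts s' 0) = T \<and> length T \<le> \<rho> \<and>
         approximates (8 * real k * real q) \<I> w (set T))"
        using t st' T length_indep[OF T(4,3)] unfolding merge_state_def by blast
    qed
  qed
  have start: "wp \<I> w B finish s R" if
    "wp \<I> w B (grow_power 9 (NMul (NConst 2) (reg 3))) s1 (\<lambda>t1 s1. wp \<I> w B
      (Seq (set_reg 13 (NConst 0)) (Seq (set_wreg 5 WZero) (Seq (set_reg 10 (NConst 1))
     (Seq (While (NLess (reg 10) (reg 9))
       (Seq merge_group
       (Seq (If (WLess (wreg 5) (wreg 4))
              (Seq (set_wreg 5 (wreg 4)) (Seq (set_reg 13 (reg 12)) (copy_elems 12 5 0))) Skip)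
         (set_reg 10 (NMul (NConst 2) (reg 10))))))
     (set_reg 0 (reg 13)))))) s1 (\<lambda>t2. R (Suc (Suc (t1 + t2)))))" for R
  proof -
    have "k - (k - card good) = p" by (auto simp: p_def)
    then show ?thesis
      unfolding finish_def
      apply (subst wp_Seq, subst wp_set_reg, simp add: reg)
      apply (subst wp_Seq, subst wp_set_reg, simp add: reg)
      apply (subst wp_Seq)
      using that B0 by (simp add: rg s1_def del: wp_Seq)
  qed
  show ?thesis
  proof (rule start, rule wp_mono[OF grow], elim conjE exE)
    fix t1 q and s3 :: "'a state"
    assume t1: "t1 \<le> 2 * (2 * p) + 1" and q: "1 \<le> q" "2 * p \<le> 2 ^ q" "2 ^ q \<le> max (2 ^ 1) (2 * (2 * p))"
      and s3: "s3 = s1\<lparr>nums := (nums s1)(9 := [2 ^ q])\<rparr>"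
    \<comment> \<open>The power is either the initial 2 or at most \<open>4 * p\<close>; both are at
      most \<open>4 * k\<close> because \<open>p \<le> k\<close> and
      \<open>1 \<le> k\<close>.\<close>
    have q4: "2 ^ q \<le> 4 * size_bound" "2 ^ q \<le> 4 * k" using q(3) p k_pos by auto
    define s2 where "s2 = s\<lparr>wts := (wts s)(5 := [0]), nums := (nums s)(3 := [p], 9 := [2 ^ q], 13 := [0], 10 := [2 ^ 0])\<rparr>"
    note lp = loop[OF q(1,2) q4(1) s2_def]
    have "q < 2 ^ q" by simp
    then have "q \<le> 4 * size_bound" using q4(1) by linarith
    then have "q * Suc (510 * size_bound ^ 4) \<le> (4 * size_bound) * (511 * size_bound ^ 4)"
      by (intro mult_mono) (use A1(1) in auto)
    also have "(4 * a) * (511 * a ^ 4) = 2044 * a ^ 5" for a :: nat using power_Suc[of a 4] by simp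
    finally have time: "t1 + q * Suc (510 * size_bound ^ 4) + 8 \<le> 2100 * size_bound ^ 5"
      using t1 A1 p by linarith
    have go: "wp \<I> w B
      (Seq (set_reg 13 (NConst 0)) (Seq (set_wreg 5 WZero) (Seq (set_reg 10 (NConst 1))
     (Seq c (set_reg 0 (reg 13)))))) s3 R" if
      "wp \<I> w B c s2 (\<lambda>t s'. wp \<I> w B (set_reg 0 (reg 13)) s' (\<lambda>t'. R (Suc (Suc (Suc (t + t'))))))" for c R
      using that reg B0 by (simp add: s3 s1_def s2_def fun_upd_twist[of 9 3])
    show "wp \<I> w B
      (Seq (set_reg 13 (NConst 0)) (Seq (set_wreg 5 WZero) (Seq (set_reg 10 (NConst 1))
     (Seq (While (NLess (reg 10) (reg 9))
       (Seq merge_group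
       (Seq (If (WLess (wreg 5) (wreg 4))
              (Seq (set_wreg 5 (wreg 4)) (Seq (set_reg 13 (reg 12)) (copy_elems 12 5 0))) Skip)
         (set_reg 10 (NMul (NConst 2) (reg 10))))))
     (set_reg 0 (reg 13)))))) s3 (\<lambda>t s'. Suc (Suc (t1 + t)) \<le> 2100 * size_bound ^ 5 \<and>
       shape \<rho> (\<rho> * (z + 1)) s' \<and>
       (\<exists>q. 2 ^ q \<le> 4 * k \<and> approximates (8 * real k * real q) \<I> w (output_set s')))"
    proof (rule go, rule wp_mono[OF lp], elim conjE exE)
      fix t T and s4 :: "'a state"
      assume t: "t \<le> q * Suc (510 * size_bound ^ 4) + 1" and sh4: "shape \<rho> (\<rho> * (z + 1)) s4"
        and T: "nums s4 13 = [length T]" "take (length T) (elts s4 0) = T" "length T \<le> \<rho>"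
          "approximates (8 * real k * real q) \<I> w (set T)"
      have TB: "length T \<le> B" using T(3) rank_le B_lin by simp
      define s5 where "s5 = s4\<lparr>nums := (nums s4)(0 := [length T])\<rparr>"
      have "output_set s5 = set T" using T(2) by (simp add: output_set_def s5_def)
      then have "\<exists>q. 2 ^ q \<le> 4 * k \<and> approximates (8 * real k * real q) \<I> w (output_set s5)"
        using T(4) q4(2) by auto
      moreover have "shape \<rho> (\<rho> * (z + 1)) s5" using sh4 by (auto simp: shape_def s5_def)
      moreover have "regs (nums s4)" using sh4 by (simp add: shape_def)
      ultimately show "wp \<I> w B (set_reg 0 (reg 13)) s4
          (\<lambda>t' s'. Suc (Suc (t1 + Suc (Suc (Suc (t + t'))))) \<le> 2100 * size_bound ^ 5 \<and>
            shape \<rho> (\<rho> * (z + 1)) s' \<and>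
            (\<exists>q. 2 ^ q \<le> 4 * k \<and> approximates (8 * real k * real q) \<I> w (output_set s')))"
        using t time TB T(1) by (simp add: s5_def)
    qed
  qed
qed

text \<open>The set of elements taken into account is \<open>good - set (pending s)\<close>, which
  is empty at the start and \<open>good\<close> when the stream is exhausted. The bound on
  \<open>2 ^ z\<close> is exported with both arguments of the minimum, as each leads to one of the
  space bounds.\<close>

lemma stream_program_correct:
  assumes xs: "distinct xs" "set xs = N"
  shows "wp \<I> w B stream_program (init k xs) (\<lambda>t s. t \<le> 2300 * size_bound ^ 5 \<and>
    (\<exists>z q. shape \<rho> (\<rho> * (z + 1)) s \<and> 2 ^ q \<le> 4 * k \<and>
      approximates (8 * real k * real q) \<I> w (output_set s) \<and>
      2 ^ z \<le> max 1 (16 * (min (k * \<rho>) (card N))\<^sup>2)))"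
proof -
  define s0 where "s0 = (init k xs)\<lparr>nums := (nums (init k xs))(14 := [0], 2 := [0], 4 := [1], 5 := [0]),
    wts := (wts (init k xs))(2 := [0])\<rparr>"
  define P where "P = (\<lambda>j s. j = length (pending s) \<and> distinct (pending s) \<and> set (pending s) \<subseteq> N \<and>
    (\<exists>G z m S. represents s (good - set (pending s)) G z m S))"
  have emp: "{} \<in> \<I>" by (rule k_extendible_system(3)[OF ext])
  have B1: "1 \<le> B" using B_lin by simp
  have s0: "pending s0 = xs" by (simp add: s0_def init_def)
  have "represents s0 {} [] 0 0 []"
    using emp by (auto simp: represents_def maximal_seen_def classes_def small_loss_def shape_def regs_def
        wregs_def stored_def s0_def init_def cls_def)
  moreover have "good - set (pending s0) = {}" using good_N xs s0 by auto
  ultimately have "represents s0 (good - set (pending s0)) [] 0 0 []" by (simp only:)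
  then have P0: "P (card N) s0" unfolding P_def using xs s0 distinct_card[OF xs(1)] by auto
  have loop: "wp \<I> w B (While More step) s0 (\<lambda>t s. t \<le> card N * Suc (150 * size_bound\<^sup>2) + 1 \<and>
    (\<exists>G z m S. represents s good G z m S))"
  proof (rule wp_While[of P, OF P0])
    fix j s assume P: "P j s" and "bval s More"
    then obtain u us where pend: "pending s = u # us" by (cases "pending s") auto
    from P obtain G z m S where rep: "represents s (good - set (pending s)) G z m S" unfolding P_def by blast
    have u: "u \<in> N" "u \<notin> good - set (pending s)" "u \<notin> set us" "distinct us" "set us \<subseteq> N"
      using P pend unfolding P_def by auto
    have eq: "(if u \<in> good then insert u (good - set (pending s)) else good - set (pending s)) = good - set us"
      using u(3) pend by auto
    show "wp \<I> w B step s (\<lambda>t s'. t \<le> 150 * size_bound\<^sup>2 \<and> (\<exists>i'<j. P i' s'))"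
    proof (rule wp_mono[OF wp_step[OF rep pend u(1,2)]], unfold eq)
      fix t and s' :: "'a state"
      assume "t \<le> 150 * size_bound\<^sup>2 \<and> pending s' = us \<and> (\<exists>G z m S. represents s' (good - set us) G z m S)"
      moreover from this have "P (length us) s'" using u unfolding P_def by simp
      moreover have "length us < j" using P pend unfolding P_def by simp
      ultimately show "t \<le> 150 * size_bound\<^sup>2 \<and> (\<exists>i'<j. P i' s')" by blast
    qed
  next
    fix j s t assume "P j s" "\<not> bval s More" "t \<le> card N * Suc (150 * size_bound\<^sup>2) + 1"
    then show "t \<le> card N * Suc (150 * size_bound\<^sup>2) + 1 \<and> (\<exists>G z m S. represents s good G z m S)"
      unfolding P_def by auto
  qed
  have r0: "regs (nums (init k xs))" "wregs (wts (init k xs))"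
    by (auto simp: init_def regs_def wregs_def)
  have start: "wp \<I> w B stream_program (init k xs) R" if
    "wp \<I> w B (While More step) s0 (\<lambda>t1 s1. wp \<I> w B finish s1
       (\<lambda>t2. R (Suc (Suc (Suc (Suc (Suc (t1 + t2))))))))" for R
    using that r0 B1 by (simp add: stream_program_def s0_def)
  show ?thesis
  proof (rule start, rule wp_mono[OF loop], elim conjE exE)
    fix t1 G z m S and s1 :: "'a state"
    assume t1: "t1 \<le> card N * Suc (150 * size_bound\<^sup>2) + 1" and rep: "represents s1 good G z m S"
    have ms: "maximal_seen \<I> k good G z" using rep by (simp add: represents_def)
    then have "length G \<le> \<rho>" by (intro length_indep) (auto simp: maximal_seen_def)
    moreover have "card good \<le> card N" by (rule card_mono[OF finite_N good_N])
    ultimately have "(min (k * length G) (card good))\<^sup>2 \<le> (min (k * \<rho>) (card N))\<^sup>2"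
      by (intro power_mono min.mono mult_left_mono) auto
    moreover have "(2::nat) ^ z \<le> max 1 (16 * (min (k * length G) (card good))\<^sup>2)"
      using ms by (simp add: maximal_seen_def)
    ultimately have z: "2 ^ z \<le> max 1 (16 * (min (k * \<rho>) (card N))\<^sup>2)" by linarith
    have "card N * Suc (150 * size_bound\<^sup>2) \<le> size_bound * (151 * size_bound\<^sup>2)"
      by (intro mult_mono) auto
    also have "a * (151 * a\<^sup>2) = 151 * a ^ 3" for a :: nat by (simp add: power2_eq_square power3_eq_cube)
    also have "size_bound ^ 3 \<le> size_bound ^ 5" by (intro power_increasing) auto
    finally have "card N * Suc (150 * size_bound\<^sup>2) \<le> 151 * size_bound ^ 5" by simp
    moreover have "1 \<le> size_bound ^ 5" by (rule one_le_power) simp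
    ultimately have t1': "t1 + 5 \<le> 200 * size_bound ^ 5" using t1 by linarith
    show "wp \<I> w B finish s1 (\<lambda>t2 s. Suc (Suc (Suc (Suc (Suc (t1 + t2))))) \<le> 2300 * size_bound ^ 5 \<and>
      (\<exists>z q. shape \<rho> (\<rho> * (z + 1)) s \<and> 2 ^ q \<le> 4 * k \<and>
        approximates (8 * real k * real q) \<I> w (output_set s) \<and>
        2 ^ z \<le> max 1 (16 * (min (k * \<rho>) (card N))\<^sup>2)))"
      by (rule wp_mono[OF finish_correct[OF rep]]) (use t1' z in auto)
  qed
qed

end

section \<open>Asymptotic bounds and the final theorem\<close>

lemma indep_rank_bounds:
  assumes "k_extendible k N \<I>"
  shows "A \<in> \<I> \<Longrightarrow> card A \<le> indep_rank \<I>" and "indep_rank \<I> \<le> card N"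
proof -
  have "\<I> \<subseteq> Pow N" using k_extendible_system(5)[OF assms] by auto
  then have fin: "finite (card ` \<I>)"
    using k_extendible_system(2)[OF assms] by (meson finite_Pow_iff finite_imageI finite_subset)
  then show "A \<in> \<I> \<Longrightarrow> card A \<le> indep_rank \<I>" by (simp add: indep_rank_def)
  show "indep_rank \<I> \<le> card N"
    unfolding indep_rank_def
  proof (subst Max_le_iff[OF fin])
    show "card ` \<I> \<noteq> {}" using k_extendible_system(3)[OF assms] by auto
    show "\<forall>a\<in>card ` \<I>. a \<le> card N"
      using card_mono[OF k_extendible_system(2)[OF assms] k_extendible_system(5)[OF assms]] by blast
  qed
qed

text \<open>Used with \<open>x\<close> the size of the ground set and with
  \<open>x = k * \<rho>\<close>, the two arguments of the minimum that bounds the rank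
  estimate.\<close>

lemma exponent_le_log:
  assumes "(2::nat) ^ z \<le> max 1 (16 * p\<^sup>2)" "p \<le> x" "1 \<le> x"
  shows "real z \<le> 4 + 2 * log 2 (real x)"
proof -
  have "p\<^sup>2 \<le> x\<^sup>2" using assms(2) by (intro power_mono) auto
  moreover have "1 \<le> x\<^sup>2" using assms(3) by simp
  ultimately have "2 ^ z \<le> 16 * x\<^sup>2" using assms(1) by linarith
  then have "real (2 ^ z) \<le> real (16 * x\<^sup>2)" by (simp only: of_nat_le_iff)
  then have "log 2 (2 ^ z) \<le> log 2 (16 * real x ^ 2)" using assms(3) by (subst log_le_cancel_iff) auto
  also have "\<dots> = log 2 (2 ^ 4) + log 2 (real x ^ 2)" using assms(3) by (simp add: log_mult)
  also have "\<dots> = 4 + 2 * log 2 (real x)" using assms(3) by (simp add: log_nat_power del: power_numeral)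
  finally show ?thesis by (simp add: log_nat_power)
qed

text \<open>\<open>L\<close> is one of the two logarithms. It can fall below 1 only for
  \<open>\<rho> \<le> 1\<close>, so \<open>\<rho> \<le> 1 + \<rho> * L\<close>. The 37 is the
  constant 23 plus the coefficient \<open>4 + 2 * 5\<close> of \<open>\<rho>\<close>.\<close>

lemma cells_le:
  fixes L :: real
  assumes "real n \<le> 23 + 4 * real \<rho> + 2 * (real \<rho> * (real z + 1))" and "real z \<le> 4 + 2 * L"
    and "2 \<le> \<rho> \<Longrightarrow> 1 \<le> L" "0 \<le> L"
  shows "real n \<le> 37 * (1 + real \<rho> * L)"
proof -
  have "real \<rho> * (real z + 1) \<le> real \<rho> * (5 + 2 * L)" using assms(2) by (intro mult_left_mono) auto
  moreover have "real \<rho> \<le> 1 + real \<rho> * L"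
  proof (cases "2 \<le> \<rho>")
    case True
    then have "real \<rho> * 1 \<le> real \<rho> * L" using assms(3) by (intro mult_left_mono) auto
    then show ?thesis by simp
  next
    case False
    then have "real \<rho> \<le> 1" by simp
    moreover have "0 \<le> real \<rho> * L" using assms(4) by simp
    ultimately show ?thesis by linarith
  qed
  moreover have "0 \<le> real \<rho> * L" using assms(4) by simp
  ultimately show ?thesis using assms(1) by (simp add: algebra_simps)
qed

lemma ratio_bigo: "(\<lambda>k. 8 * real k * (2 + log 2 (real k))) \<in> O(\<lambda>k. real k * ln (real k))"
proof (rule bigoI)
  show "\<forall>\<^sub>F k in at_top. norm (8 * real k * (2 + log 2 (real k))) \<le>
    (8 * (2 + 1 / ln 2)) * norm (real k * ln (real k))"
  proof (rule eventually_at_top_linorderI[of 3])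
    fix k :: nat assume k: "3 \<le> k"
    \<comment> \<open>From 3 on \<open>ln k\<close> is at least 1 and absorbs the additive constant
      2.\<close>
    have "exp 1 \<le> real k" using exp_le k by linarith
    then have ln: "1 \<le> ln (real k)" using k by (subst ln_ge_iff) auto
    have "2 + log 2 (real k) \<le> 2 * ln (real k) + ln (real k) / ln 2" using ln by (simp add: log_def)
    also have "\<dots> = (2 + 1 / ln 2) * ln (real k)" by (simp add: algebra_simps)
    finally have "8 * real k * (2 + log 2 (real k)) \<le> 8 * real k * ((2 + 1 / ln 2) * ln (real k))"
      by (intro mult_left_mono) auto
    moreover have "0 \<le> log 2 (real k)" using k by simp
    ultimately show "norm (8 * real k * (2 + log 2 (real k))) \<le>
        (8 * (2 + 1 / ln 2)) * norm (real k * ln (real k))"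
      using ln by (simp add: abs_mult algebra_simps)
  qed
qed

lemma approximates_mono:
  assumes "approximates \<alpha> \<I> w T" "\<alpha> \<le> \<beta>" "0 \<le> sum w T"
  shows "approximates \<beta> \<I> w T"
proof -
  have "\<alpha> * sum w T \<le> \<beta> * sum w T" using assms(2,3) by (rule mult_right_mono)
  then show ?thesis using assms(1) unfolding approximates_def by fastforce
qed

theorem theorem1p1:
  shows "\<exists>(P :: com) (\<alpha> :: nat \<Rightarrow> real) (C :: real) (d :: nat).
    \<alpha> \<in> O(\<lambda>k. real k * ln (real k)) \<and>
    (\<forall>k N (\<I> :: 'a set set) w xs.
       1 \<le> k \<and> k_extendible k N \<I> \<and> (\<forall>u\<in>N. 0 \<le> w u) \<and> distinct xs \<and> set xs = N \<longrightarrow>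
       (\<exists>t s. exec \<I> w ((card N + k + 2) ^ d) P (init k xs) t s \<and>
          approximates (\<alpha> k) \<I> w (output_set s) \<and>
          real t \<le> C * real (card N + 1) ^ d \<and>
          real (num_cells s) \<le> C * (1 + real (indep_rank \<I>) * log 2 (real (card N)) ^ d) \<and>
          real (num_cells s) \<le>
            C * (1 + real (indep_rank \<I>) * (log 2 (real k) + log 2 (real (indep_rank \<I>))))))"
proof (rule exI[of _ stream_program], rule exI[of _ "\<lambda>k. 8 * real k * (2 + log 2 (real k))"],
    rule exI[of _ 2300], rule exI[of _ 7], intro conjI allI impI)
  show "(\<lambda>k. 8 * real k * (2 + log 2 (real k))) \<in> O(\<lambda>k. real k * ln (real k))" by (rule ratio_bigo)
  fix k N xs and \<I> :: "'a set set" and w :: "'a \<Rightarrow> real"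
  assume h: "1 \<le> k \<and> k_extendible k N \<I> \<and> (\<forall>u\<in>N. 0 \<le> w u) \<and> distinct xs \<and> set xs = N"
  define \<rho> where "\<rho> = indep_rank \<I>"
  define B where "B = (card N + k + 2) ^ 7"
  have ext: "k_extendible k N \<I>" and k: "1 \<le> k" using h by auto
  \<comment> \<open>The base is at least 3, so four of its seven factors are worth
    \<open>81 \<ge> 64\<close>; the other three cover the cube.\<close>
  have "64 * (card N + 1) ^ 3 \<le> B"
  proof -
    have "(3::nat) ^ 4 \<le> (card N + k + 2) ^ 4" using k by (intro power_mono) auto
    then have "64 \<le> (card N + k + 2) ^ 4" by simp
    moreover have "(card N + 1) ^ 3 \<le> (card N + k + 2) ^ 3" by (intro power_mono) auto
    ultimately have "64 * (card N + 1) ^ 3 \<le> (card N + k + 2) ^ 4 * (card N + k + 2) ^ 3"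
      by (rule mult_mono) auto
    then show ?thesis by (simp add: B_def flip: power_add)
  qed
  then interpret extendible_stream k N \<I> w \<rho> B
    using h indep_rank_bounds[OF ext] by unfold_locales (auto simp: \<rho>_def)
  from stream_program_correct[of xs] h obtain t s z q where
    ex: "exec \<I> w B stream_program (init k xs) t s" and t: "t \<le> 2300 * (card N + 1) ^ 5"
    and sh: "shape \<rho> (\<rho> * (z + 1)) s" and q: "2 ^ q \<le> 4 * k"
    and appr: "approximates (8 * real k * real q) \<I> w (output_set s)"
    and z: "2 ^ z \<le> max 1 (16 * (min (k * \<rho>) (card N))\<^sup>2)"
    unfolding wp_def by blast
  have cells: "real (num_cells s) \<le> 23 + 4 * real \<rho> + 2 * (real \<rho> * (real z + 1))"
  proof -
    have "real (num_cells s) \<le> real (23 + 4 * \<rho> + 2 * (\<rho> * (z + 1)))"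
      by (simp only: of_nat_le_iff num_cells_shape[OF sh])
    then show ?thesis by (simp add: algebra_simps)
  qed
  have "real (2 ^ q) \<le> real (4 * k)" using q by (simp only: of_nat_le_iff)
  then have "log 2 (2 ^ q) \<le> log 2 (2\<^sup>2 * real k)" using k by (subst log_le_cancel_iff) auto
  also have "\<dots> = log 2 (2\<^sup>2) + log 2 (real k)" using k by (subst log_mult) auto
  also have "\<dots> = 2 + log 2 (real k)" by (simp add: log_nat_power del: power_numeral)
  finally have "real q \<le> 2 + log 2 (real k)" by (simp add: log_nat_power)
  then have "8 * real k * real q \<le> 8 * real k * (2 + log 2 (real k))" by (intro mult_left_mono) auto
  moreover have "output_set s \<in> \<I>" using appr by (simp add: approximates_def)
  then have "0 \<le> sum w (output_set s)"
    using k_extendible_system(5)[OF ext] w_nonneg by (intro sum_nonneg) blast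
  ultimately have ratio: "approximates (8 * real k * (2 + log 2 (real k))) \<I> w (output_set s)"
    using appr approximates_mono by blast
  have "(card N + 1) ^ 5 \<le> (card N + 1) ^ 7" by (intro power_increasing) auto
  then have "t \<le> 2300 * (card N + 1) ^ 7" using t by linarith
  then have "real t \<le> real (2300 * (card N + 1) ^ 7)" by (simp only: of_nat_le_iff)
  then have time: "real t \<le> 2300 * real (card N + 1) ^ 7" by simp
  \<comment> \<open>For \<open>n = 0\<close> this rests on the convention
    \<open>ln 0 = 0\<close>.\<close>
  have pos: "0 \<le> log 2 (real n)" for n :: nat by (cases n) (auto simp: log_def)
  have big: "1 \<le> log 2 (real n)" if "2 \<le> n" for n :: nat using that by (simp add: le_log_iff)
  have space1: "real (num_cells s) \<le> 37 * (1 + real \<rho> * log 2 (real (card N)))"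
  proof (cases "\<rho> = 0")
    case True
    then show ?thesis using cells by simp
  next
    case False
    then have "1 \<le> card N" using rank_le by linarith
    then have "real z \<le> 4 + 2 * log 2 (real (card N))"
      by (intro exponent_le_log[OF z]) auto
    then show ?thesis
      by (rule cells_le[OF cells]) (use big[of "card N"] rank_le pos in auto)
  qed
  have space2: "real (num_cells s) \<le> 37 * (1 + real \<rho> * (log 2 (real k) + log 2 (real \<rho>)))"
  proof (cases "\<rho> = 0")
    case True
    then show ?thesis using cells by simp
  next
    case False
    then have "real z \<le> 4 + 2 * log 2 (real (k * \<rho>))"
      using k by (intro exponent_le_log[OF z]) auto
    also have "log 2 (real (k * \<rho>)) = log 2 (real k) + log 2 (real \<rho>)"
      using k False by (simp add: log_mult)
    finally show ?thesis
    proof (rule cells_le[OF cells])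
      show "1 \<le> log 2 (real k) + log 2 (real \<rho>)" if "2 \<le> \<rho>" using big[OF that] pos[of k] by linarith
      show "0 \<le> log 2 (real k) + log 2 (real \<rho>)" using pos[of k] pos[of \<rho>] by linarith
    qed
  qed
  \<comment> \<open>The single exponent 7 serves the range of numbers, the time and the
    polylogarithm, so the logarithm is replaced by its seventh power. This is harmless because the
    logarithm is at least 1 or, for \<open>card N \<le> 1\<close>, equal to 0.\<close>
  have "log 2 (real (card N)) \<le> log 2 (real (card N)) ^ 7"
  proof (cases "2 \<le> card N")
    case True
    from power_increasing[OF _ big[OF this], of 1 7] show ?thesis by simp
  next
    case False
    then have "card N = 0 \<or> card N = 1" by linarith
    then show ?thesis by (auto simp: log_def)
  qed
  then have "real \<rho> * log 2 (real (card N)) \<le> real \<rho> * log 2 (real (card N)) ^ 7"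
    by (intro mult_left_mono) auto
  moreover have "0 \<le> real \<rho> * log 2 (real (card N))" "0 \<le> real \<rho> * (log 2 (real k) + log 2 (real \<rho>))"
    using pos by (auto intro!: mult_nonneg_nonneg add_nonneg_nonneg)
  moreover have "a \<le> 2300 * (1 + y)" if "a \<le> 37 * (1 + x)" "0 \<le> x" "x \<le> y" for a x y :: real
  proof -
    have "37 * (1 + x) \<le> 2300 * (1 + y)" using that by (intro mult_mono) auto
    with that(1) show ?thesis by simp
  qed
  ultimately have
    "real (num_cells s) \<le> 2300 * (1 + real \<rho> * log 2 (real (card N)) ^ 7)"
    "real (num_cells s) \<le> 2300 * (1 + real \<rho> * (log 2 (real k) + log 2 (real \<rho>)))"
    using space1 space2 by blast+
  with ex ratio time show "\<exists>t s. exec \<I> w ((card N + k + 2) ^ 7) stream_program (init k xs) t s \<and>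
      approximates (8 * real k * (2 + log 2 (real k))) \<I> w (output_set s) \<and>
      real t \<le> 2300 * real (card N + 1) ^ 7 \<and>
      real (num_cells s) \<le> 2300 * (1 + real (indep_rank \<I>) * log 2 (real (card N)) ^ 7) \<and>
      real (num_cells s) \<le>
        2300 * (1 + real (indep_rank \<I>) * (log 2 (real k) + log 2 (real (indep_rank \<I>))))"
    unfolding B_def \<rho>_def by blast
qed

end
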